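(* Assume that $\mathsf a>0$ and $\mathsf a\ne\frac14$, and consider on $L^2(\mathbb R^2)$ the operator $$\mathcal K_{\mathsf a}=v\partial_x-\mathsf a x\partial_v-\partial_v^2+\frac{v^2}{4}-\frac12 .$$ Let $\mu_\pm=\frac{1\pm\sqrt{1-4\mathsf a}}{2}$ if $\mathsf a\in(0,\frac14)$ and $\mu_\pm=\frac{1\pm i\sqrt{4\mathsf a-1}}{2}$ if $\mathsf a\in(\frac14,+\infty)$. Then $$\mathrm{Sp}(\mathcal K_{\mathsf a})=\big\{k\mu_++\ell\mu_-\ \big|\ (k,\ell)\in\mathbb N^2\big\},$$ $$\mathrm{mult}(z_j)=\#\big\{(k,\ell)\in\mathbb N^2\ \big|\ k\mu_++\ell\mu_-=z_j\big\},\qquad z_j\in\mathrm{Sp}(\mathcal K_{\mathsf a}),$$ $$\mathcal N_{\mathcal K_{\mathsf a}}(\lambda)=\#\big\{(k,\ell)\in\mathbb N^2\ \big|\ \mathrm{Re}(k\mu_++\ell\mu_-)\le\lambda\big\}.$$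
   Context: $\mathbb N=\{0,1,2,\dots\}$. Points of $\mathbb R^2$ are written $(x,v)$. $\mathcal K_{\mathsf a}$ denotes the closed operator on $L^2(\mathbb R^2)$ with domain $\{f\in L^2:\mathcal K_{\mathsf a}f\in L^2\}$ (distributional sense), which is the closure of the differential operator on $C_c^\infty(\mathbb R^2)$. $\mathrm{mult}(z_j)$ is the algebraic multiplicity of the isolated eigenvalue $z_j$, i.e. the rank of the Riesz projector $\frac{i}{2\pi}\oint_{|z-z_j|=\varepsilon}(\mathcal K_{\mathsf a}-z)^{-1}dz$ (small counterclockwise circle enclosing no other point of the spectrum). For $\lambda\in\mathbb R$, $\mathcal N_{\mathcal K_{\mathsf a}}(\lambda)=\sum_{z_j\in\mathrm{Sp}(\mathcal K_{\mathsf a}),\ \mathrm{Re}(z_j)\le\lambda}\mathrm{mult}(z_j)$. *)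

theory Defs
  imports "HOL-Analysis.Analysis" "HOL-Library.Extended_Nat"
begin

section \<open>The complex Hilbert space of square integrable functions on the plane\<close>

definition square_integrable :: "(real \<times> real \<Rightarrow> complex) \<Rightarrow> bool" where
  "square_integrable f \<longleftrightarrow>
     f \<in> borel_measurable lborel \<and> integrable lborel (\<lambda>p. (cmod (f p))\<^sup>2)"

definition L2_rel :: "(real \<times> real \<Rightarrow> complex) \<Rightarrow> (real \<times> real \<Rightarrow> complex) \<Rightarrow> bool" where
  "L2_rel f g \<longleftrightarrow> square_integrable f \<and> square_integrable g \<and> (AE p in lborel. f p = g p)"

lemma square_integrable_0: "square_integrable (\<lambda>_. 0)"
  by (simp add: square_integrable_def)

lemma square_integrable_measurable [measurable_dest]:
  "square_integrable f \<Longrightarrow> f \<in> borel_measurable lborel"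
  by (simp add: square_integrable_def)

lemma square_integrable_add:
  assumes "square_integrable f" "square_integrable g"
  shows "square_integrable (\<lambda>p. f p + g p)"
  unfolding square_integrable_def
proof
  have [measurable]: "f \<in> borel_measurable lborel" "g \<in> borel_measurable lborel"
    using assms by (auto simp: square_integrable_def)
  show "(\<lambda>p. f p + g p) \<in> borel_measurable lborel" by measurable
  have "integrable lborel (\<lambda>p. 2 * (cmod (f p))\<^sup>2 + 2 * (cmod (g p))\<^sup>2)"
    using assms by (auto simp: square_integrable_def)
  then show "integrable lborel (\<lambda>p. (cmod (f p + g p))\<^sup>2)"
  proof (rule Bochner_Integration.integrable_bound)
    have "(cmod (a + b))\<^sup>2 \<le> 2 * (cmod a)\<^sup>2 + 2 * (cmod b)\<^sup>2" for a b
    proof -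
      have "(cmod (a + b))\<^sup>2 \<le> (cmod a + cmod b)\<^sup>2"
        by (intro power_mono norm_triangle_ineq) auto
      also have "\<dots> \<le> 2 * (cmod a)\<^sup>2 + 2 * (cmod b)\<^sup>2"
        using sum_squares_bound[of "cmod a" "cmod b"] by (simp add: power2_sum)
      finally show ?thesis .
    qed
    then show "AE p in lborel. norm ((cmod (f p + g p))\<^sup>2)
        \<le> norm (2 * (cmod (f p))\<^sup>2 + 2 * (cmod (g p))\<^sup>2)" by simp
  qed measurable
qed

lemma square_integrable_scale:
  "square_integrable f \<Longrightarrow> square_integrable (\<lambda>p. c * f p)"
  by (auto simp: square_integrable_def norm_mult power_mult_distrib)

lemma square_integrable_scaleR:
  "square_integrable f \<Longrightarrow> square_integrable (\<lambda>p. c *\<^sub>R f p)"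
  by (auto simp: square_integrable_def power_mult_distrib)

lemma square_integrable_minus:
  "square_integrable f \<Longrightarrow> square_integrable (\<lambda>p. - f p)"
  by (auto simp: square_integrable_def)

lemma square_integrable_diff:
  "square_integrable f \<Longrightarrow> square_integrable g \<Longrightarrow> square_integrable (\<lambda>p. f p - g p)"
  using square_integrable_add[OF _ square_integrable_minus] by force

lemma integrable_inner:
  assumes "square_integrable f" "square_integrable g"
  shows "integrable lborel (\<lambda>p. f p \<bullet> g p)"
proof -
  have [measurable]: "f \<in> borel_measurable lborel" "g \<in> borel_measurable lborel"
    using assms by (auto simp: square_integrable_def)
  have "integrable lborel (\<lambda>p. (cmod (f p))\<^sup>2 + (cmod (g p))\<^sup>2)"
    using assms by (auto simp: square_integrable_def)
  then show ?thesis
  proof (rule Bochner_Integration.integrable_bound)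
    have "\<bar>a \<bullet> b\<bar> \<le> (cmod a)\<^sup>2 + (cmod b)\<^sup>2" for a b :: complex
    proof -
      have "0 \<le> cmod a * cmod b" "2 * (cmod a * cmod b) \<le> (cmod a)\<^sup>2 + (cmod b)\<^sup>2"
        using sum_squares_bound[of "cmod a" "cmod b"] by (simp_all add: mult.assoc)
      with Cauchy_Schwarz_ineq2[of a b] show ?thesis by linarith
    qed
    then show "AE p in lborel. norm (f p \<bullet> g p) \<le> norm ((cmod (f p))\<^sup>2 + (cmod (g p))\<^sup>2)"
      by simp
  qed measurable
qed

quotient_type L2 = "real \<times> real \<Rightarrow> complex" / partial: L2_rel
proof (rule part_equivpI)
  show "\<exists>f. L2_rel f f"
    using square_integrable_0 by (intro exI[of _ "\<lambda>_. 0"]) (simp add: L2_rel_def)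
  show "symp L2_rel"
    by (rule sympI) (auto simp: L2_rel_def)
  show "transp L2_rel"
    by (rule transpI) (auto simp: L2_rel_def)
qed

instantiation L2 :: real_vector
begin

lift_definition zero_L2 :: L2 is "\<lambda>_. 0"
  by (simp add: L2_rel_def square_integrable_0)

lift_definition plus_L2 :: "L2 \<Rightarrow> L2 \<Rightarrow> L2" is "\<lambda>f g p. f p + g p"
  by (auto simp: L2_rel_def square_integrable_add)

lift_definition uminus_L2 :: "L2 \<Rightarrow> L2" is "\<lambda>f p. - f p"
  by (auto simp: L2_rel_def square_integrable_minus)

lift_definition minus_L2 :: "L2 \<Rightarrow> L2 \<Rightarrow> L2" is "\<lambda>f g p. f p - g p"
  by (auto simp: L2_rel_def square_integrable_diff)

lift_definition scaleR_L2 :: "real \<Rightarrow> L2 \<Rightarrow> L2" is "\<lambda>c f p. c *\<^sub>R f p"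
  by (auto simp: L2_rel_def square_integrable_scaleR)

instance
proof
  fix f g h :: L2 and a b :: real
  show "f + g + h = f + (g + h)"
    by transfer (auto simp: L2_rel_def square_integrable_add add_ac)
  show "f + g = g + f"
    by transfer (auto simp: L2_rel_def square_integrable_add add_ac)
  show "0 + f = f"
    by transfer (auto simp: L2_rel_def)
  show "- f + f = 0"
    by transfer (auto simp: L2_rel_def square_integrable_0)
  show "f - g = f + - g"
    by transfer (auto simp: L2_rel_def square_integrable_diff)
  show "a *\<^sub>R (f + g) = a *\<^sub>R f + a *\<^sub>R g"
    by transfer (auto simp: L2_rel_def algebra_simps square_integrable_add square_integrable_scaleR)
  show "(a + b) *\<^sub>R f = a *\<^sub>R f + b *\<^sub>R f"
    by transfer (auto simp: L2_rel_def algebra_simps square_integrable_add square_integrable_scaleR)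
  show "a *\<^sub>R b *\<^sub>R f = (a * b) *\<^sub>R f"
    by transfer (auto simp: L2_rel_def algebra_simps square_integrable_scaleR)
  show "1 *\<^sub>R f = f"
    by transfer (auto simp: L2_rel_def)
qed

end

instantiation L2 :: real_inner
begin

(* the real part of the usual hermitian inner product *)
lift_definition inner_L2 :: "L2 \<Rightarrow> L2 \<Rightarrow> real" is
  "\<lambda>f g. LINT p|lborel. f p \<bullet> g p"
  by (rule integral_cong_AE) (auto simp: L2_rel_def square_integrable_def)

definition norm_L2 :: "L2 \<Rightarrow> real" where "norm_L2 f = sqrt (f \<bullet> f)"
definition sgn_L2 :: "L2 \<Rightarrow> L2" where "sgn_L2 f = f /\<^sub>R norm f"
definition dist_L2 :: "L2 \<Rightarrow> L2 \<Rightarrow> real" where "dist_L2 f g = norm (f - g)"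
definition uniformity_L2 :: "(L2 \<times> L2) filter" where
  "(uniformity_L2 :: (L2 \<times> L2) filter) = (INF e\<in>{0<..}. principal {(f, g). dist f g < e})"
definition open_L2 :: "L2 set \<Rightarrow> bool" where
  "open_L2 U = (\<forall>x\<in>U. \<forall>\<^sub>F (x', y) in uniformity. x' = x \<longrightarrow> y \<in> U)"

instance
proof
  fix f g h :: L2 and a :: real and U :: "L2 set"
  show "dist f g = norm (f - g)" by (rule dist_L2_def)
  show "sgn f = f /\<^sub>R norm f" by (rule sgn_L2_def)
  show "(uniformity :: (L2 \<times> L2) filter) = (INF e\<in>{0<..}. principal {(f, g). dist f g < e})"
    by (rule uniformity_L2_def)
  show "open U = (\<forall>x\<in>U. \<forall>\<^sub>F (x', y) in uniformity. x' = x \<longrightarrow> y \<in> U)" by (rule open_L2_def)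
  show "f \<bullet> g = g \<bullet> f"
    by transfer (simp add: inner_commute)
  show "(f + g) \<bullet> h = f \<bullet> h + g \<bullet> h"
    by transfer (simp add: inner_add_left L2_rel_def integrable_inner)
  show "(a *\<^sub>R f) \<bullet> g = a * (f \<bullet> g)"
    by transfer simp
  show "0 \<le> f \<bullet> f"
    by transfer simp
  show "f \<bullet> f = 0 \<longleftrightarrow> f = 0"
  proof transfer
    fix f :: "real \<times> real \<Rightarrow> complex"
    assume f: "L2_rel f f"
    then have "integrable lborel (\<lambda>p. f p \<bullet> f p)"
      by (simp add: L2_rel_def integrable_inner)
    then have "(LINT p|lborel. f p \<bullet> f p) = 0 \<longleftrightarrow> (AE p in lborel. f p \<bullet> f p = 0)"
      by (intro integral_nonneg_eq_0_iff_AE) auto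
    with f show "(LINT p|lborel. f p \<bullet> f p) = 0 \<longleftrightarrow> L2_rel f (\<lambda>_. 0)"
      by (simp add: L2_rel_def square_integrable_0)
  qed
  show "norm f = sqrt (f \<bullet> f)" by (rule norm_L2_def)
qed

end

lift_definition scaleC :: "complex \<Rightarrow> L2 \<Rightarrow> L2" (infixr "*\<^sub>C" 75) is "\<lambda>c f p. c * f p"
  by (auto simp: L2_rel_def square_integrable_scale)

global_interpretation L2: vector_space scaleC
  defines L2_span = L2.span and L2_dim = L2.dim
proof
  fix f g :: L2 and a b :: complex
  show "a *\<^sub>C (f + g) = a *\<^sub>C f + a *\<^sub>C g"
    by transfer (auto simp: L2_rel_def algebra_simps square_integrable_add square_integrable_scale)
  show "(a + b) *\<^sub>C f = a *\<^sub>C f + b *\<^sub>C f"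
    by transfer (auto simp: L2_rel_def algebra_simps square_integrable_add square_integrable_scale)
  show "a *\<^sub>C b *\<^sub>C f = (a * b) *\<^sub>C f"
    by transfer (auto simp: L2_rel_def algebra_simps square_integrable_scale)
  show "1 *\<^sub>C f = f"
    by transfer (auto simp: L2_rel_def)
qed

lemma norm_scaleC: "norm (c *\<^sub>C f) = cmod c * norm f"
proof -
  have *: "(c * z) \<bullet> (c * z) = (cmod c)\<^sup>2 * (z \<bullet> z)" for c z :: complex
    by (simp add: power2_norm_eq_inner[symmetric] norm_mult power_mult_distrib)
  have "(c *\<^sub>C f) \<bullet> (c *\<^sub>C f) = (cmod c)\<^sup>2 * (f \<bullet> f)"
    by transfer (simp only: * integral_mult_right_zero)
  then show ?thesis by (simp add: norm_eq_sqrt_inner real_sqrt_mult)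
qed

lemma bounded_linear_scaleC: "bounded_linear (scaleC c)"
proof (rule bounded_linear_intro[where K = "cmod c"])
  fix f g and r :: real
  show "c *\<^sub>C (f + g) = c *\<^sub>C f + c *\<^sub>C g" by (rule L2.scale_right_distrib)
  show "c *\<^sub>C r *\<^sub>R f = r *\<^sub>R c *\<^sub>C f"
    by transfer (auto simp: L2_rel_def square_integrable_scale square_integrable_scaleR)
  show "norm (c *\<^sub>C f) \<le> norm f * cmod c" by (simp add: norm_scaleC)
qed

lemma norm_abs_L2:
  assumes "square_integrable f"
  shows "ennreal ((norm (abs_L2 f))\<^sup>2) = (\<integral>\<^sup>+p. ennreal ((cmod (f p))\<^sup>2) \<partial>lborel)"
proof -
  have "(norm (abs_L2 f))\<^sup>2 = abs_L2 f \<bullet> abs_L2 f"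
    by (simp add: power2_norm_eq_inner)
  also have "\<dots> = (LINT p|lborel. f p \<bullet> f p)"
    using assms by (subst inner_L2.abs_eq) (auto simp: eq_onp_def L2_rel_def)
  also have "\<dots> = (LINT p|lborel. (cmod (f p))\<^sup>2)"
    by (simp add: power2_norm_eq_inner)
  finally show ?thesis
    using assms by (subst nn_integral_eq_integral) (auto simp: square_integrable_def)
qed

instance L2 :: banach
proof
  fix X :: "nat \<Rightarrow> L2"
  assume X: "Cauchy X"
  define F where "F n = rep_L2 (X n)" for n
  have rel: "L2_rel (F n) (F n)" for n
    unfolding F_def by (rule Quotient_rep_reflp[OF Quotient_L2])
  then have sq: "square_integrable (F n)" for n
    by (simp add: L2_rel_def)
  have [measurable]: "F n \<in> borel_measurable lborel" for n
    using sq by (simp add: square_integrable_def)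
  have abs_F: "abs_L2 (F n) = X n" for n
    unfolding F_def by (rule Quotient_abs_rep[OF Quotient_L2])
  have dist_F: "(\<integral>\<^sup>+p. ennreal ((cmod (F m p - F n p))\<^sup>2) \<partial>lborel) = ennreal ((norm (X m - X n))\<^sup>2)"
    for m n
  proof -
    have "X m - X n = abs_L2 (\<lambda>p. F m p - F n p)"
      using minus_L2.abs_eq[of "F m" "F n"] rel by (simp add: abs_F eq_onp_def)
    then show ?thesis
      using norm_abs_L2[OF square_integrable_diff[OF sq sq]] by simp
  qed
  have "\<exists>N. \<forall>m\<ge>N. \<forall>n\<ge>N. norm (X m - X n) < (1/4) ^ k" for k
    using X[unfolded Cauchy_iff] by (meson zero_less_power zero_less_divide_1_iff zero_less_numeral)
  then obtain N where N: "\<And>k m n. m \<ge> N k \<Longrightarrow> n \<ge> N k \<Longrightarrow> norm (X m - X n) < (1/4) ^ k"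
    by metis
  define r where "r k = (\<Sum>i\<le>k. N i) + k" for k
  have "strict_mono r"
    by (rule strict_mono_Suc_iff[THEN iffD2]) (simp add: r_def)
  have rN: "r k \<ge> N k" for k
    using member_le_sum[of k "{..k}" N] by (simp add: r_def)
  define G where "G k p = F (r (Suc k)) p - F (r k) p" for k p
  have [measurable]: "G k \<in> borel_measurable lborel" for k
    unfolding G_def by measurable
  have G: "(\<integral>\<^sup>+p. ennreal (4 ^ k * (cmod (G k p))\<^sup>2) \<partial>lborel) \<le> ennreal ((1/4) ^ k)" for k
  proof -
    have "r (Suc k) \<ge> N k"
      using rN[of k] \<open>strict_mono r\<close> by (meson lessI less_imp_le order_trans strict_mono_less)
    then have "norm (X (r (Suc k)) - X (r k)) \<le> (1/4) ^ k"
      using N[OF _ rN] by (simp add: less_imp_le)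
    then have "(norm (X (r (Suc k)) - X (r k)))\<^sup>2 \<le> ((1/4) ^ k)\<^sup>2"
      by (intro power_mono) auto
    then have *: "4 ^ k * (norm (X (r (Suc k)) - X (r k)))\<^sup>2 \<le> 4 ^ k * ((1/4) ^ k)\<^sup>2"
      by (intro mult_left_mono) auto
    have "(\<integral>\<^sup>+p. ennreal (4 ^ k * (cmod (G k p))\<^sup>2) \<partial>lborel)
        = ennreal (4 ^ k) * (\<integral>\<^sup>+p. ennreal ((cmod (G k p))\<^sup>2) \<partial>lborel)"
      by (subst nn_integral_cmult[symmetric]) (auto simp: ennreal_mult)
    also have "\<dots> = ennreal (4 ^ k * (norm (X (r (Suc k)) - X (r k)))\<^sup>2)"
      by (simp add: G_def dist_F ennreal_mult)
    also have "\<dots> \<le> ennreal ((1/4) ^ k)"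
      using * by (intro ennreal_leI) (simp add: power2_eq_square power_one_over)
    finally show ?thesis .
  qed
  have "(\<integral>\<^sup>+p. (\<Sum>k. ennreal (4 ^ k * (cmod (G k p))\<^sup>2)) \<partial>lborel)
      = (\<Sum>k. \<integral>\<^sup>+p. ennreal (4 ^ k * (cmod (G k p))\<^sup>2) \<partial>lborel)"
    by (rule nn_integral_suminf) auto
  also have "\<dots> \<le> (\<Sum>k. ennreal ((1/4) ^ k))"
    by (intro suminf_le G) auto
  also have "\<dots> = ennreal (\<Sum>k. (1/4) ^ k)"
    by (rule suminf_ennreal2) (auto intro: summable_geometric)
  also have "\<dots> < \<infinity>" by simp
  finally have "(\<integral>\<^sup>+p. (\<Sum>k. ennreal (4 ^ k * (cmod (G k p))\<^sup>2)) \<partial>lborel) \<noteq> \<infinity>"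
    by (rule less_imp_neq)
  then have "AE p in lborel. (\<Sum>k. ennreal (4 ^ k * (cmod (G k p))\<^sup>2)) \<noteq> \<infinity>"
    by (rule nn_integral_noteq_infinite[rotated]) measurable
  then have conv: "AE p in lborel. convergent (\<lambda>k. F (r k) p)"
  proof eventually_elim
    case (elim p)
    define C where "C = (\<Sum>k. ennreal (4 ^ k * (cmod (G k p))\<^sup>2))"
    have "ennreal (4 ^ k * (cmod (G k p))\<^sup>2) \<le> C" for k
    proof -
      have "(\<Sum>k\<in>{k}. ennreal (4 ^ k * (cmod (G k p))\<^sup>2)) \<le> C"
        unfolding C_def by (rule sum_le_suminf) (rule summableI, simp_all only: finite.intros zero_le)
      then show ?thesis by (simp only: sum.insert sum.empty finite.intros empty_iff not_False_eq_True add_0_right)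
    qed
    moreover obtain c where c: "C = ennreal c" "c \<ge> 0"
      using elim by (cases C) (auto simp: C_def)
    ultimately have "4 ^ k * (cmod (G k p))\<^sup>2 \<le> c" for k
      by (metis ennreal_le_iff)
    moreover have "((2 :: real) ^ k)\<^sup>2 = 4 ^ k" for k
      by (simp add: power2_eq_square flip: power_mult_distrib)
    ultimately have "(2 ^ k * cmod (G k p))\<^sup>2 \<le> c" for k
      by (simp only: power_mult_distrib)
    then have "2 ^ k * cmod (G k p) \<le> sqrt c" for k
      by (rule real_le_rsqrt)
    then have "norm (G k p) \<le> sqrt c * (1/2) ^ k" for k
      by (simp add: field_simps power_one_over)
    then have "summable (\<lambda>k. G k p)"
      by (rule summable_comparison_test'[where N = 0, rotated])
        (rule summable_mult, rule summable_geometric, simp)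
    then have "convergent (\<lambda>n. \<Sum>k<n. G k p)"
      by (simp add: summable_iff_convergent)
    then have "convergent (\<lambda>n. F (r n) p - F (r 0) p)"
      by (simp only: G_def sum_lessThan_telescope[where f = "\<lambda>n. F (r n) p"])
    then have "convergent (\<lambda>n. F (r n) p - F (r 0) p + F (r 0) p)"
      by (rule convergent_add) (rule convergent_const)
    then show ?case by simp
  qed
  define f where "f p = lim (\<lambda>k. F (r k) p)" for p
  have [measurable]: "f \<in> borel_measurable lborel"
    unfolding f_def by measurable
  have lim: "AE p in lborel. (\<lambda>k. F (r k) p) \<longlonglongrightarrow> f p"
    using conv by eventually_elim (simp add: f_def convergent_LIMSEQ_iff)
  have fatou: "(\<integral>\<^sup>+p. ennreal ((cmod (f p - F n p))\<^sup>2) \<partial>lborel) \<le> ennreal ((1/4) ^ k)"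
    if n: "n \<ge> N k" for n k
  proof -
    have "AE p in lborel. ennreal ((cmod (f p - F n p))\<^sup>2)
        = liminf (\<lambda>j. ennreal ((cmod (F (r j) p - F n p))\<^sup>2))"
      using lim
    proof eventually_elim
      case (elim p)
      then have "(\<lambda>j. ennreal ((cmod (F (r j) p - F n p))\<^sup>2))
          \<longlonglongrightarrow> ennreal ((cmod (f p - F n p))\<^sup>2)"
        by (intro tendsto_intros)
      then show ?case
        by (rule lim_imp_Liminf[OF sequentially_bot, symmetric])
    qed
    then have "(\<integral>\<^sup>+p. ennreal ((cmod (f p - F n p))\<^sup>2) \<partial>lborel)
        = (\<integral>\<^sup>+p. liminf (\<lambda>j. ennreal ((cmod (F (r j) p - F n p))\<^sup>2)) \<partial>lborel)"
      by (rule nn_integral_cong_AE)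
    also have "\<dots> \<le> liminf (\<lambda>j. \<integral>\<^sup>+p. ennreal ((cmod (F (r j) p - F n p))\<^sup>2) \<partial>lborel)"
      by (rule nn_integral_liminf) auto
    also have "\<dots> \<le> ennreal ((1/4) ^ k)"
    proof (rule Liminf_le)
      show "\<forall>\<^sub>F j in sequentially.
          (\<integral>\<^sup>+p. ennreal ((cmod (F (r j) p - F n p))\<^sup>2) \<partial>lborel) \<le> ennreal ((1/4) ^ k)"
        using eventually_ge_at_top[of "N k"]
      proof eventually_elim
        case (elim j)
        have "r j \<ge> N k"
          using elim seq_suble[OF \<open>strict_mono r\<close>, of j] by simp
        then have "norm (X (r j) - X n) \<le> (1/4) ^ k"
          using N n by (simp add: less_imp_le)
        then have "(norm (X (r j) - X n))\<^sup>2 \<le> ((1/4) ^ k)\<^sup>2"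
          by (intro power_mono) auto
        also have "\<dots> \<le> (1/4) ^ k"
          by (simp add: power2_eq_square mult_left_le power_le_one)
        finally show ?case
          by (simp add: dist_F ennreal_leI)
      qed
    qed simp
    finally show ?thesis .
  qed
  have sq_diff: "square_integrable (\<lambda>p. f p - F n p)" if "n \<ge> N 0" for n
    unfolding square_integrable_def
  proof
    show "integrable lborel (\<lambda>p. (cmod (f p - F n p))\<^sup>2)"
      using fatou[OF that] by (intro integrableI_bounded) (auto intro: le_less_trans)
  qed measurable
  have "square_integrable f"
    using square_integrable_add[OF sq_diff[OF order.refl] sq[of "N 0"]] by simp
  have "X \<longlonglongrightarrow> abs_L2 f"
  proof (rule metric_LIMSEQ_I)
    fix e :: real assume "e > 0"
    then obtain k where k: "(1/4) ^ k < e\<^sup>2"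
      using real_arch_pow_inv[of "e\<^sup>2" "1/4"] by auto
    have "dist (X n) (abs_L2 f) < e" if "n \<ge> N k" for n
    proof -
      have "abs_L2 f - X n = abs_L2 (\<lambda>p. f p - F n p)"
        using minus_L2.abs_eq[of f "F n"] rel \<open>square_integrable f\<close>
        by (simp add: abs_F eq_onp_def L2_rel_def)
      then have "ennreal ((norm (abs_L2 f - X n))\<^sup>2) \<le> ennreal ((1/4) ^ k)"
        using fatou[OF that] norm_abs_L2[OF square_integrable_diff[OF \<open>square_integrable f\<close> sq]]
        by simp
      then have "(norm (abs_L2 f - X n))\<^sup>2 < e\<^sup>2"
        using k by simp
      then have "norm (abs_L2 f - X n) < e"
        using \<open>e > 0\<close> by (simp add: power_less_imp_less_base)
      then show ?thesis by (simp add: dist_norm norm_minus_commute)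
    qed
    then show "\<exists>no. \<forall>n\<ge>no. dist (X n) (abs_L2 f) < e" by blast
  qed
  then show "convergent X" by (rule convergentI)
qed


section \<open>Distributions\<close>

definition partial_x :: "(real \<times> real \<Rightarrow> complex) \<Rightarrow> real \<times> real \<Rightarrow> complex" where
  "partial_x \<phi> p = frechet_derivative \<phi> (at p) (1, 0)"

definition partial_v :: "(real \<times> real \<Rightarrow> complex) \<Rightarrow> real \<times> real \<Rightarrow> complex" where
  "partial_v \<phi> p = frechet_derivative \<phi> (at p) (0, 1)"

primrec C_k :: "nat \<Rightarrow> (real \<times> real \<Rightarrow> complex) \<Rightarrow> bool" where
  "C_k 0 \<phi> \<longleftrightarrow> continuous_on UNIV \<phi>"
| "C_k (Suc n) \<phi> \<longleftrightarrow>
     (\<forall>p. \<phi> differentiable (at p)) \<and> C_k n (partial_x \<phi>) \<and> C_k n (partial_v \<phi>)"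

definition test_functions :: "(real \<times> real \<Rightarrow> complex) set" where
  "test_functions = {\<phi>. (\<forall>n. C_k n \<phi>) \<and> compact (closure {p. \<phi> p \<noteq> 0})}"

(* Functionals are total on the function type; only their values on test_functions matter. *)
type_synonym distribution = "(real \<times> real \<Rightarrow> complex) \<Rightarrow> complex"

definition dist_of :: "L2 \<Rightarrow> distribution" where
  "dist_of f \<phi> = (LINT p|lborel. rep_L2 f p * \<phi> p)"

definition dist_x :: "distribution \<Rightarrow> distribution" where
  "dist_x T \<phi> = - T (partial_x \<phi>)"

definition dist_v :: "distribution \<Rightarrow> distribution" where
  "dist_v T \<phi> = - T (partial_v \<phi>)"

definition dist_mult :: "(real \<times> real \<Rightarrow> complex) \<Rightarrow> distribution \<Rightarrow> distribution" where
  "dist_mult m T \<phi> = T (\<lambda>p. m p * \<phi> p)"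


section \<open>Unbounded operators, spectrum and Riesz projectors\<close>

(* a domain together with the action on it; values outside the domain are irrelevant *)
type_synonym unbounded_op = "L2 set \<times> (L2 \<Rightarrow> L2)"

(* Blinfun maps are only required to be real linear, but the inverse of a complex linear
   operator is complex linear. *)
definition is_resolvent :: "unbounded_op \<Rightarrow> complex \<Rightarrow> (L2 \<Rightarrow>\<^sub>L L2) \<Rightarrow> bool" where
  "is_resolvent A z R \<longleftrightarrow>
     (\<forall>g. blinfun_apply R g \<in> fst A \<and>
          snd A (blinfun_apply R g) - z *\<^sub>C blinfun_apply R g = g) \<and>
     (\<forall>f\<in>fst A. blinfun_apply R (snd A f - z *\<^sub>C f) = f)"

definition spectrum :: "unbounded_op \<Rightarrow> complex set" where
  "spectrum A = {z. \<nexists>R. is_resolvent A z R}"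

definition resolvent :: "unbounded_op \<Rightarrow> complex \<Rightarrow> L2 \<Rightarrow>\<^sub>L L2" where
  "resolvent A z = (THE R. is_resolvent A z R)"

definition scale_blinfun :: "complex \<Rightarrow> (L2 \<Rightarrow>\<^sub>L L2) \<Rightarrow> (L2 \<Rightarrow>\<^sub>L L2)" where
  "scale_blinfun c R = Blinfun (scaleC c) o\<^sub>L R"

(* the operator-valued contour integral of (A - w)^{-1} times i / (2 pi), with the circle
   parametrised by w = z + \<epsilon> exp (i t), dw = i \<epsilon> exp (i t) dt *)
definition riesz_projector :: "unbounded_op \<Rightarrow> complex \<Rightarrow> real \<Rightarrow> L2 \<Rightarrow>\<^sub>L L2" where
  "riesz_projector A z \<epsilon> =
     scale_blinfun (\<i> / (2 * of_real pi))
       (integral {0..2 * pi}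
         (\<lambda>t. scale_blinfun (\<i> * of_real \<epsilon> * cis t) (resolvent A (z + of_real \<epsilon> * cis t))))"

(* L2_dim is 0 on infinite-dimensional subspaces, hence the case distinction *)
definition op_rank :: "(L2 \<Rightarrow>\<^sub>L L2) \<Rightarrow> enat" where
  "op_rank P = (if \<exists>B. finite B \<and> L2_span B = range (blinfun_apply P)
             then enat (L2_dim (range (blinfun_apply P))) else \<infinity>)"

definition alg_mult :: "unbounded_op \<Rightarrow> complex \<Rightarrow> enat" where
  "alg_mult A z = op_rank (riesz_projector A z (SOME \<epsilon>. \<epsilon> > 0 \<and> cball z \<epsilon> \<inter> spectrum A \<subseteq> {z}))"

(* The sum of the multiplicities is written as a supremum over finite subsets, so that it is
   meaningful (in enat) without presupposing finiteness of the index set. *)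
definition eigenvalue_counting :: "unbounded_op \<Rightarrow> real \<Rightarrow> enat" where
  "eigenvalue_counting A r =
     (SUP F \<in> {F. finite F \<and> F \<subseteq> {z \<in> spectrum A. Re z \<le> r}}. \<Sum>z\<in>F. alg_mult A z)"

definition ecard :: "'a set \<Rightarrow> enat" where
  "ecard S = (if finite S then enat (card S) else \<infinity>)"


section \<open>The Kramers--Fokker--Planck operator with quadratic potential\<close>

definition K_dist :: "real \<Rightarrow> distribution \<Rightarrow> distribution" where
  "K_dist a T \<phi> =
     dist_mult (\<lambda>(x, v). of_real v) (dist_x T) \<phi>
     - of_real a * dist_mult (\<lambda>(x, v). of_real x) (dist_v T) \<phi>
     - dist_v (dist_v T) \<phi>
     + dist_mult (\<lambda>(x, v). of_real (v\<^sup>2 / 4)) T \<phi>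
     - 1 / 2 * T \<phi>"

definition K_graph :: "real \<Rightarrow> L2 \<Rightarrow> L2 \<Rightarrow> bool" where
  "K_graph a f g \<longleftrightarrow> (\<forall>\<phi>\<in>test_functions. K_dist a (dist_of f) \<phi> = dist_of g \<phi>)"

definition K_op :: "real \<Rightarrow> unbounded_op" where
  "K_op a = ({f. \<exists>g. K_graph a f g}, \<lambda>f. THE g. K_graph a f g)"

end

theory Submission
  imports Defs "HOL-Probability.Probability"
begin

text \<open>After rescaling \<open>x\<close>, the operator is \<open>K = b\<^sup>* b + s (b\<^sup>* c - c\<^sup>* b)\<close> with \<open>s = sqrt a\<close> and annihilation
  operators \<open>b\<close> in \<open>v\<close> and \<open>c\<close> in \<open>x\<close>. It preserves the total Hermite degree \<open>n\<close>, so it is an orthogonal sum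
  of blocks \<open>K\<^sub>n\<close> of size \<open>n + 1\<close>; testing against truncated Hermite functions shows that the maximal
  domain is that of the orthogonal sum. On homogeneous forms of degree \<open>n\<close> in two variables \<open>K\<^sub>n\<close> acts as
  a derivation, and the products of powers of its two linear eigenforms form an eigenbasis with
  eigenvalues \<open>k \<mu>\<^sub>+ + (n - k) \<mu>\<^sub>-\<close>.

  What remains is to bound the resolvents of the blocks uniformly in \<open>n\<close>. As \<open>Re K = b\<^sup>* b \<ge> 0\<close>, the
  semigroup \<open>exp (-t K\<^sub>n)\<close> is contractive. The condition number of the eigenbasis grows at most
  exponentially in \<open>n\<close>, while the eigenvalues grow linearly, so at some time \<open>T\<close> independent of \<open>n\<close> its
  norm is at most \<open>2\<^sup>-\<^sup>n\<close>. Integrating the derivative of \<open>exp (t w) exp (-t K\<^sub>n) u\<close> over \<open>[0, T]\<close> then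
  bounds \<open>u\<close> by \<open>(K\<^sub>n - w) u\<close> with a constant independent of large \<open>n\<close>. The Riesz projectors are finally evaluated
  on eigenvectors, where they are scalar contour integrals; each level contributes at most one
  eigenvector to a given eigenvalue.\<close>

section \<open>Functions decaying faster than every exponential\<close>

text \<open>The obstacle is non-normality. The number operator in v and the transport term do not
  commute, so the eigenforms of a block are not orthogonal and the distance from w to the
  eigenvalues does not control the inverse of K_n - w. Without a bound uniform in n the blockwise
  inverses need not assemble to a bounded operator, and a point outside the listed set could still
  be spectral. Diagonalisation alone gives a bound exponential in n; it serves the finitely many low
  levels, and on high levels the semigroup trades it against decay.

  The dilation y = s x turns the transport term into s times the rotation generator v d_y - y d_v,
  which is why the total degree is preserved. The condition on \<open>a\<close> enters as
  \<open>mp \<noteq> mm\<close>: passing to the eigenforms divides by \<open>mp - mm\<close>.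

  The domain is maximal, so nothing about f may be used beyond its pairings with test functions.
  Hermite functions have no compact support, hence the cut-offs.

  The Riesz projector is an integral of operators, so the resolvent must be norm continuous along
  the circle; the uniform bound is used a second time for this.\<close>

definition rapid :: "(real \<Rightarrow> real) \<Rightarrow> bool" where
  "rapid F \<longleftrightarrow> continuous_on UNIV F \<and> (\<forall>c. \<exists>C. \<forall>x. \<bar>F x\<bar> \<le> C * exp (- c * \<bar>x\<bar>))"

lemma rapid_continuous: "rapid F \<Longrightarrow> continuous_on UNIV F"
  by (simp add: rapid_def)

lemma rapid_measurable: "rapid F \<Longrightarrow> F \<in> borel_measurable borel"
  by (simp add: rapid_def borel_measurable_continuous_onI)

lemma rapid_bound:
  assumes "rapid F" obtains C where "C > 0" "\<And>x. \<bar>F x\<bar> \<le> C * exp (- c * \<bar>x\<bar>)"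
proof -
  obtain C where C: "\<And>x. \<bar>F x\<bar> \<le> C * exp (- c * \<bar>x\<bar>)"
    using assms by (meson rapid_def)
  have "\<bar>F x\<bar> \<le> (\<bar>C\<bar> + 1) * exp (- c * \<bar>x\<bar>)" for x
    by (rule order.trans[OF C[of x]]) (intro mult_right_mono, auto)
  then show ?thesis using that[of "\<bar>C\<bar> + 1"] by simp
qed

lemma rapid_add:
  assumes "rapid F" "rapid G" shows "rapid (\<lambda>x. F x + G x)"
  unfolding rapid_def
proof (intro conjI allI)
  show "continuous_on UNIV (\<lambda>x. F x + G x)"
    using assms by (intro continuous_intros) (auto simp: rapid_def)
  fix c
  obtain C where C: "\<And>x. \<bar>F x\<bar> \<le> C * exp (- c * \<bar>x\<bar>)" using rapid_bound[OF assms(1)] by metis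
  obtain D where D: "\<And>x. \<bar>G x\<bar> \<le> D * exp (- c * \<bar>x\<bar>)" using rapid_bound[OF assms(2)] by metis
  have "\<bar>F x + G x\<bar> \<le> (C + D) * exp (- c * \<bar>x\<bar>)" for x
    using C[of x] D[of x] by (simp add: algebra_simps)
  then show "\<exists>C. \<forall>x. \<bar>F x + G x\<bar> \<le> C * exp (- c * \<bar>x\<bar>)" by blast
qed

text \<open>Growth at rate b is absorbed by asking F for decay at rate c + b. Decay at every rate is
  therefore stable under polynomial and exponential factors; the first are needed for Hermite
  functions, the second for the moment argument that shows their completeness.\<close>

lemma rapid_mult_exp_bound:
  assumes "rapid F" and cont: "continuous_on UNIV G" and G: "\<And>x. \<bar>G x\<bar> \<le> B * exp (b * \<bar>x\<bar>)"
  shows "rapid (\<lambda>x. G x * F x)"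
  unfolding rapid_def
proof (intro conjI allI)
  show "continuous_on UNIV (\<lambda>x. G x * F x)"
    using assms by (intro continuous_intros) (auto simp: rapid_def)
  fix c
  obtain C where C: "C > 0" "\<And>x. \<bar>F x\<bar> \<le> C * exp (- (c + b) * \<bar>x\<bar>)"
    using rapid_bound[OF assms(1)] by metis
  have "\<bar>G x * F x\<bar> \<le> (B * C) * exp (- c * \<bar>x\<bar>)" for x
  proof -
    have "\<bar>G x * F x\<bar> \<le> (B * exp (b * \<bar>x\<bar>)) * (C * exp (- (c + b) * \<bar>x\<bar>))"
      unfolding abs_mult
      using G[of x] by (intro mult_mono C G) (auto intro: order_trans[OF abs_ge_zero])
    also have "\<dots> = (B * C) * exp (b * \<bar>x\<bar> + - (c + b) * \<bar>x\<bar>)"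
      by (simp only: exp_add mult_ac)
    also have "b * \<bar>x\<bar> + - (c + b) * \<bar>x\<bar> = - c * \<bar>x\<bar>" by (simp add: algebra_simps)
    finally show ?thesis .
  qed
  then show "\<exists>C. \<forall>x. \<bar>G x * F x\<bar> \<le> C * exp (- c * \<bar>x\<bar>)" by blast
qed

lemma rapid_cmult: "rapid F \<Longrightarrow> rapid (\<lambda>x. c * F x)"
  by (rule rapid_mult_exp_bound[where B = "\<bar>c\<bar>" and b = 0]) auto

lemma rapid_diff: "rapid F \<Longrightarrow> rapid G \<Longrightarrow> rapid (\<lambda>x. F x - G x)"
  using rapid_add[OF _ rapid_cmult[of G "-1"]] by simp

lemma rapid_mult_bounded:
  "rapid F \<Longrightarrow> continuous_on UNIV G \<Longrightarrow> (\<And>x. \<bar>G x\<bar> \<le> B) \<Longrightarrow> rapid (\<lambda>x. G x * F x)"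
  by (rule rapid_mult_exp_bound[where B = B and b = 0]) auto

lemma rapid_mult:
  assumes "rapid F" "rapid G" shows "rapid (\<lambda>x. F x * G x)"
proof -
  obtain C where "\<And>x. \<bar>F x\<bar> \<le> C * exp (- 0 * \<bar>x\<bar>)" using rapid_bound[OF assms(1)] by metis
  with assms show ?thesis
    by (intro rapid_mult_bounded[where B = C]) (auto simp: rapid_def)
qed

lemma rapid_id_mult: "rapid F \<Longrightarrow> rapid (\<lambda>x. x * F x)"
  using order.trans[OF _ exp_ge_add_one_self[of "\<bar>x\<bar>" for x]]
  by (intro rapid_mult_exp_bound[where B = 1 and b = 1] continuous_intros)
    auto

lemma rapid_poly_mult: "rapid F \<Longrightarrow> rapid (\<lambda>x. poly p x * F x)"
proof (induction p)
  case 0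
  then show ?case using rapid_cmult[of F 0] by simp
next
  case (pCons c p)
  then have "rapid (\<lambda>x. c * F x + x * (poly p x * F x))"
    by (intro rapid_add rapid_cmult rapid_id_mult) auto
  then show ?case by (simp add: algebra_simps)
qed

lemma rapid_exp_abs: "rapid F \<Longrightarrow> rapid (\<lambda>x. exp (c * \<bar>x\<bar>) * F x)"
  by (intro rapid_mult_exp_bound[where B = 1 and b = c] continuous_intros) auto

lemma rapid_abs: "rapid F \<Longrightarrow> rapid (\<lambda>x. \<bar>F x\<bar>)"
  by (auto simp: rapid_def intro: continuous_intros)

lemma rapid_scale:
  assumes "rapid F" "s > 0" shows "rapid (\<lambda>x. F (s * x))"
  unfolding rapid_def
proof (intro conjI allI)
  show "continuous_on UNIV (\<lambda>x. F (s * x))"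
    by (rule continuous_on_compose2[of UNIV F]) (use assms in \<open>auto simp: rapid_def intro!: continuous_intros\<close>)
  fix c
  obtain C where "\<And>x. \<bar>F x\<bar> \<le> C * exp (- (c / s) * \<bar>x\<bar>)" using rapid_bound[OF assms(1)] by metis
  from this[of "s * x" for x] have "\<bar>F (s * x)\<bar> \<le> C * exp (- c * \<bar>x\<bar>)" for x
    using assms(2) by (simp add: abs_mult)
  then show "\<exists>C. \<forall>x. \<bar>F (s * x)\<bar> \<le> C * exp (- c * \<bar>x\<bar>)" by blast
qed

lemma rapid_gauss: "rapid (\<lambda>x. exp (- (x\<^sup>2 / 4)))"
  unfolding rapid_def
proof (intro conjI allI)
  show "continuous_on UNIV (\<lambda>x::real. exp (- (x\<^sup>2 / 4)))" by (intro continuous_intros) auto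
  fix c
  have "exp (- (x\<^sup>2 / 4)) \<le> exp (c\<^sup>2) * exp (- c * \<bar>x\<bar>)" for x :: real
  proof -
    have "0 \<le> (\<bar>x\<bar> / 2 - c)\<^sup>2" by simp
    also have "\<dots> = x\<^sup>2 / 4 - c * \<bar>x\<bar> + c\<^sup>2" by (simp add: power2_diff power_divide)
    finally show ?thesis by (simp add: exp_add[symmetric])
  qed
  then show "\<exists>C. \<forall>x::real. \<bar>exp (- (x\<^sup>2 / 4))\<bar> \<le> C * exp (- c * \<bar>x\<bar>)" by auto
qed

lemma integrable_inverse_one_plus_square: "integrable lborel (\<lambda>x::real. inverse (1 + x\<^sup>2))"
  using integrable_inverse_1_plus_square by (simp add: set_integrable_def)

lemma rapid_integrable:
  assumes "rapid F" shows "integrable lborel F"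
proof -
  \<comment> \<open>Rate 2 because 1 + x^2 <= (1 + |x|)^2 <= exp (2 |x|), so the integrable majorant
    is a multiple of 1 / (1 + x^2).\<close>
  obtain C where C: "C > 0" "\<And>x. \<bar>F x\<bar> \<le> C * exp (- 2 * \<bar>x\<bar>)" using rapid_bound[OF assms] by metis
  have "norm (F x) \<le> norm (C * inverse (1 + x\<^sup>2))" for x
  proof -
    have "1 + x\<^sup>2 \<le> (1 + \<bar>x\<bar>)\<^sup>2" by (simp add: power2_sum)
    also have "\<dots> \<le> (exp \<bar>x\<bar>)\<^sup>2" by (intro power_mono exp_ge_add_one_self) auto
    also have "\<dots> = exp (2 * \<bar>x\<bar>)" by (simp add: exp_double)
    finally have "inverse (exp (2 * \<bar>x\<bar>)) \<le> inverse (1 + x\<^sup>2)"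
      by (intro le_imp_inverse_le) (auto intro: add_pos_nonneg)
    then have "C * exp (- 2 * \<bar>x\<bar>) \<le> C * inverse (1 + x\<^sup>2)"
      using C by (intro mult_left_mono) (auto simp: exp_minus)
    from order.trans[OF C(2) this] show ?thesis using C(1) by (simp add: abs_mult)
  qed
  then show ?thesis
    by (intro Bochner_Integration.integrable_bound[OF integrable_mult_right[OF integrable_inverse_one_plus_square, of C]])
      (use rapid_measurable[OF assms] in auto)
qed

lemma rapid_tendsto_0:
  assumes "rapid F" shows "(\<lambda>n. F (real n)) \<longlonglongrightarrow> 0" "(\<lambda>n. F (- real n)) \<longlonglongrightarrow> 0"
proof -
  obtain C where C: "\<And>x. \<bar>F x\<bar> \<le> C * exp (- 1 * \<bar>x\<bar>)" using rapid_bound[OF assms] by metis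
  have *: "(\<lambda>n. C * exp (- real n)) \<longlonglongrightarrow> 0" by real_asymp
  show "(\<lambda>n. F (real n)) \<longlonglongrightarrow> 0"
    by (rule Lim_null_comparison[OF _ *]) (use C[of "real n" for n] in \<open>auto\<close>)
  show "(\<lambda>n. F (- real n)) \<longlonglongrightarrow> 0"
    by (rule Lim_null_comparison[OF _ *]) (use C[of "- real n" for n] in \<open>auto\<close>)
qed

text \<open>This is what makes integration by parts free of boundary terms: on [-n, n] the integral
  is a difference of two values of F, both tending to 0.\<close>

lemma rapid_integral_deriv_zero:
  assumes F: "rapid F" and G: "rapid G" and D: "\<And>x. (F has_real_derivative G x) (at x)"
  shows "(LINT x|lborel. G x) = 0"
proof -
  have [measurable]: "G \<in> borel_measurable borel" by (rule rapid_measurable[OF G])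
  have "(\<lambda>n. LINT x|lborel. indicator {- real n..real n} x *\<^sub>R G x) \<longlonglongrightarrow> (LINT x|lborel. G x)"
  proof (rule integral_dominated_convergence[where w = "\<lambda>x. \<bar>G x\<bar>"])
    show "integrable lborel (\<lambda>x. \<bar>G x\<bar>)" using rapid_integrable[OF G] by simp
    have "(\<lambda>n. indicator {- real n..real n} x *\<^sub>R G x) \<longlonglongrightarrow> G x" for x
    proof (rule tendsto_eventually)
      show "\<forall>\<^sub>F n in sequentially. indicator {- real n..real n} x *\<^sub>R G x = G x"
        using eventually_ge_at_top[of "nat \<lceil>\<bar>x\<bar>\<rceil>"]
        by eventually_elim (auto simp: indicator_def abs_le_iff nat_le_iff ceiling_le_iff)
    qed
    then show "AE x in lborel. (\<lambda>n. indicator {- real n..real n} x *\<^sub>R G x) \<longlonglongrightarrow> G x" by simp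
  qed (auto simp: indicator_def)
  moreover have "(LINT x|lborel. indicator {- real n..real n} x *\<^sub>R G x) = F n - F (- real n)" for n
    by (rule integral_FTC_Icc[OF _ _ continuous_on_subset[OF rapid_continuous[OF G]]])
      (use D in \<open>auto simp: has_real_derivative_iff_has_vector_derivative[symmetric] intro: has_field_derivative_at_within\<close>)
  moreover have "(\<lambda>n. F (real n) - F (- real n)) \<longlonglongrightarrow> 0 - 0"
    by (intro tendsto_diff rapid_tendsto_0 F)
  ultimately show ?thesis using LIMSEQ_unique by fastforce
qed

section \<open>Hermite functions\<close>

text \<open>The probabilists' Hermite polynomials, orthogonal for the weight exp (- x^2 / 2);
  \<open>hfun\<close> carries the square root of that weight.\<close>

primrec hermite :: "nat \<Rightarrow> real poly" where
  "hermite 0 = 1"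
| "hermite (Suc n) = [:0, 1:] * hermite n - pderiv (hermite n)"

lemma pderiv_hermite_Suc: "pderiv (hermite (Suc n)) = smult (real (Suc n)) (hermite n)"
proof (induction n)
  case (Suc n)
  define h where "h = hermite n"
  define g where "g = [:0, 1:] * h - pderiv h"
  have IH: "pderiv g = smult (real (Suc n)) h"
    using Suc by (simp only: h_def g_def hermite.simps(2))
  have "pderiv ([:0, 1:] * g - pderiv g) = g + [:0, 1:] * pderiv g - pderiv (pderiv g)"
    by (simp only: pderiv_diff pderiv_mult) (simp add: pderiv_pCons)
  also have "[:0, 1:] * pderiv g - pderiv (pderiv g) = smult (real (Suc n)) g"
    by (simp only: IH pderiv_smult mult_smult_right smult_diff_right[symmetric]) (simp only: g_def)
  then have "g + [:0, 1:] * pderiv g - pderiv (pderiv g) = g + smult (real (Suc n)) g"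
    by (simp only: add_diff_eq[symmetric])
  also have "\<dots> = smult (real (Suc (Suc n))) g"
    by (simp only: of_nat_Suc[of "Suc n"] smult_add_left smult_1_left)
  finally have "pderiv ([:0, 1:] * g - pderiv g) = smult (real (Suc (Suc n))) g" .
  then show ?case by (simp only: h_def g_def hermite.simps(2))
qed (simp add: pderiv_pCons)

definition hfun :: "nat \<Rightarrow> real \<Rightarrow> real" where
  "hfun n x = poly (hermite n) x * exp (- (x\<^sup>2 / 4))"

lemma rapid_hfun: "rapid (hfun n)"
  unfolding hfun_def by (rule rapid_poly_mult[OF rapid_gauss])

lemma hfun_mult: "x * hfun n x = hfun (Suc n) x + real n * hfun (n - 1) x"
proof (cases n)
  case (Suc m)
  have "poly (pderiv (hermite n)) x = real n * poly (hermite m) x"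
    unfolding Suc pderiv_hermite_Suc by simp
  then show ?thesis by (simp add: hfun_def algebra_simps Suc)
qed (simp add: hfun_def)

text \<open>Annihilation: x/2 + d/dx lowers the degree. \<open>hfun_deriv'\<close> reads the same
  derivative as creation, x/2 - d/dx raising it. At n = 0 the truncated index \<open>n - 1\<close>
  comes with the factor 0.\<close>

lemma hfun_deriv:
  "(hfun n has_real_derivative (real n * hfun (n - 1) x - x / 2 * hfun n x)) (at x)"
proof -
  have "poly (pderiv (hermite n)) x = real n * poly (hermite (n - 1)) x"
    by (cases n) (simp_all add: pderiv_hermite_Suc del: hermite.simps(2))
  then show ?thesis unfolding hfun_def
    by (auto intro!: derivative_eq_intros poly_DERIV simp: algebra_simps)
qed

lemma hfun_deriv': "(hfun n has_real_derivative (x / 2 * hfun n x - hfun (Suc n) x)) (at x)"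
  by (rule DERIV_cong[OF hfun_deriv]) (use hfun_mult[of x n] in \<open>simp add: field_simps\<close>)

text \<open>Creation is adjoint to annihilation. Differentiating the product with the creation form
  for i and the annihilation form for j makes the two terms with x/2 cancel.\<close>

lemma hfun_integral_step:
  "(LINT x|lborel. hfun (Suc i) x * hfun j x) = real j * (LINT x|lborel. hfun i x * hfun (j - 1) x)"
proof -
  let ?G = "\<lambda>x. real j * (hfun i x * hfun (j - 1) x) - hfun (Suc i) x * hfun j x"
  have G: "rapid ?G" by (intro rapid_diff rapid_cmult rapid_mult rapid_hfun)
  have "(LINT x|lborel. ?G x) = 0"
  proof (rule rapid_integral_deriv_zero[of "\<lambda>x. hfun i x * hfun j x"])
    show "((\<lambda>x. hfun i x * hfun j x) has_real_derivative ?G x) (at x)" for x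
      by (auto intro!: derivative_eq_intros hfun_deriv[of j] hfun_deriv'[of i] simp: algebra_simps)
  qed (intro G rapid_mult rapid_hfun)+
  then show ?thesis
    by (subst (asm) Bochner_Integration.integral_diff)
      (auto intro!: rapid_integrable rapid_mult rapid_hfun)
qed

lemma hfun_orthogonal:
  "(LINT x|lborel. hfun i x * hfun j x) = (if i = j then fact i * sqrt (2 * pi) else 0)"
proof (induction i arbitrary: j)
  case 0
  show ?case
  proof (cases j)
    case 0
    have "hfun 0 x * hfun 0 x = sqrt (2 * pi) * std_normal_density x" for x
      by (simp add: hfun_def std_normal_density_def field_simps exp_add[symmetric])
    then show ?thesis using 0 integral_std_normal_moment_even[of 0] by simp
  next
    case (Suc m)
    \<comment> \<open>After the swap the step lemma lowers the index 0 and produces the factor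
      0.\<close>
    have "(LINT x|lborel. hfun 0 x * hfun (Suc m) x) = (LINT x|lborel. hfun (Suc m) x * hfun 0 x)"
      by (simp add: mult.commute)
    then show ?thesis using Suc by (simp only: hfun_integral_step) simp
  qed
next
  case (Suc i)
  show ?case unfolding hfun_integral_step Suc by (cases j) auto
qed

section \<open>A function with vanishing moments is zero\<close>

lemma integrable_moment:
  fixes g :: "real \<Rightarrow> 'a :: {banach, second_countable_topology}"
  assumes [measurable]: "g \<in> borel_measurable borel"
    and int: "\<And>c. integrable lborel (\<lambda>x. exp (c * \<bar>x\<bar>) *\<^sub>R g x)"
  shows "integrable lborel (\<lambda>x. x ^ k *\<^sub>R g x)"
proof (rule Bochner_Integration.integrable_bound[OF int[of "real k"]])
  have "\<bar>x\<bar> ^ k \<le> exp (real k * \<bar>x\<bar>)" for x :: real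
    unfolding exp_of_nat_mult by (intro power_mono) (auto intro: order.trans[OF _ exp_ge_add_one_self])
  then show "AE x in lborel. norm (x ^ k *\<^sub>R g x) \<le> norm (exp (real k * \<bar>x\<bar>) *\<^sub>R g x)"
    by (auto simp: abs_mult power_abs intro!: mult_right_mono)
qed measurable

text \<open>Exponential integrability lets the power series of exp (i t x) be integrated termwise,
  so all Fourier integrals of g vanish. The positive and negative parts of g then have the same mass
  m; if m > 0, dividing by m gives two probability densities with the same characteristic function,
  and Levy's theorem identifies them.\<close>

lemma moments_zero_real:
  fixes g :: "real \<Rightarrow> real"
  assumes [measurable]: "g \<in> borel_measurable borel"
    and int: "\<And>c. integrable lborel (\<lambda>x. exp (c * \<bar>x\<bar>) * g x)"
    and mom: "\<And>k. (LINT x|lborel. x ^ k * g x) = 0"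
  shows "AE x in lborel. g x = 0"
proof -
  have g: "integrable lborel g" using int[of 0] by simp
  have intk: "integrable lborel (\<lambda>x. x ^ k * g x)" for k
    using integrable_moment[of g k] int by simp
  have fourier: "(LINT x|lborel. g x *\<^sub>R iexp (t * x)) = 0" for t
  proof -
    have "(\<lambda>n. LINT x|lborel. g x *\<^sub>R (\<Sum>k<n. (\<i> * of_real (t * x)) ^ k /\<^sub>R fact k))
        \<longlonglongrightarrow> (LINT x|lborel. g x *\<^sub>R iexp (t * x))"
    proof (rule integral_dominated_convergence[where w = "\<lambda>x. \<bar>exp (\<bar>t\<bar> * \<bar>x\<bar>) * g x\<bar>"])
      show "integrable lborel (\<lambda>x. \<bar>exp (\<bar>t\<bar> * \<bar>x\<bar>) * g x\<bar>)"
        using int[of "\<bar>t\<bar>"] by (rule integrable_abs)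
      show "AE x in lborel. (\<lambda>n. g x *\<^sub>R (\<Sum>k<n. (\<i> * of_real (t * x)) ^ k /\<^sub>R fact k))
          \<longlonglongrightarrow> g x *\<^sub>R iexp (t * x)"
        using exp_converges[of "\<i> * of_real (t * x)" for x]
        by (auto intro!: tendsto_intros simp: sums_def)
      have "norm (g x *\<^sub>R (\<Sum>k<n. (\<i> * of_real (t * x)) ^ k /\<^sub>R fact k)) \<le> \<bar>exp (\<bar>t\<bar> * \<bar>x\<bar>) * g x\<bar>"
        for n x
      proof -
        have "norm (\<Sum>k<n. (\<i> * of_real (t * x)) ^ k /\<^sub>R fact k) \<le> (\<Sum>k<n. \<bar>t * x\<bar> ^ k /\<^sub>R fact k)"
          by (rule sum_norm_le) (simp add: norm_power norm_mult abs_mult)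
        also have "\<dots> \<le> exp \<bar>t * x\<bar>"
          using exp_converges[of "\<bar>t * x\<bar>"]
          by (intro sum_le_suminf[OF sums_summable, THEN order.trans]) (auto simp: sums_iff)
        finally show ?thesis by (simp add: abs_mult mult.commute[of "\<bar>g x\<bar>"] mult_right_mono)
      qed
      then show "AE x in lborel. norm (g x *\<^sub>R (\<Sum>k<n. (\<i> * of_real (t * x)) ^ k /\<^sub>R fact k))
          \<le> \<bar>exp (\<bar>t\<bar> * \<bar>x\<bar>) * g x\<bar>" for n by simp
    qed measurable
    moreover have "(LINT x|lborel. g x *\<^sub>R (\<Sum>k<n. (\<i> * of_real (t * x)) ^ k /\<^sub>R fact k)) = 0" for n
    proof -
      have "g x *\<^sub>R (\<Sum>k<n. (\<i> * of_real (t * x)) ^ k /\<^sub>R fact k)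
          = (\<Sum>k<n. (\<i> * of_real t) ^ k / fact k * of_real (x ^ k * g x))" for x
        by (simp add: sum_distrib_left power_mult_distrib scaleR_conv_of_real field_simps)
      then have "(LINT x|lborel. g x *\<^sub>R (\<Sum>k<n. (\<i> * of_real (t * x)) ^ k /\<^sub>R fact k))
          = (\<Sum>k<n. LINT x|lborel. (\<i> * of_real t) ^ k / fact k * of_real (x ^ k * g x))"
        by (simp only:) (intro Bochner_Integration.integral_sum integrable_mult_right integrable_of_real intk)
      also have "\<dots> = 0"
        by (intro sum.neutral ballI) (simp only: integral_mult_right_zero integral_complex_of_real mom of_real_0 mult_zero_right)
      finally show ?thesis .
    qed
    ultimately show ?thesis by (simp add: LIMSEQ_const_iff)
  qed
  define p q where "p = (\<lambda>x. max 0 (g x))" and "q = (\<lambda>x. max 0 (- g x))"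
  have pq: "g x = p x - q x" "p x \<ge> 0" "q x \<ge> 0" for x by (auto simp: p_def q_def)
  have [measurable]: "p \<in> borel_measurable borel" "q \<in> borel_measurable borel"
    by (simp_all add: p_def q_def)
  have int_pq: "integrable lborel p" "integrable lborel q"
    using g unfolding p_def q_def by (auto intro: Bochner_Integration.integrable_bound[OF g])
  define m where "m = (LINT x|lborel. p x)"
  have mq: "(LINT x|lborel. q x) = m"
    using mom[of 0] Bochner_Integration.integral_diff[OF int_pq] by (simp add: pq(1) m_def)
  have "m \<ge> 0" unfolding m_def by (intro integral_nonneg_AE) (simp add: pq)
  show ?thesis
  proof (cases "m = 0")
    case True
    have "AE x in lborel. p x = 0" "AE x in lborel. q x = 0"
      using integral_nonneg_eq_0_iff_AE[OF int_pq(1)] integral_nonneg_eq_0_iff_AE[OF int_pq(2)]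
        True mq m_def pq by auto
    then show ?thesis by eventually_elim (simp add: pq(1))
  next
    case False
    then have m: "m > 0" using \<open>m \<ge> 0\<close> by simp
    have distr: "real_distribution (density lborel (\<lambda>x. ennreal (r x / m)))"
      if r: "integrable lborel r" "\<And>x. r x \<ge> 0" "(LINT x|lborel. r x) = m" for r
    proof -
      have [measurable]: "r \<in> borel_measurable borel" using r(1) by auto
      have "(\<integral>\<^sup>+x. ennreal (r x / m) \<partial>lborel) = ennreal (LINT x|lborel. r x / m)"
        using r m by (intro nn_integral_eq_integral) auto
      then have "emeasure (density lborel (\<lambda>x. ennreal (r x / m))) UNIV = 1"
        using r m by (simp add: emeasure_density)
      then interpret prob_space "density lborel (\<lambda>x. ennreal (r x / m))"
        by (intro prob_spaceI) simp
      show ?thesis by unfold_locales auto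
    qed
    have char: "char (density lborel (\<lambda>x. ennreal (r x / m))) t
        = (LINT x|lborel. r x *\<^sub>R iexp (t * x)) / of_real m"
      if r: "integrable lborel r" "\<And>x. r x \<ge> 0" for r t
    proof -
      have [measurable]: "r \<in> borel_measurable borel" using r(1) by auto
      have "char (density lborel (\<lambda>x. ennreal (r x / m))) t = (LINT x|lborel. (r x / m) *\<^sub>R iexp (t * x))"
        unfolding char_def using r m by (intro integral_density) auto
      also have "\<dots> = (LINT x|lborel. (r x *\<^sub>R iexp (t * x)) / of_real m)"
        by (simp add: scaleR_conv_of_real)
      finally show ?thesis by simp
    qed
    have ie: "integrable lborel (\<lambda>x. r x *\<^sub>R iexp (t * x))" if "integrable lborel r" for r t
      by (rule Bochner_Integration.integrable_bound[OF that]) (use that in auto)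
    have "(LINT x|lborel. p x *\<^sub>R iexp (t * x)) = (LINT x|lborel. q x *\<^sub>R iexp (t * x))" for t
      using fourier[of t] Bochner_Integration.integral_diff[OF ie[OF int_pq(1)] ie[OF int_pq(2)], of t t]
      by (simp add: pq(1) scaleR_diff_left)
    then have "char (density lborel (\<lambda>x. ennreal (p x / m))) = char (density lborel (\<lambda>x. ennreal (q x / m)))"
      by (intro ext) (simp add: char int_pq pq)
    then have "density lborel (\<lambda>x. ennreal (p x / m)) = density lborel (\<lambda>x. ennreal (q x / m))"
      by (intro Levy_uniqueness distr int_pq pq mq m_def[symmetric])
    then have "AE x in lborel. ennreal (p x / m) = ennreal (q x / m)"
      by (intro sigma_finite_measure.density_unique[OF sigma_finite_lborel]) auto
    then show ?thesis
    proof eventually_elim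
      case (elim x)
      then have "p x / m = q x / m" using m pq(2,3)[of x] by (subst (asm) ennreal_inj) auto
      then show ?case using m by (simp add: pq(1))
    qed
  qed
qed

lemma moments_zero:
  fixes g :: "real \<Rightarrow> complex"
  assumes [measurable]: "g \<in> borel_measurable borel"
    and int: "\<And>c. integrable lborel (\<lambda>x. exp (c * \<bar>x\<bar>) *\<^sub>R g x)"
    and mom: "\<And>k. (LINT x|lborel. x ^ k *\<^sub>R g x) = 0"
  shows "AE x in lborel. g x = 0"
proof -
  have intk: "integrable lborel (\<lambda>x. x ^ k *\<^sub>R g x)" for k
    by (rule integrable_moment[OF assms(1) int])
  have "AE x in lborel. Re (g x) = 0"
  proof (rule moments_zero_real)
    show "integrable lborel (\<lambda>x. exp (c * \<bar>x\<bar>) * Re (g x))" for c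
      using integrable_Re[OF int[of c]] by simp
    show "(LINT x|lborel. x ^ k * Re (g x)) = 0" for k
      using integral_Re[OF intk[of k]] mom[of k] by simp
  qed measurable
  moreover have "AE x in lborel. Im (g x) = 0"
  proof (rule moments_zero_real)
    show "integrable lborel (\<lambda>x. exp (c * \<bar>x\<bar>) * Im (g x))" for c
      using integrable_Im[OF int[of c]] by simp
    show "(LINT x|lborel. x ^ k * Im (g x)) = 0" for k
      using integral_Im[OF intk[of k]] mom[of k] by simp
  qed measurable
  ultimately show ?thesis by eventually_elim (simp add: complex_eq_iff)
qed

section \<open>Homogeneous substitution in polynomials\<close>

text \<open>A polynomial of degree at most \<open>n\<close> stands for the form of degree \<open>n\<close> in two variables
  obtained by homogenisation; \<open>hsub n A B\<close> substitutes \<open>(A, B)\<close> for these variables.\<close>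

definition hsub :: "nat \<Rightarrow> complex poly \<Rightarrow> complex poly \<Rightarrow> complex poly \<Rightarrow> complex poly" where
  "hsub n A B p = (\<Sum>i\<le>n. smult (coeff p i) (A ^ i * B ^ (n - i)))"

lemma smult_sum_right: "smult c (\<Sum>i\<in>I. f i) = (\<Sum>i\<in>I. smult c (f i))"
  by (induction I rule: infinite_finite_induct) (auto simp: smult_add_right)

lemma hsub_add: "hsub n A B (p + q) = hsub n A B p + hsub n A B q"
  by (simp add: hsub_def smult_add_left sum.distrib)

lemma hsub_smult: "hsub n A B (smult c p) = smult c (hsub n A B p)"
  by (simp add: hsub_def smult_sum_right)

lemma hsub_sum: "hsub n A B (\<Sum>i\<in>I. f i) = (\<Sum>i\<in>I. hsub n A B (f i))"
  by (induction I rule: infinite_finite_induct) (auto simp: hsub_add, auto simp: hsub_def)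

text \<open>Substitution is multiplicative on forms; one linear factor at a time suffices because
  the eigenforms are products of linear forms. The degree bound removes the term
  \<open>A ^ Suc n\<close>, so that B can be factored out of
  \<open>hsub (Suc n) A B p\<close>.\<close>

lemma hsub_linear_factor:
  assumes "degree p \<le> n"
  shows "hsub (Suc n) A B ([:\<beta>, \<alpha>:] * p) = (smult \<alpha> A + smult \<beta> B) * hsub n A B p"
proof -
  have "[:\<beta>, \<alpha>:] * p = smult \<beta> p + smult \<alpha> (pCons 0 p)" by simp
  moreover have "hsub (Suc n) A B p = B * hsub n A B p"
    using assms by (simp add: hsub_def coeff_eq_0 sum_distrib_left Suc_diff_le mult_ac)
  moreover have "hsub (Suc n) A B (pCons 0 p) = A * hsub n A B p"
    unfolding hsub_def sum.atMost_Suc_shift by (simp add: sum_distrib_left mult_ac)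
  ultimately show ?thesis by (simp only: hsub_add hsub_smult) (simp add: algebra_simps)
qed

lemma degree_linear_powers: "degree ([:b, a:] ^ k * [:d, c:] ^ l) \<le> k + l" for a :: complex
proof (rule order.trans[OF degree_mult_le add_mono])
  have deg: "degree [:y, x:] \<le> 1" for x y :: complex by simp
  show "degree ([:b, a:] ^ k) \<le> k" "degree ([:d, c:] ^ l) \<le> l"
    using degree_power_le[of "[:b, a:]" k] degree_power_le[of "[:d, c:]" l]
      mult_le_mono1[OF deg, of b a k] mult_le_mono1[OF deg, of d c l] by linarith+
qed

lemma hsub_linear_powers:
  "hsub (k + l) A B ([:b, a:] ^ k * [:d, c:] ^ l)
    = (smult a A + smult b B) ^ k * (smult c A + smult d B) ^ l"
proof (induction k)
  case 0
  show ?case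
  proof (induction l)
    case (Suc l)
    then show ?case
      using hsub_linear_factor[of "[:d, c:] ^ l" l A B d c] degree_linear_powers[of b a 0 d c l]
      by simp
  qed (simp add: hsub_def)
next
  case (Suc k)
  then show ?case
    using hsub_linear_factor[OF degree_linear_powers, of k l A B b a b a d c]
    by (simp only: power_Suc add_Suc mult.assoc)
qed

section \<open>The l1 norm of the coefficients\<close>

definition pnorm :: "complex poly \<Rightarrow> real" where
  "pnorm p = sum_list (map cmod (coeffs p))"

lemma pnorm_pCons: "pnorm (pCons c p) = cmod c + pnorm p"
  by (auto simp: pnorm_def cCons_def)

lemma pnorm_0 [simp]: "pnorm 0 = 0"
  by (simp add: pnorm_def)

lemma pnorm_nonneg: "pnorm p \<ge> 0"
  unfolding pnorm_def by (rule sum_list_nonneg) auto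

lemma pnorm_sum_coeff: "degree p \<le> n \<Longrightarrow> pnorm p = (\<Sum>i\<le>n. cmod (coeff p i))"
proof (induction p arbitrary: n)
  case (pCons c p)
  show ?case
  proof (cases n)
    case 0
    then show ?thesis using pCons by (auto simp: pnorm_pCons split: if_splits)
  next
    case (Suc m)
    then have "degree p \<le> m" using pCons(3) by (auto split: if_splits)
    then show ?thesis unfolding Suc sum.atMost_Suc_shift by (simp add: pCons.IH pnorm_pCons)
  qed
qed simp

lemma pnorm_add: "pnorm (p + q) \<le> pnorm p + pnorm q"
proof (induction p q rule: poly_induct2)
  case (pCons a p b q)
  then show ?case using norm_triangle_ineq[of a b] by (simp add: pnorm_pCons)
qed simp

lemma pnorm_smult: "pnorm (smult c p) = cmod c * pnorm p"
  by (induction p) (simp_all add: pnorm_pCons norm_mult algebra_simps)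

lemma pnorm_sum: "pnorm (\<Sum>i\<in>I. f i) \<le> (\<Sum>i\<in>I. pnorm (f i))"
  by (induction I rule: infinite_finite_induct) (auto intro: order.trans[OF pnorm_add])

lemma pnorm_mult: "pnorm (p * q) \<le> pnorm p * pnorm q"
proof (induction p)
  case (pCons c p)
  have "pnorm (pCons c p * q) \<le> pnorm (smult c q) + pnorm (pCons 0 (p * q))"
    unfolding mult_pCons_left by (rule pnorm_add)
  also have "\<dots> \<le> pnorm (pCons c p) * pnorm q"
    using pCons.IH by (simp add: pnorm_smult pnorm_pCons distrib_right)
  finally show ?case .
qed simp

lemma pnorm_power: "pnorm (p ^ k) \<le> pnorm p ^ k"
proof (induction k)
  case (Suc k)
  have "pnorm (p ^ Suc k) \<le> pnorm p * pnorm (p ^ k)" by (simp add: pnorm_mult)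
  also have "\<dots> \<le> pnorm p ^ Suc k" using Suc by (simp add: mult_left_mono pnorm_nonneg)
  finally show ?case .
qed (simp add: pnorm_def)

lemma pnorm_powers:
  assumes "pnorm A \<le> c" "pnorm B \<le> c" "i \<le> n" shows "pnorm (A ^ i * B ^ (n - i)) \<le> c ^ n"
proof -
  have "pnorm (A ^ i * B ^ (n - i)) \<le> pnorm (A ^ i) * pnorm (B ^ (n - i))" by (rule pnorm_mult)
  also have "\<dots> \<le> c ^ i * c ^ (n - i)"
    by (intro mult_mono order.trans[OF pnorm_power] power_mono pnorm_nonneg zero_le_power assms
        order.trans[OF pnorm_nonneg assms(1)])
  finally show ?thesis using assms(3) by (simp add: power_add[symmetric])
qed

text \<open>The l1 norm is chosen because it is submultiplicative: powers of two fixed linear forms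
  then cost only \<open>c ^ n\<close>, which is where the exponential condition number comes
  from.\<close>

lemma pnorm_hsub:
  assumes "pnorm A \<le> c" "pnorm B \<le> c" "degree p \<le> n"
  shows "pnorm (hsub n A B p) \<le> c ^ n * pnorm p"
proof -
  have "pnorm (hsub n A B p) \<le> (\<Sum>i\<le>n. cmod (coeff p i) * c ^ n)"
    unfolding hsub_def
    by (intro order.trans[OF pnorm_sum] sum_mono)
      (auto simp: pnorm_smult intro!: mult_left_mono pnorm_powers assms)
  then show ?thesis by (simp add: pnorm_sum_coeff[OF assms(3)] sum_distrib_left mult.commute)
qed

lemma degree_hsub:
  assumes "degree A \<le> 1" "degree B \<le> 1" shows "degree (hsub n A B p) \<le> n"
  unfolding hsub_def
proof (rule degree_sum_le)
  fix i assume "i \<in> {..n}"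
  have "degree (A ^ i * B ^ (n - i)) \<le> degree A * i + degree B * (n - i)"
    by (intro order.trans[OF degree_mult_le] add_mono degree_power_le)
  also have "\<dots> \<le> 1 * i + 1 * (n - i)" by (intro add_mono mult_le_mono1 assms)
  finally show "degree (smult (coeff p i) (A ^ i * B ^ (n - i))) \<le> n"
    using \<open>i \<in> {..n}\<close> degree_smult_le order.trans by fastforce
qed simp

section \<open>The operator on a level of the harmonic oscillator\<close>

text \<open>Both ranges of \<open>a\<close> are treated at once: \<open>mp\<close> and
  \<open>mm\<close> enter only as the distinct roots of mu^2 - mu + a, with positive real
  parts.\<close>

locale kfp =
  fixes a :: real and mp mm :: complex
  assumes a_pos: "a > 0" and sum_mu: "mp + mm = 1" and prod_mu: "mp * mm = of_real a"
    and mu_neq: "mp \<noteq> mm" and Re_mp: "Re mp > 0" and Re_mm: "Re mm > 0"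
begin

definition s :: real where "s = sqrt a"

lemma s_pos: "s > 0" using a_pos by (simp add: s_def)

lemma s_sq: "of_real s * of_real s = (mp * mm :: complex)"
  unfolding prod_mu s_def using a_pos by (simp flip: of_real_mult)

lemma mp_sq: "mp * mp + of_real s * of_real s = mp"
  unfolding s_sq using sum_mu by (metis distrib_left mult.right_neutral)

lemma mm_sq: "mm * mm + of_real s * of_real s = mm"
  unfolding s_sq using sum_mu by (metis distrib_right mult_1 add.commute)

text \<open>On forms in \<open>X\<close> and \<open>Y\<close>, with \<open>b\<^sup>*, c\<^sup>*\<close> multiplication by \<open>X, Y\<close> and \<open>b, c\<close> the partial derivatives,
  this is \<open>b\<^sup>* b + s (b\<^sup>* c - c\<^sup>* b)\<close>, written at \<open>Y = 1\<close>; on degree \<open>n\<close>, \<open>c\<close> becomes \<open>n - X d/dX\<close>.\<close>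

definition Kpoly :: "nat \<Rightarrow> complex poly \<Rightarrow> complex poly" where
  "Kpoly n p = [:- of_real s, 1, - of_real s:] * pderiv p + [:0, of_nat n * of_real s:] * p"

lemma coeff_Kpoly:
  "coeff (Kpoly n p) i = of_nat i * coeff p i - of_real s * of_nat (Suc i) * coeff p (Suc i)
     + (if i = 0 then 0 else of_real s * (of_nat n - of_nat (i - 1)) * coeff p (i - 1))"
proof (cases i)
  case (Suc j)
  then show ?thesis
    by (cases j) (simp_all add: Kpoly_def coeff_pderiv algebra_simps)
qed (simp add: Kpoly_def coeff_pderiv)

section \<open>Eigenforms of a block and coordinates along them\<close>

definition eigpoly :: "nat \<Rightarrow> nat \<Rightarrow> complex poly" where
  "eigpoly n k = [:of_real s, - mp:] ^ k * [:of_real s, - mm:] ^ (n - k)"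

definition lam :: "nat \<Rightarrow> nat \<Rightarrow> complex" where
  "lam n k = of_nat k * mp + of_nat (n - k) * mm"

text \<open>The first-order part D is a derivation, and mu^2 + s^2 = mu gives D L = (mu - s X) L for
  L = s - mu X. Hence D multiplies the product by k (mp - s X) + (n - k) (mm - s X), and the
  multiplication term n s X of \<open>Kpoly\<close> cancels the part containing X.\<close>

lemma Kpoly_eigpoly:
  assumes "k \<le> n" shows "Kpoly n (eigpoly n k) = smult (lam n k) (eigpoly n k)"
proof -
  define D where "D p = [:- of_real s, 1, - of_real s:] * pderiv p" for p :: "complex poly"
  have Dmult: "D (p * q) = D p * q + p * D q" for p q
    by (simp add: D_def pderiv_mult algebra_simps del: mult_pCons_left mult_pCons_right)
  have D_lin: "D [:of_real s, - \<mu>:] = [:\<mu>, - of_real s:] * [:of_real s, - \<mu>:]"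
    if "\<mu> * \<mu> + of_real s * of_real s = \<mu>" for \<mu>
    using that by (simp add: D_def pderiv_pCons algebra_simps)
  have D_pow: "D (L ^ m) = of_nat m * q * L ^ m" if "D L = q * L" for L q m
  proof (induction m)
    case (Suc m)
    then show ?case by (simp only: power_Suc Dmult that) (simp add: algebra_simps)
  qed (simp add: D_def)
  have "D (eigpoly n k) = (of_nat k * [:mp, - of_real s:] + of_nat (n - k) * [:mm, - of_real s:]) * eigpoly n k"
    unfolding eigpoly_def Dmult D_pow[OF D_lin[OF mp_sq]] D_pow[OF D_lin[OF mm_sq]]
    by (simp only: algebra_simps)
  also have "of_nat k * [:mp, - of_real s:] + of_nat (n - k) * [:mm, - of_real s:]
      = [:lam n k, - (of_nat n * of_real s):]"
    using assms by (simp add: of_nat_poly lam_def of_nat_diff algebra_simps)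
  finally show ?thesis
    unfolding Kpoly_def D_def[symmetric] by (simp only: distrib_right[symmetric]) simp
qed

text \<open>The linear forms that substitute the two eigenforms back into \<open>X\<close> and \<open>1\<close>.\<close>

definition subA :: "complex poly" where "subA = [:1 / (mp - mm), - (1 / (mp - mm)):]"
definition subB :: "complex poly" where
  "subB = [:(1 + mm / (mp - mm)) / of_real s, - (mm / (mp - mm)) / of_real s:]"

text \<open>Expressing both variables through the two eigenforms rewrites p as a form in them; its
  k-th coefficient is the coordinate of p along \<open>eigpoly n k\<close>. This explicit shape is
  what allows the size of the coordinates to be estimated.\<close>

definition eigcoef :: "nat \<Rightarrow> complex poly \<Rightarrow> nat \<Rightarrow> complex" where
  "eigcoef n p k = coeff (hsub n subA subB p) k"

lemma poly_of_degree_le: "degree p \<le> n \<Longrightarrow> (\<Sum>i\<le>n. smult (coeff p i) ([:0, 1:] ^ i)) = p"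
  by (simp add: poly_as_sum_of_monoms' flip: monom_altdef)

text \<open>The two linear substitutions are inverse to each other. Facts A and B check this on the
  two variables, and multiplicativity carries it to monomials. \<open>eigcoef_eigpoly\<close> is the
  composition in the other order.\<close>

lemma sum_eigpoly:
  assumes "degree p \<le> n" shows "(\<Sum>k\<le>n. smult (eigcoef n p k) (eigpoly n k)) = p"
proof -
  let ?L = "[:of_real s, - mp:]" and ?M = "[:of_real s, - mm:]"
  have d: "mp - mm \<noteq> 0" using mu_neq by simp
  have s: "complex_of_real s \<noteq> 0" using s_pos by simp
  have d1: "mp / (mp - mm) - mm / (mp - mm) = 1" using d by (simp add: diff_divide_distrib[symmetric])
  have A: "smult (- (1 / (mp - mm))) ?L + smult (1 / (mp - mm)) ?M = [:0, 1:]"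
    using d1 by simp
  have "mp * (mm / (mp - mm)) / of_real s - mm * ((1 + mm / (mp - mm)) / of_real s) = 0"
    using d s by (simp add: field_simps)
  then have B: "smult (- (mm / (mp - mm)) / of_real s) ?L + smult ((1 + mm / (mp - mm)) / of_real s) ?M = 1"
    using s by (simp add: one_pCons mult.commute)
  have "(\<Sum>k\<le>n. smult (eigcoef n p k) (eigpoly n k)) = hsub n ?L ?M (hsub n subA subB p)"
    by (simp add: hsub_def[of n ?L ?M] eigcoef_def eigpoly_def)
  also have "\<dots> = (\<Sum>i\<le>n. smult (coeff p i) (hsub n ?L ?M (subA ^ i * subB ^ (n - i))))"
    unfolding hsub_def[of n subA subB] by (simp only: hsub_sum hsub_smult)
  also have "\<dots> = (\<Sum>i\<le>n. smult (coeff p i) ([:0, 1:] ^ i))"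
  proof (intro sum.cong refl)
    fix i assume "i \<in> {..n}"
    then have "hsub n ?L ?M (subA ^ i * subB ^ (n - i)) = [:0, 1:] ^ i * 1 ^ (n - i)"
      using hsub_linear_powers[of i "n - i" ?L ?M "1 / (mp - mm)" "- (1 / (mp - mm))"
          "(1 + mm / (mp - mm)) / of_real s" "- (mm / (mp - mm)) / of_real s"]
      by (simp only: subA_def subB_def A B) simp
    then show "smult (coeff p i) (hsub n ?L ?M (subA ^ i * subB ^ (n - i))) = smult (coeff p i) ([:0, 1:] ^ i)"
      by simp
  qed
  finally show ?thesis using poly_of_degree_le[OF assms] by simp
qed

lemma eigcoef_eigpoly:
  assumes "l \<le> n" shows "eigcoef n (eigpoly n l) k = (if k = l then 1 else 0)"
proof -
  have d: "mp - mm \<noteq> 0" using mu_neq by simp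
  have s: "complex_of_real s \<noteq> 0" using s_pos by simp
  have "mp / (mp - mm) - mm / (mp - mm) = 1" using d by (simp add: diff_divide_distrib[symmetric])
  then have "mp / (mp - mm) = 1 + mm / (mp - mm)" by (simp add: diff_eq_eq)
  then have A: "smult (- mp) subA + smult (of_real s) subB = [:0, 1:]"
    using s by (simp add: subA_def subB_def)
  have B: "smult (- mm) subA + smult (of_real s) subB = 1"
    using s by (simp add: subA_def subB_def one_pCons)
  have "hsub n subA subB (eigpoly n l) = [:0, 1:] ^ l * 1 ^ (n - l)"
    using hsub_linear_powers[of l "n - l" subA subB "of_real s" "- mp" "of_real s" "- mm"] assms
    by (simp only: eigpoly_def A B) simp
  then show ?thesis by (simp add: eigcoef_def flip: monom_altdef[of 1, simplified])
qed

lemma eigcoef_add: "eigcoef n (p + q) k = eigcoef n p k + eigcoef n q k"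
  by (simp add: eigcoef_def hsub_add)

lemma eigcoef_smult: "eigcoef n (smult c p) k = c * eigcoef n p k"
  by (simp add: eigcoef_def hsub_smult)

lemma eigcoef_sum: "eigcoef n (\<Sum>i\<in>I. f i) k = (\<Sum>i\<in>I. eigcoef n (f i) k)"
  by (simp add: eigcoef_def hsub_sum coeff_sum)

lemma degree_eigpoly: "k \<le> n \<Longrightarrow> degree (eigpoly n k) \<le> n"
  using degree_linear_powers[of "of_real s" "- mp" k "of_real s" "- mm" "n - k"] by (simp add: eigpoly_def)

section \<open>Functional calculus of a block in its eigenbasis\<close>

definition fcalc :: "nat \<Rightarrow> (nat \<Rightarrow> complex) \<Rightarrow> complex poly \<Rightarrow> complex poly" where
  "fcalc n m p = (\<Sum>k\<le>n. smult (m k * eigcoef n p k) (eigpoly n k))"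

lemma degree_fcalc: "degree (fcalc n m p) \<le> n"
  unfolding fcalc_def by (rule degree_sum_le) (auto intro: order.trans[OF degree_smult_le] degree_eigpoly)

lemma eigcoef_fcalc: "k \<le> n \<Longrightarrow> eigcoef n (fcalc n m p) k = m k * eigcoef n p k"
  by (simp add: fcalc_def eigcoef_sum eigcoef_smult eigcoef_eigpoly if_distrib cong: if_cong)

lemma fcalc_fcalc: "fcalc n m (fcalc n m' p) = fcalc n (\<lambda>k. m k * m' k) p"
  unfolding fcalc_def[of n m] fcalc_def[of n "\<lambda>k. m k * m' k"]
  by (intro sum.cong refl) (simp add: eigcoef_fcalc mult_ac)

lemma fcalc_1: "degree p \<le> n \<Longrightarrow> fcalc n (\<lambda>_. 1) p = p"
  by (simp add: fcalc_def sum_eigpoly)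

lemma fcalc_cong: "(\<And>k. k \<le> n \<Longrightarrow> m k = m' k) \<Longrightarrow> fcalc n m p = fcalc n m' p"
  by (simp add: fcalc_def)

lemma fcalc_add: "fcalc n m (p + q) = fcalc n m p + fcalc n m q"
  by (simp add: fcalc_def eigcoef_add distrib_left smult_add_left sum.distrib)

lemma fcalc_smult: "fcalc n m (smult c p) = smult c (fcalc n m p)"
  by (simp add: fcalc_def eigcoef_smult smult_sum_right mult_ac)

lemma Kpoly_add: "Kpoly n (p + q) = Kpoly n p + Kpoly n q"
  by (simp only: Kpoly_def pderiv_add distrib_left add_ac)

lemma Kpoly_smult: "Kpoly n (smult c p) = smult c (Kpoly n p)"
  by (simp add: Kpoly_def pderiv_smult smult_add_right)

lemma Kpoly_sum: "Kpoly n (\<Sum>i\<in>I. f i) = (\<Sum>i\<in>I. Kpoly n (f i))"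
  by (induction I rule: infinite_finite_induct) (auto simp: Kpoly_add, auto simp: Kpoly_def)

lemma fcalc_minus: "fcalc n (\<lambda>k. m k - m' k) p = fcalc n m p - fcalc n m' p"
  by (simp add: fcalc_def left_diff_distrib smult_diff_left sum_subtractf)

lemma fcalc_const: "degree p \<le> n \<Longrightarrow> fcalc n (\<lambda>k. c) p = smult c p"
  using fcalc_1[of "smult c p" n] degree_smult_le[of c p]
  by (simp add: fcalc_def eigcoef_smult)

lemma Kpoly_fcalc: assumes "degree p \<le> n" shows "Kpoly n p = fcalc n (lam n) p"
proof -
  have "Kpoly n p = Kpoly n (fcalc n (\<lambda>_. 1) p)" by (simp add: fcalc_1 assms)
  also have "\<dots> = fcalc n (lam n) p"
    by (simp add: fcalc_def Kpoly_sum Kpoly_smult Kpoly_eigpoly mult.commute)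
  finally show ?thesis .
qed

lemma degree_Kpoly: "degree p \<le> n \<Longrightarrow> degree (Kpoly n p) \<le> n"
  by (simp add: Kpoly_fcalc degree_fcalc)

lemma Kpoly_shift_fcalc:
  assumes "degree p \<le> n" shows "Kpoly n p - smult w p = fcalc n (\<lambda>k. lam n k - w) p"
  using assms by (simp add: fcalc_minus Kpoly_fcalc fcalc_const)

section \<open>Conditioning of the eigenbasis\<close>

definition cond1 :: real where
  "cond1 = max (pnorm [:of_real s, - mp:]) (pnorm [:of_real s, - mm:]) * max (pnorm subA) (pnorm subB)"

lemma cond1_nonneg: "cond1 \<ge> 0"
  by (simp add: cond1_def pnorm_nonneg le_max_iff_disj)

text \<open>One factor \<open>c' ^ n\<close> is paid for passing to the eigen-coordinates and one
  factor \<open>c ^ n\<close> for coming back; \<open>cond1\<close> is the product of the two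
  bases.\<close>

lemma pnorm_fcalc:
  assumes "degree p \<le> n" "\<And>k. k \<le> n \<Longrightarrow> cmod (m k) \<le> M"
  shows "pnorm (fcalc n m p) \<le> M * cond1 ^ n * pnorm p"
proof -
  define c where "c = max (pnorm [:of_real s, - mp:]) (pnorm [:of_real s, - mm:])"
  define c' where "c' = max (pnorm subA) (pnorm subB)"
  have c: "c \<ge> 0" by (simp add: c_def pnorm_nonneg le_max_iff_disj)
  have M: "M \<ge> 0" using assms(2)[of 0] norm_ge_zero[of "m 0"] by linarith
  have "pnorm (fcalc n m p) \<le> (\<Sum>k\<le>n. (M * cmod (eigcoef n p k)) * c ^ n)"
    unfolding fcalc_def eigpoly_def
  proof (intro order.trans[OF pnorm_sum] sum_mono)
    fix k assume k: "k \<in> {..n}"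
    have "cmod (m k * eigcoef n p k) \<le> M * cmod (eigcoef n p k)"
      using k by (simp add: norm_mult mult_right_mono assms)
    then show "pnorm (smult (m k * eigcoef n p k) ([:of_real s, - mp:] ^ k * [:of_real s, - mm:] ^ (n - k)))
        \<le> (M * cmod (eigcoef n p k)) * c ^ n"
      unfolding pnorm_smult using k M
      by (intro mult_mono pnorm_powers) (auto simp: c_def pnorm_nonneg)
  qed
  also have "\<dots> = M * c ^ n * pnorm (hsub n subA subB p)"
    by (subst pnorm_sum_coeff[OF degree_hsub]) (auto simp: subA_def subB_def eigcoef_def sum_distrib_left mult_ac)
  also have "\<dots> \<le> M * c ^ n * (c' ^ n * pnorm p)"
    using M c by (intro mult_left_mono pnorm_hsub assms) (auto simp: c'_def)
  finally show ?thesis by (simp add: cond1_def c_def c'_def power_mult_distrib mult_ac)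
qed

text \<open>The squared Hilbert norm of the form (see \<open>norm_Jn\<close>), known as the Fischer
  or Bombieri norm.\<close>

definition hsq :: "nat \<Rightarrow> complex poly \<Rightarrow> real" where
  "hsq n p = (\<Sum>i\<le>n. fact i * fact (n - i) * (cmod (coeff p i))\<^sup>2)"

lemma hsq_nonneg: "hsq n p \<ge> 0"
  unfolding hsq_def by (intro sum_nonneg) simp

lemma hsq_le_pnorm:
  assumes "degree p \<le> n" shows "hsq n p \<le> fact n * (pnorm p)\<^sup>2"
proof -
  have "hsq n p \<le> (\<Sum>i\<le>n. fact n * (cmod (coeff p i))\<^sup>2)"
    unfolding hsq_def
  proof (intro sum_mono mult_right_mono)
    fix i assume "i \<in> {..n}"
    then have i: "i \<le> n" by simp
    have "fact i * fact (n - i) * 1 \<le> fact i * fact (n - i) * (n choose i)"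
      using i by (intro mult_left_mono) (auto simp: Suc_leI)
    then have "fact i * fact (n - i) \<le> (fact n :: nat)"
      by (simp only: binomial_fact_lemma[OF i] mult_1_right)
    then have "real (fact i * fact (n - i)) \<le> real (fact n)" by (rule of_nat_mono)
    then show "fact i * fact (n - i) \<le> (fact n :: real)" by simp
  qed simp
  also have "\<dots> = fact n * (\<Sum>i\<le>n. (cmod (coeff p i))\<^sup>2)" by (simp add: sum_distrib_left)
  also have "(\<Sum>i\<le>n. (cmod (coeff p i))\<^sup>2) \<le> (\<Sum>i\<le>n. cmod (coeff p i) * pnorm p)"
    unfolding power2_eq_square pnorm_sum_coeff[OF assms]
    by (intro sum_mono mult_left_mono member_le_sum) auto
  also have "\<dots> = (pnorm p)\<^sup>2"
    by (simp add: power2_eq_square pnorm_sum_coeff[OF assms] sum_distrib_right)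
  finally show ?thesis by simp
qed

text \<open>n! / (i! (n - i)!) is a binomial coefficient, and these add up to 2^n. The factor n!
  also occurs in \<open>hsq_le_pnorm\<close>, so it cancels in \<open>hsq_fcalc\<close> and the
  change of norm only doubles \<open>cond1\<close>.\<close>

lemma pnorm_le_hsq:
  assumes "degree p \<le> n" shows "fact n * (pnorm p)\<^sup>2 \<le> (2 ^ n)\<^sup>2 * hsq n p"
proof -
  define x where "x = sqrt (hsq n p / fact n)"
  have "cmod (coeff p i) \<le> real (n choose i) * x" if "i \<le> n" for i
  proof -
    let ?b = "real (n choose i)"
    have "fact i * fact (n - i) * (cmod (coeff p i))\<^sup>2 \<le> hsq n p"
      unfolding hsq_def using that by (intro member_le_sum) auto
    then have "?b * (fact i * fact (n - i) * (cmod (coeff p i))\<^sup>2) \<le> ?b * hsq n p"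
      by (rule mult_left_mono) simp
    moreover have "?b * (fact i * fact (n - i) * (cmod (coeff p i))\<^sup>2)
        = real (fact i * fact (n - i) * (n choose i)) * (cmod (coeff p i))\<^sup>2"
      by simp
    then have "?b * (fact i * fact (n - i) * (cmod (coeff p i))\<^sup>2) = fact n * (cmod (coeff p i))\<^sup>2"
      by (simp only: binomial_fact_lemma[OF that] of_nat_fact)
    ultimately have "fact n * (cmod (coeff p i))\<^sup>2 \<le> ?b * hsq n p" by (simp only:)
    then have "(cmod (coeff p i))\<^sup>2 \<le> ?b * (hsq n p / fact n)"
      by (simp add: field_simps)
    \<comment> \<open>Weakening \<open>?b\<close> to its square makes the right-hand side a perfect
      square, so the root can be taken.\<close>
    also have "\<dots> \<le> ?b\<^sup>2 * (hsq n p / fact n)"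
      using that hsq_nonneg by (intro mult_right_mono) (auto simp: power2_eq_square Suc_leI)
    also have "\<dots> = (?b * x)\<^sup>2" using hsq_nonneg[of n p] by (simp add: power_mult_distrib x_def)
    finally show ?thesis using hsq_nonneg[of n p] by (auto intro: power2_le_imp_le simp: x_def)
  qed
  then have "pnorm p \<le> (\<Sum>i\<le>n. real (n choose i)) * x"
    unfolding pnorm_sum_coeff[OF assms] sum_distrib_right by (intro sum_mono) auto
  also have "(\<Sum>i\<le>n. real (n choose i)) = 2 ^ n"
    by (metis choose_row_sum of_nat_sum of_nat_numeral of_nat_power)
  finally have "(pnorm p)\<^sup>2 \<le> (2 ^ n * x)\<^sup>2" by (intro power_mono pnorm_nonneg)
  also have "\<dots> = (2 ^ n)\<^sup>2 * (hsq n p / fact n)"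
    using hsq_nonneg[of n p] by (simp add: power_mult_distrib x_def)
  finally show ?thesis by (simp add: field_simps)
qed

lemma hsq_fcalc:
  assumes "degree p \<le> n" "\<And>k. k \<le> n \<Longrightarrow> cmod (m k) \<le> M"
  shows "sqrt (hsq n (fcalc n m p)) \<le> M * (2 * cond1) ^ n * sqrt (hsq n p)"
proof -
  have M: "M \<ge> 0" using assms(2)[of 0] norm_ge_zero[of "m 0"] by linarith
  have "hsq n (fcalc n m p) \<le> fact n * (pnorm (fcalc n m p))\<^sup>2"
    by (rule hsq_le_pnorm[OF degree_fcalc])
  also have "\<dots> \<le> fact n * (M * cond1 ^ n * pnorm p)\<^sup>2"
    by (intro mult_left_mono power_mono pnorm_fcalc assms pnorm_nonneg) auto
  also have "\<dots> = (M * cond1 ^ n)\<^sup>2 * (fact n * (pnorm p)\<^sup>2)" by (simp add: power_mult_distrib)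
  also have "\<dots> \<le> (M * cond1 ^ n)\<^sup>2 * ((2 ^ n)\<^sup>2 * hsq n p)"
    by (intro mult_left_mono pnorm_le_hsq assms) auto
  also have "\<dots> = (M * (2 * cond1) ^ n)\<^sup>2 * hsq n p" by (simp add: power_mult_distrib mult_ac)
  finally have "sqrt (hsq n (fcalc n m p)) \<le> sqrt ((M * (2 * cond1) ^ n)\<^sup>2 * hsq n p)" by simp
  also have "\<dots> = M * (2 * cond1) ^ n * sqrt (hsq n p)"
    using M cond1_nonneg by (simp add: real_sqrt_mult)
  finally show ?thesis .
qed

text \<open>For the weights i! (n - i)! the transport part is skew: its two sums agree after an
  index shift and cancel. What remains is the sum of i! (n - i)! i |c_i|^2, the number operator in
  v.\<close>

lemma Kpoly_accretive:
  "0 \<le> (\<Sum>i\<le>n. fact i * fact (n - i) * (coeff (Kpoly n p) i \<bullet> coeff p i))" (is "_ \<le> ?S")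
  if "degree p \<le> n"
proof -
  define c where "c = coeff p"
  have c0: "c (Suc n) = 0" using that by (simp add: c_def coeff_eq_0)
  have "(\<Sum>i\<le>n. fact i * fact (n - i) * (coeff (Kpoly n p) i \<bullet> c i))
     = (\<Sum>i\<le>n. fact i * fact (n - i) * real i * (cmod (c i))\<^sup>2)
      - s * (\<Sum>i\<le>n. fact (Suc i) * fact (n - i) * (c (Suc i) \<bullet> c i))
      + s * (\<Sum>i\<le>n. if i = 0 then 0 else fact i * fact (Suc n - i) * (c (i - 1) \<bullet> c i))"
    unfolding sum_distrib_left sum_subtractf[symmetric] sum.distrib[symmetric]
  proof (intro sum.cong refl)
    fix i assume i: "i \<in> {..n}"
    have r: "of_nat i * c i = real i *\<^sub>R c i" "of_real s * of_nat (Suc i) * c (Suc i) = (s * real (Suc i)) *\<^sub>R c (Suc i)"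
      by (simp_all add: scaleR_conv_of_real)
    have r3: "of_real s * (of_nat n - of_nat (i - 1)) * c (i - 1) = (s * real (Suc n - i)) *\<^sub>R c (i - 1)" if "i \<noteq> 0"
      using i that by (simp add: scaleR_conv_of_real of_nat_diff)
    have f3: "fact (n - i) * real (Suc n - i) = fact (Suc n - i)" using i by (simp add: Suc_diff_le)
    show "fact i * fact (n - i) * (coeff (Kpoly n p) i \<bullet> c i)
      = fact i * fact (n - i) * real i * (cmod (c i))\<^sup>2 - s * (fact (Suc i) * fact (n - i) * (c (Suc i) \<bullet> c i))
       + s * (if i = 0 then 0 else fact i * fact (Suc n - i) * (c (i - 1) \<bullet> c i))"
    proof (cases "i = 0")
      case True
      then show ?thesis unfolding coeff_Kpoly c_def[symmetric] r
        by (simp add: inner_diff_left algebra_simps del: of_nat_Suc)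
    next
      case False
      then show ?thesis unfolding coeff_Kpoly c_def[symmetric] r
        by (simp only: False if_False r3[OF False] inner_add_left inner_diff_left inner_scaleR_left f3[symmetric] fact_Suc power2_norm_eq_inner)
          (simp add: algebra_simps)
    qed
  qed
  \<comment> \<open>The sum may be extended to \<open>Suc n\<close> because the degree bound gives
    \<open>c (Suc n) = 0\<close>; the shift then matches the other transport sum.\<close>
  also have "(\<Sum>i\<le>n. if i = 0 then 0 else fact i * fact (Suc n - i) * (c (i - 1) \<bullet> c i))
      = (\<Sum>i\<le>Suc n. if i = 0 then 0 else fact i * fact (Suc n - i) * (c (i - 1) \<bullet> c i))"
    by (simp add: c0)
  also have "\<dots> = (\<Sum>i\<le>n. fact (Suc i) * fact (n - i) * (c (Suc i) \<bullet> c i))"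
    unfolding sum.atMost_Suc_shift by (simp add: inner_commute)
  finally have "?S = (\<Sum>i\<le>n. fact i * fact (n - i) * real i * (cmod (c i))\<^sup>2)" by (simp add: c_def)
  then show ?thesis by (simp add: sum_nonneg)
qed

end

section \<open>Pairing with square integrable functions\<close>

lemma square_integrable_rep: "square_integrable (rep_L2 f)"
  using Quotient_rep_reflp[OF Quotient_L2, of f] by (simp add: L2_rel_def)

lemma rep_L2_measurable [measurable]: "rep_L2 f \<in> borel_measurable lborel"
  using square_integrable_rep by (simp add: square_integrable_def)

lemma abs_L2_rep: "abs_L2 (rep_L2 f) = f"
  by (rule Quotient_abs_rep[OF Quotient_L2])

lemma rep_L2_abs: "square_integrable g \<Longrightarrow> AE p in lborel. rep_L2 (abs_L2 g) p = g p"
  using Quotient_rep_abs[OF Quotient_L2, of g] by (simp add: L2_rel_def)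

lemma abs_L2_eqI: "square_integrable f \<Longrightarrow> square_integrable g \<Longrightarrow> AE p in lborel. f p = g p \<Longrightarrow> abs_L2 f = abs_L2 g"
  using Quotient_rel[OF Quotient_L2, of f g] by (simp add: L2_rel_def)

lemma rep_L2_scaleC: "AE p in lborel. rep_L2 (c *\<^sub>C f) p = c * rep_L2 f p"
proof -
  have "c *\<^sub>C f = abs_L2 (\<lambda>p. c * rep_L2 f p)"
    using scaleC.abs_eq[of "rep_L2 f" c]
    by (simp add: eq_onp_def L2_rel_def square_integrable_rep abs_L2_rep)
  then show ?thesis
    using rep_L2_abs[OF square_integrable_scale[OF square_integrable_rep]] by simp
qed

lemma inner_abs_L2:
  "square_integrable f \<Longrightarrow> square_integrable g \<Longrightarrow> abs_L2 f \<bullet> abs_L2 g = (LINT p|lborel. f p \<bullet> g p)"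
  by (subst inner_L2.abs_eq) (auto simp: eq_onp_def L2_rel_def)

lemma inner_L2_rep: "square_integrable g \<Longrightarrow> f \<bullet> abs_L2 g = (LINT p|lborel. rep_L2 f p \<bullet> g p)"
  using inner_abs_L2[OF square_integrable_rep, of g f] by (simp add: abs_L2_rep)

lemma square_integrable_cnj: "square_integrable f \<Longrightarrow> square_integrable (\<lambda>p. cnj (f p))"
  unfolding square_integrable_def by (auto intro!: borel_measurable_continuous_on[of cnj] continuous_intros)

lemma integrable_mult:
  assumes "square_integrable f" "square_integrable g"
  shows "integrable lborel (\<lambda>p. f p * g p)"
proof -
  have [measurable]: "f \<in> borel_measurable lborel" "g \<in> borel_measurable lborel"
    using assms by (auto simp: square_integrable_def)
  have "integrable lborel (\<lambda>p. (cmod (f p))\<^sup>2 + (cmod (g p))\<^sup>2)"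
    using assms by (auto simp: square_integrable_def)
  then show ?thesis
  proof (rule Bochner_Integration.integrable_bound)
    have "cmod (x * y) \<le> (cmod x)\<^sup>2 + (cmod y)\<^sup>2" for x y
    proof -
      have "0 \<le> cmod x * cmod y" "2 * (cmod x * cmod y) \<le> (cmod x)\<^sup>2 + (cmod y)\<^sup>2"
        using sum_squares_bound[of "cmod x" "cmod y"] by (simp_all add: mult.assoc)
      then show ?thesis unfolding norm_mult by linarith
    qed
    then show "AE p in lborel. norm (f p * g p) \<le> norm ((cmod (f p))\<^sup>2 + (cmod (g p))\<^sup>2)"
      by simp
  qed measurable
qed

lemma dist_of_integrable: "square_integrable \<psi> \<Longrightarrow> integrable lborel (\<lambda>p. rep_L2 f p * \<psi> p)"
  by (rule integrable_mult[OF square_integrable_rep])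

lemma dist_of_abs: "square_integrable g \<Longrightarrow> square_integrable \<psi> \<Longrightarrow> dist_of (abs_L2 g) \<psi> = (LINT p|lborel. g p * \<psi> p)"
proof -
  assume sq: "square_integrable g" "square_integrable \<psi>"
  then have [measurable]: "g \<in> borel_measurable lborel" "\<psi> \<in> borel_measurable lborel"
    by (auto simp: square_integrable_def)
  have "AE p in lborel. rep_L2 (abs_L2 g) p * \<psi> p = g p * \<psi> p"
    using rep_L2_abs[OF sq(1)] by eventually_elim simp
  then show ?thesis unfolding dist_of_def by (intro integral_cong_AE) measurable
qed

text \<open>The pairing is bilinear, while \<open>inner\<close> on \<open>L2\<close> is only the
  real part of the hermitian product; the imaginary part is recovered by pairing with i times the
  conjugate. This is how continuity in f reaches \<open>dist_of\<close>.\<close>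

lemma dist_of_conv_inner:
  assumes "square_integrable \<psi>"
  shows "dist_of f \<psi> = of_real (f \<bullet> abs_L2 (\<lambda>p. cnj (\<psi> p))) + \<i> * of_real (f \<bullet> abs_L2 (\<lambda>p. \<i> * cnj (\<psi> p)))"
proof (rule complex_eqI)
  have "Re (dist_of f \<psi>) = (LINT p|lborel. Re (rep_L2 f p * \<psi> p))"
    unfolding dist_of_def by (rule integral_Re[symmetric, OF dist_of_integrable[OF assms]])
  also have "\<dots> = f \<bullet> abs_L2 (\<lambda>p. cnj (\<psi> p))"
    by (simp add: inner_L2_rep square_integrable_cnj assms inner_complex_def)
  finally show "Re (dist_of f \<psi>) = Re (of_real (f \<bullet> abs_L2 (\<lambda>p. cnj (\<psi> p)))
     + \<i> * of_real (f \<bullet> abs_L2 (\<lambda>p. \<i> * cnj (\<psi> p))))" by simp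
  have "Im (dist_of f \<psi>) = (LINT p|lborel. Im (rep_L2 f p * \<psi> p))"
    unfolding dist_of_def by (rule integral_Im[symmetric, OF dist_of_integrable[OF assms]])
  also have "\<dots> = f \<bullet> abs_L2 (\<lambda>p. \<i> * cnj (\<psi> p))"
    by (simp add: inner_L2_rep square_integrable_cnj square_integrable_scale assms inner_complex_def algebra_simps)
  finally show "Im (dist_of f \<psi>) = Im (of_real (f \<bullet> abs_L2 (\<lambda>p. cnj (\<psi> p)))
     + \<i> * of_real (f \<bullet> abs_L2 (\<lambda>p. \<i> * cnj (\<psi> p))))" by simp
qed

lemma bounded_linear_dist_of:
  assumes "square_integrable \<psi>" shows "bounded_linear (\<lambda>f. dist_of f \<psi>)"
  unfolding dist_of_conv_inner[OF assms]
  by (intro bounded_linear_add bounded_linear_compose[OF bounded_linear_mult_right]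
      bounded_linear_compose[OF bounded_linear_of_real] bounded_linear_inner_left)

lemma dist_of_scaleC: "dist_of (c *\<^sub>C f) \<psi> = c * dist_of f \<psi>" if "square_integrable \<psi>"
proof -
  have [measurable]: "\<psi> \<in> borel_measurable lborel" using that by (simp add: square_integrable_def)
  have "dist_of (c *\<^sub>C f) \<psi> = (LINT p|lborel. c * (rep_L2 f p * \<psi> p))"
    unfolding dist_of_def by (rule integral_cong_AE) (use rep_L2_scaleC[of c f] in auto)
  then show ?thesis by (simp add: dist_of_def)
qed

lemma scaleR_scaleC: "r *\<^sub>R f = of_real r *\<^sub>C f"
  by transfer (auto simp: L2_rel_def square_integrable_scaleR square_integrable_scale scaleR_conv_of_real)

section \<open>Tensor products\<close>

lemma integrable_tensor:
  fixes F G :: "real \<Rightarrow> real"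
  assumes F: "integrable lborel F" and G: "integrable lborel G"
  shows "integrable lborel (\<lambda>p. F (fst p) * G (snd p))"
    and "(LINT p|lborel. F (fst p) * G (snd p)) = (LINT x|lborel. F x) * (LINT v|lborel. G v)"
proof -
  have [measurable]: "F \<in> borel_measurable lborel" "G \<in> borel_measurable lborel"
    using assms by auto
  have "integrable (lborel \<Otimes>\<^sub>M lborel) (\<lambda>p. F (fst p) * G (snd p))"
  proof (rule lborel_pair.Fubini_integrable)
    show "integrable lborel (\<lambda>x. LINT y|lborel. norm (F (fst (x, y)) * G (snd (x, y))))"
      using F by (simp add: abs_mult)
    show "AE x in lborel. integrable lborel (\<lambda>y. F (fst (x, y)) * G (snd (x, y)))"
      using G by simp
  qed measurable
  then show "integrable lborel (\<lambda>p. F (fst p) * G (snd p))"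
    and "(LINT p|lborel. F (fst p) * G (snd p)) = (LINT x|lborel. F x) * (LINT v|lborel. G v)"
    using lborel_pair.integral_fst'[of "\<lambda>p. F (fst p) * G (snd p)"] by (simp_all add: lborel_prod)
qed

lemma square_integrable_tensor:
  assumes F: "rapid F" and G: "rapid G"
  shows "square_integrable (\<lambda>p. complex_of_real (F (fst p) * G (snd p)))"
  unfolding square_integrable_def
proof
  have [measurable]: "F \<in> borel_measurable borel" "G \<in> borel_measurable borel"
    using assms by (auto intro: rapid_measurable)
  show "(\<lambda>p. complex_of_real (F (fst p) * G (snd p))) \<in> borel_measurable lborel"
    unfolding lborel_prod[symmetric] by measurable
  have "integrable lborel (\<lambda>p. (F (fst p) * F (fst p)) * (G (snd p) * G (snd p)))"
    using integrable_tensor(1)[OF rapid_integrable[OF rapid_mult[OF F F]] rapid_integrable[OF rapid_mult[OF G G]]] .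
  then show "integrable lborel (\<lambda>p. (cmod (complex_of_real (F (fst p) * G (snd p))))\<^sup>2)"
    by (simp only: norm_of_real power2_abs) (simp only: power2_eq_square mult_ac)
qed

section \<open>Completeness of the Hermite functions\<close>

text \<open>The recursion for x times a Hermite function upgrades orthogonality to all
  \<open>x ^ k * hfun j (s * x)\<close>, so every moment of
  \<open>hfun 0 (s * x) *\<^sub>R g x\<close> vanishes, and the Gaussian factor has no zeros.
  Integrability is asked against rapid functions because that is what Fubini yields for partial
  integrals.\<close>

lemma hermite_complete:
  fixes g :: "real \<Rightarrow> complex"
  assumes meas: "g \<in> borel_measurable borel" and s: "s > 0"
    and int: "\<And>F. rapid F \<Longrightarrow> integrable lborel (\<lambda>x. F x *\<^sub>R g x)"
    and orth: "\<And>j. (LINT x|lborel. hfun j (s * x) *\<^sub>R g x) = 0"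
  shows "AE x in lborel. g x = 0"
proof -
  note [measurable] = meas
  have rap: "rapid (\<lambda>x. x ^ k * hfun j (s * x))" for k j
    using rapid_poly_mult[OF rapid_scale[OF rapid_hfun s], of "monom 1 k"] by (simp add: poly_monom)
  have mom: "(LINT x|lborel. (x ^ k * hfun j (s * x)) *\<^sub>R g x) = 0" for k j
  proof (induction k arbitrary: j)
    case (Suc k)
    have "(x ^ Suc k * hfun j (s * x)) *\<^sub>R g x = (1 / s) *\<^sub>R ((x ^ k * hfun (Suc j) (s * x)) *\<^sub>R g x)
        + (real j / s) *\<^sub>R ((x ^ k * hfun (j - 1) (s * x)) *\<^sub>R g x)" for x
    proof -
      have "x ^ Suc k * hfun j (s * x) = (x ^ k / s) * ((s * x) * hfun j (s * x))"
        using s by simp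
      also have "\<dots> = 1 / s * (x ^ k * hfun (Suc j) (s * x)) + real j / s * (x ^ k * hfun (j - 1) (s * x))"
        unfolding hfun_mult by (simp add: algebra_simps add_divide_distrib)
      finally show ?thesis by (simp only: scaleR_left_distrib scaleR_scaleR)
    qed
    then have "(LINT x|lborel. (x ^ Suc k * hfun j (s * x)) *\<^sub>R g x)
       = (LINT x|lborel. (1 / s) *\<^sub>R ((x ^ k * hfun (Suc j) (s * x)) *\<^sub>R g x)
          + (real j / s) *\<^sub>R ((x ^ k * hfun (j - 1) (s * x)) *\<^sub>R g x))"
      by (simp only:)
    also have "\<dots> = 0"
      by (subst Bochner_Integration.integral_add) (intro integrable_scaleR_right int rap,
         intro integrable_scaleR_right int rap, simp only: integral_scaleR_right Suc, simp)
    finally show ?case .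
  qed (simp add: orth)
  have "AE x in lborel. hfun 0 (s * x) *\<^sub>R g x = 0"
  proof (rule moments_zero)
    have [measurable]: "hfun 0 \<in> borel_measurable borel" by (rule rapid_measurable[OF rapid_hfun])
    show "(\<lambda>x. hfun 0 (s * x) *\<^sub>R g x) \<in> borel_measurable borel" by measurable
    show "integrable lborel (\<lambda>x. exp (c * \<bar>x\<bar>) *\<^sub>R hfun 0 (s * x) *\<^sub>R g x)" for c
      using int[OF rapid_exp_abs[OF rapid_scale[OF rapid_hfun s]]] by simp
    show "(LINT x|lborel. x ^ k *\<^sub>R hfun 0 (s * x) *\<^sub>R g x) = 0" for k
      using mom[of k 0] by simp
  qed
  then show ?thesis by eventually_elim (simp add: hfun_def)
qed

text \<open>The one-variable result is applied twice: in x to each partial integral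
  \<open>g i\<close>, then in v to \<open>f (x, v)\<close> for almost every fixed x. There are
  countably many i, so one null set of x serves them all.\<close>

lemma hermite_tensor_complete:
  fixes f :: "real \<times> real \<Rightarrow> complex"
  assumes f: "square_integrable f" and s: "s > 0"
    and orth: "\<And>i j. (LINT p|lborel. f p * of_real (hfun j (s * fst p) * hfun i (snd p))) = 0"
  shows "AE p in lborel. f p = 0"
proof -
  have [measurable]: "f \<in> borel_measurable (borel \<Otimes>\<^sub>M borel)"
    using f by (simp add: square_integrable_def borel_prod)
  have [measurable]: "hfun i \<in> borel_measurable borel" for i by (rule rapid_measurable[OF rapid_hfun])
  have int2: "integrable (lborel \<Otimes>\<^sub>M lborel) (\<lambda>p. F (fst p) *\<^sub>R G (snd p) *\<^sub>R f p)" if "rapid F" "rapid G" for F G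
    using integrable_mult[OF f square_integrable_tensor[OF that]]
    by (simp add: lborel_prod scaleR_conv_of_real mult_ac)
  define g where "g i x = (LINT v|lborel. hfun i v *\<^sub>R f (x, v))" for i x
  have g0: "AE x in lborel. g i x = 0" for i
  proof (rule hermite_complete[OF _ s])
    show "g i \<in> borel_measurable borel" unfolding g_def by measurable
    fix F :: "real \<Rightarrow> real" assume "rapid F"
    from lborel_pair.integrable_fst'[OF int2[OF this rapid_hfun[of i]]]
    show "integrable lborel (\<lambda>x. F x *\<^sub>R g i x)" by (simp add: g_def del: scaleR_scaleR)
  next
    fix j
    show "(LINT x|lborel. hfun j (s * x) *\<^sub>R g i x) = 0"
      using lborel_pair.integral_fst'[OF int2[OF rapid_scale[OF rapid_hfun[of j] s] rapid_hfun[of i]]] orth[of j i]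
      by (simp only: g_def fst_conv snd_conv integral_scaleR_right lborel_prod) (simp add: scaleR_conv_of_real mult_ac)
  qed
  have "AE x in lborel. \<forall>i. g i x = 0"
    using g0 by (simp add: AE_all_countable)
  moreover have "AE x in lborel. integrable lborel (\<lambda>v. (cmod (f (x, v)))\<^sup>2)"
    using f by (intro lborel_pair.AE_integrable_fst'[of "\<lambda>p. (cmod (f p))\<^sup>2", simplified])
      (simp add: square_integrable_def lborel_prod)
  ultimately have "AE x in lborel. AE v in lborel. f (x, v) = 0"
  proof eventually_elim
    case (elim x)
    show ?case
    proof (rule hermite_complete[of _ 1])
      show "(\<lambda>v. f (x, v)) \<in> borel_measurable borel" by measurable
      show "(LINT v|lborel. hfun j (1 * v) *\<^sub>R f (x, v)) = 0" for j
        using elim(1) by (simp add: g_def)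
      fix F :: "real \<Rightarrow> real" assume F: "rapid F"
      then have [measurable]: "F \<in> borel_measurable borel" by (rule rapid_measurable)
      show "integrable lborel (\<lambda>v. F v *\<^sub>R f (x, v))"
      proof (rule Bochner_Integration.integrable_bound)
        show "integrable lborel (\<lambda>v. F v * F v + (cmod (f (x, v)))\<^sup>2)"
          by (intro Bochner_Integration.integrable_add rapid_integrable rapid_mult F elim(2))
        have "\<bar>y\<bar> * z \<le> y * y + z\<^sup>2" if "z \<ge> 0" for y z :: real
        proof -
          have "0 \<le> \<bar>y\<bar> * z" "2 * (\<bar>y\<bar> * z) \<le> \<bar>y\<bar>\<^sup>2 + z\<^sup>2"
            using sum_squares_bound[of "\<bar>y\<bar>" z] that by (simp_all add: mult.assoc)
          then show ?thesis by (simp add: power2_eq_square)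
        qed
        then show "AE v in lborel. norm (F v *\<^sub>R f (x, v)) \<le> norm (F v * F v + (cmod (f (x, v)))\<^sup>2)"
          by simp
      qed measurable
    qed simp
  qed
  then have "AE p in lborel \<Otimes>\<^sub>M lborel. f p = 0"
    by (intro lborel_pair.AE_pair_measure) measurable
  then show ?thesis unfolding lborel_prod .
qed

section \<open>Orthogonal series\<close>

lemma norm_sum_orthogonal:
  fixes x :: "nat \<Rightarrow> 'a :: real_inner"
  assumes "\<And>m n. m \<noteq> n \<Longrightarrow> x m \<bullet> x n = 0" "finite I"
  shows "(norm (\<Sum>n\<in>I. x n))\<^sup>2 = (\<Sum>n\<in>I. (norm (x n))\<^sup>2)"
  using assms(2)
proof induction
  case (insert k I)
  have "x k \<bullet> sum x I = 0" unfolding inner_sum_right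
    by (intro sum.neutral ballI assms(1)) (use insert in auto)
  then show ?case using insert
    by (simp add: power2_norm_eq_inner inner_add_left inner_add_right inner_commute)
qed simp

lemma summable_orthogonal:
  fixes x :: "nat \<Rightarrow> 'a :: {real_inner, banach}"
  assumes orth: "\<And>m n. m \<noteq> n \<Longrightarrow> x m \<bullet> x n = 0" and sq: "summable (\<lambda>n. (norm (x n))\<^sup>2)"
  shows "summable x"
  unfolding summable_Cauchy
proof (intro allI impI)
  fix e :: real assume e: "e > 0"
  then obtain N where N: "\<And>m n. m \<ge> N \<Longrightarrow> norm (\<Sum>i=m..<n. (norm (x i))\<^sup>2) < e\<^sup>2"
    using sq unfolding summable_Cauchy by (meson zero_less_power)
  have "norm (sum x {m..<n}) < e" if "m \<ge> N" for m n
  proof -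
    have "(norm (sum x {m..<n}))\<^sup>2 < e\<^sup>2"
      using N[OF that, of n] by (simp add: norm_sum_orthogonal[OF orth])
    then show ?thesis using e by (simp add: power_less_imp_less_base)
  qed
  then show "\<exists>N. \<forall>m\<ge>N. \<forall>n. norm (sum x {m..<n}) < e" by blast
qed

lemma norm_suminf_orthogonal:
  fixes x :: "nat \<Rightarrow> 'a :: {real_inner, banach}"
  assumes orth: "\<And>m n. m \<noteq> n \<Longrightarrow> x m \<bullet> x n = 0" and sq: "summable (\<lambda>n. (norm (x n))\<^sup>2)"
  shows "(norm (suminf x))\<^sup>2 = (\<Sum>n. (norm (x n))\<^sup>2)"
proof (rule LIMSEQ_unique)
  show "(\<lambda>n. \<Sum>i<n. (norm (x i))\<^sup>2) \<longlonglongrightarrow> (norm (suminf x))\<^sup>2"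
    using tendsto_power[OF tendsto_norm[OF summable_LIMSEQ[OF summable_orthogonal[OF orth sq]]], of 2]
    by (simp add: norm_sum_orthogonal[OF orth])
  show "(\<lambda>n. \<Sum>i<n. (norm (x i))\<^sup>2) \<longlonglongrightarrow> (\<Sum>n. (norm (x n))\<^sup>2)"
    by (rule summable_LIMSEQ[OF sq])
qed

section \<open>The Hermite basis of the Hilbert space\<close>

context kfp
begin

text \<open>The first index belongs to v, the second to x. The constant cancels the two Gaussian
  integrals, whose product is 2 pi / s, and leaves the squared norm i! j!.\<close>

definition Hf :: "nat \<Rightarrow> nat \<Rightarrow> real \<times> real \<Rightarrow> real" where
  "Hf i j p = sqrt (s / (2 * pi)) * hfun j (s * fst p) * hfun i (snd p)"

definition HC :: "nat \<Rightarrow> nat \<Rightarrow> real \<times> real \<Rightarrow> complex" where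
  "HC i j p = of_real (Hf i j p)"

lemma HC_tensor: "HC i j = (\<lambda>p. of_real ((sqrt (s / (2 * pi)) * hfun j (s * fst p)) * hfun i (snd p)))"
  by (simp add: HC_def Hf_def fun_eq_iff)

lemma rapid_Hf_fst: "rapid (\<lambda>x. sqrt (s / (2 * pi)) * hfun j (s * x))"
  by (intro rapid_cmult rapid_scale rapid_hfun s_pos)

lemma square_integrable_HC: "square_integrable (HC i j)"
  unfolding HC_tensor by (rule square_integrable_tensor[OF rapid_Hf_fst rapid_hfun])

definition HL :: "nat \<Rightarrow> nat \<Rightarrow> L2" where "HL i j = abs_L2 (HC i j)"

text \<open>\<open>HC\<close> is real valued, so this bilinear pairing is the hermitian coefficient;
  the division by the squared norm is left to \<open>pn\<close>.\<close>

definition cf :: "L2 \<Rightarrow> nat \<Rightarrow> nat \<Rightarrow> complex" where "cf f i j = dist_of f (HC i j)"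

lemma bounded_linear_cf: "bounded_linear (\<lambda>f. cf f i j)"
  unfolding cf_def by (rule bounded_linear_dist_of[OF square_integrable_HC])

lemma cf_scaleC: "cf (c *\<^sub>C f) i j = c * cf f i j"
  unfolding cf_def by (rule dist_of_scaleC[OF square_integrable_HC])

lemma cf_HL: "cf (HL i j) k l = (if i = k \<and> j = l then fact i * fact j else 0)"
proof -
  have sc: "(LINT x|lborel. hfun j (s * x) * hfun l (s * x)) = (if j = l then fact j * sqrt (2 * pi) else 0) / s"
    using lborel_integral_real_affine[of s "\<lambda>x. hfun j x * hfun l x" 0] s_pos
    by (simp add: hfun_orthogonal field_simps split: if_splits)
  have "cf (HL i j) k l = (LINT p|lborel. HC i j p * HC k l p)"
    unfolding cf_def HL_def by (intro dist_of_abs square_integrable_HC)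
  also have "\<dots> = of_real (LINT p|lborel. Hf i j p * Hf k l p)"
    unfolding HC_def of_real_mult[symmetric] by (rule integral_complex_of_real)
  also have "(LINT p|lborel. Hf i j p * Hf k l p)
      = (LINT p|lborel. (s / (2 * pi) * (hfun j (s * fst p) * hfun l (s * fst p))) * (hfun i (snd p) * hfun k (snd p)))"
    using s_pos by (intro Bochner_Integration.integral_cong refl) (simp add: Hf_def algebra_simps)
  also have "\<dots> = (LINT x|lborel. s / (2 * pi) * (hfun j (s * x) * hfun l (s * x))) * (LINT v|lborel. hfun i v * hfun k v)"
    by (rule integrable_tensor(2)[OF rapid_integrable[OF rapid_cmult[OF
            rapid_mult[OF rapid_scale[OF rapid_hfun s_pos] rapid_scale[OF rapid_hfun s_pos]]]]
          rapid_integrable[OF rapid_mult[OF rapid_hfun rapid_hfun]]])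
  also have "\<dots> = (if i = k \<and> j = l then fact i * fact j else 0)"
  proof -
    have "sqrt (2 * pi) * sqrt (2 * pi) = 2 * pi" by simp
    then have "fact j * sqrt (2 * pi) * (fact i * sqrt (2 * pi)) / (2 * pi) = fact i * fact j"
      by (simp add: divide_simps mult_ac del: real_sqrt_mult_self)
    then show ?thesis using s_pos by (auto simp: sc hfun_orthogonal)
  qed
  finally show ?thesis by simp
qed

lemma inner_scaleC_HL: "f \<bullet> (c *\<^sub>C HL i j) = cf f i j \<bullet> c"
proof -
  have "c *\<^sub>C HL i j = abs_L2 (\<lambda>p. c * HC i j p)"
    unfolding HL_def using scaleC.abs_eq[of "HC i j" c] square_integrable_HC by (simp add: eq_onp_def L2_rel_def)
  then have "f \<bullet> (c *\<^sub>C HL i j) = (LINT p|lborel. rep_L2 f p \<bullet> (c * HC i j p))"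
    by (simp add: inner_L2_rep square_integrable_scale square_integrable_HC)
  also have "\<dots> = (LINT p|lborel. (rep_L2 f p * HC i j p) \<bullet> c)"
    by (intro Bochner_Integration.integral_cong refl) (simp add: HC_def inner_complex_def algebra_simps)
  also have "\<dots> = cf f i j \<bullet> c"
    unfolding cf_def dist_of_def
    by (rule integral_bounded_linear[OF bounded_linear_inner_left dist_of_integrable[OF square_integrable_HC]])
  finally show ?thesis .
qed

lemma cf_zero_imp_zero: assumes "\<And>i j. cf f i j = 0" shows "f = 0"
proof -
  have nz: "sqrt (s / (2 * pi)) \<noteq> 0" using s_pos by simp
  have "(LINT p|lborel. rep_L2 f p * of_real (hfun j (s * fst p) * hfun i (snd p))) = 0" for i j
  proof -
    have "0 = (LINT p|lborel. of_real (sqrt (s / (2 * pi))) * (rep_L2 f p * of_real (hfun j (s * fst p) * hfun i (snd p))))"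
      using assms[of i j] unfolding cf_def dist_of_def HC_tensor by (simp add: mult_ac)
    also have "\<dots> = of_real (sqrt (s / (2 * pi))) * (LINT p|lborel. rep_L2 f p * of_real (hfun j (s * fst p) * hfun i (snd p)))"
      by (rule integral_mult_right_zero)
    finally show ?thesis using nz by (simp only: eq_commute[of "0::complex"] mult_eq_0_iff of_real_eq_0_iff simp_thms)
  qed
  then have "AE p in lborel. rep_L2 f p = 0"
    using hermite_tensor_complete[OF square_integrable_rep s_pos] by blast
  then have "abs_L2 (rep_L2 f) = abs_L2 (\<lambda>_. 0)"
    by (intro abs_L2_eqI square_integrable_rep square_integrable_0)
  then show ?thesis by (simp add: abs_L2_rep zero_L2_def)
qed

lemma cf_eq_imp_eq: "(\<And>i j. cf f i j = cf g i j) \<Longrightarrow> f = g"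
  using cf_zero_imp_zero[of "f - g"] by (simp add: linear_simps[OF bounded_linear_cf])

text \<open>The monomial \<open>X\<^sup>i\<close> stands for the Hermite function of degree \<open>i\<close> in \<open>v\<close> and \<open>n - i\<close> in \<open>x\<close>,
  whose squared norm is \<open>i! (n - i)!\<close>.\<close>

definition Jn :: "nat \<Rightarrow> complex poly \<Rightarrow> L2" where
  "Jn n p = (\<Sum>i\<le>n. coeff p i *\<^sub>C HL i (n - i))"

definition pn :: "nat \<Rightarrow> L2 \<Rightarrow> complex poly" where
  "pn n f = (\<Sum>i\<le>n. monom (cf f i (n - i) / (fact i * fact (n - i))) i)"

lemma coeff_pn: "coeff (pn n f) i = (if i \<le> n then cf f i (n - i) / (fact i * fact (n - i)) else 0)"
  by (simp add: pn_def coeff_sum)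

lemma degree_pn: "degree (pn n f) \<le> n"
  unfolding pn_def by (rule degree_sum_le) (auto intro: order.trans[OF degree_monom_le])

lemma pn_add: "pn n (f + g) = pn n f + pn n g"
  by (rule poly_eqI) (simp add: coeff_pn linear_simps[OF bounded_linear_cf] add_divide_distrib)

lemma pn_scaleC: "pn n (c *\<^sub>C f) = smult c (pn n f)"
  by (rule poly_eqI) (simp add: coeff_pn cf_scaleC)

lemma pn_eq_imp_eq: assumes "\<And>n. pn n f = pn n g" shows "f = g"
proof (rule cf_eq_imp_eq)
  fix i j
  have "coeff (pn (i + j) f) i = coeff (pn (i + j) g) i" using assms by simp
  then show "cf f i j = cf g i j" by (simp add: coeff_pn)
qed

lemma Jn_add: "Jn n (p + q) = Jn n p + Jn n q"
  by (simp add: Jn_def L2.scale_left_distrib sum.distrib)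

lemma Jn_smult: "Jn n (smult c p) = c *\<^sub>C Jn n p"
  by (simp add: Jn_def L2.scale_sum_right)

lemma Jn_sum: "Jn n (\<Sum>i\<in>I. f i) = (\<Sum>i\<in>I. Jn n (f i))"
  by (induction I rule: infinite_finite_induct) (auto simp: Jn_add, auto simp: Jn_def)

lemma cf_Jn: "cf (Jn n p) i j = (if i + j = n then fact i * fact j * coeff p i else 0)"
proof -
  have "cf (Jn n p) i j = (\<Sum>k\<le>n. coeff p k * (if k = i \<and> n - k = j then fact k * fact (n - k) else 0))"
    by (simp add: Jn_def linear_sum[OF bounded_linear.linear[OF bounded_linear_cf]] cf_scaleC cf_HL o_def)
  also have "\<dots> = (\<Sum>k\<le>n. if k = i then (if i + j = n then fact i * fact j * coeff p i else 0) else 0)"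
    by (intro sum.cong refl) auto
  finally show ?thesis by auto
qed

lemma pn_Jn: "pn n (Jn m p) = (if n = m then (\<Sum>i\<le>n. monom (coeff p i) i) else 0)"
  by (rule poly_eqI) (auto simp: coeff_pn cf_Jn coeff_sum)

lemma pn_Jn_same: "degree p \<le> n \<Longrightarrow> pn n (Jn n p) = p"
  by (simp add: pn_Jn poly_as_sum_of_monoms')

lemma inner_Jn_right: "f \<bullet> Jn n p = (\<Sum>i\<le>n. cf f i (n - i) \<bullet> coeff p i)"
  by (simp add: Jn_def inner_sum_right inner_scaleC_HL)

lemma inner_Jn_same: "Jn n p \<bullet> Jn n q = (\<Sum>i\<le>n. fact i * fact (n - i) * (coeff p i \<bullet> coeff q i))"
  unfolding inner_Jn_right
proof (intro sum.cong refl)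
  fix i assume "i \<in> {..n}"
  then have "cf (Jn n p) i (n - i) = (fact i * fact (n - i)) *\<^sub>R coeff p i"
    by (simp add: cf_Jn scaleR_conv_of_real)
  then show "cf (Jn n p) i (n - i) \<bullet> coeff q i = fact i * fact (n - i) * (coeff p i \<bullet> coeff q i)"
    by simp
qed

lemma inner_Jn_diff: "m \<noteq> n \<Longrightarrow> Jn m p \<bullet> Jn n q = 0"
  unfolding inner_Jn_right by (intro sum.neutral) (auto simp: cf_Jn)

lemma norm_Jn: "norm (Jn n p) = sqrt (hsq n p)"
  by (simp add: norm_eq_sqrt_inner inner_Jn_same hsq_def power2_norm_eq_inner)

lemma inner_Jn_pn: "Jn n (pn n f) \<bullet> Jn n p = f \<bullet> Jn n p"
  unfolding inner_Jn_right by (intro sum.cong refl) (simp add: cf_Jn coeff_pn)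

section \<open>Bessel, expansion over the levels, Parseval\<close>

lemma bessel: "summable (\<lambda>n. (norm (Jn n (pn n f)))\<^sup>2)" "(\<Sum>n. (norm (Jn n (pn n f)))\<^sup>2) \<le> (norm f)\<^sup>2"
proof -
  have le: "(\<Sum>n<N. (norm (Jn n (pn n f)))\<^sup>2) \<le> (norm f)\<^sup>2" for N
  proof -
    define S where "S = (\<Sum>n<N. Jn n (pn n f))"
    have S: "(norm S)\<^sup>2 = (\<Sum>n<N. (norm (Jn n (pn n f)))\<^sup>2)"
      unfolding S_def by (rule norm_sum_orthogonal) (auto simp: inner_Jn_diff)
    also have "\<dots> = f \<bullet> S"
      by (simp add: S_def inner_sum_right power2_norm_eq_inner inner_Jn_pn)
    also have "\<dots> \<le> norm f * norm S" by (rule norm_cauchy_schwarz)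
    finally have "norm S \<le> norm f"
      by (cases "norm S = 0") (auto simp: power2_eq_square)
    then show ?thesis unfolding S[symmetric] by (intro power_mono) auto
  qed
  show "summable (\<lambda>n. (norm (Jn n (pn n f)))\<^sup>2)"
    by (rule bounded_imp_summable[OF _ le[of "Suc n" for n, unfolded lessThan_Suc_atMost]]) simp
  then show "(\<Sum>n. (norm (Jn n (pn n f)))\<^sup>2) \<le> (norm f)\<^sup>2"
    by (rule suminf_le_const[OF _ le])
qed

lemma cf_suminf_Jn:
  assumes "summable (\<lambda>n. (norm (Jn n (p n)))\<^sup>2)" shows "cf (\<Sum>n. Jn n (p n)) i j = fact i * fact j * coeff (p (i + j)) i"
proof -
  have "summable (\<lambda>n. Jn n (p n))" by (rule summable_orthogonal[OF _ assms]) (simp add: inner_Jn_diff)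
  from bounded_linear.suminf[OF bounded_linear_cf this]
  have "cf (\<Sum>n. Jn n (p n)) i j = (\<Sum>n. cf (Jn n (p n)) i j)" by simp
  also have "\<dots> = (\<Sum>n\<in>{i + j}. cf (Jn n (p n)) i j)"
    by (rule suminf_finite) (auto simp: cf_Jn)
  finally show ?thesis by (simp add: cf_Jn)
qed

lemma pn_suminf_Jn:
  assumes "summable (\<lambda>n. (norm (Jn n (p n)))\<^sup>2)" "degree (p n) \<le> n" shows "pn n (\<Sum>n. Jn n (p n)) = p n"
  using assms(2) by (intro poly_eqI) (auto simp: coeff_pn cf_suminf_Jn[OF assms(1)] coeff_eq_0)

text \<open>Bessel makes the orthogonal series converge; its sum has the same Hermite coefficients
  as f, and completeness says that these determine f.\<close>

lemma expansion_sums: "(\<lambda>n. Jn n (pn n f)) sums f"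
proof -
  have sm: "summable (\<lambda>n. Jn n (pn n f))"
    by (rule summable_orthogonal[OF _ bessel(1)]) (simp add: inner_Jn_diff)
  have "(\<Sum>n. Jn n (pn n f)) = f"
    by (rule pn_eq_imp_eq) (rule pn_suminf_Jn[of "\<lambda>n. pn n f", OF bessel(1) degree_pn])
  then show ?thesis using sm by (simp add: sums_iff)
qed

lemma parseval: "(norm f)\<^sup>2 = (\<Sum>n. (norm (Jn n (pn n f)))\<^sup>2)"
  using norm_suminf_orthogonal[OF _ bessel(1), of f] expansion_sums[of f]
  by (simp add: inner_Jn_diff sums_iff)

end

section \<open>Smooth cut-off functions\<close>

primrec Ck1 :: "nat \<Rightarrow> (real \<Rightarrow> real) \<Rightarrow> bool" where
  "Ck1 0 f \<longleftrightarrow> continuous_on UNIV f"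
| "Ck1 (Suc n) f \<longleftrightarrow> (\<exists>f'. (\<forall>x. (f has_real_derivative f' x) (at x)) \<and> Ck1 n f')"

definition smooth1 :: "(real \<Rightarrow> real) \<Rightarrow> bool" where "smooth1 f \<longleftrightarrow> (\<forall>n. Ck1 n f)"

lemma continuous_on_deriv: "(\<And>x. (f has_real_derivative f' x) (at x)) \<Longrightarrow> continuous_on UNIV f"
  by (meson DERIV_isCont continuous_at_imp_continuous_on)

lemma Ck1_mono: "Ck1 (Suc n) f \<Longrightarrow> Ck1 n f"
proof (induction n arbitrary: f)
  case 0
  then show ?case using continuous_on_deriv by auto
next
  case (Suc n)
  then show ?case using Ck1.simps(2) by blast
qed

lemma Ck1_add: "Ck1 n f \<Longrightarrow> Ck1 n g \<Longrightarrow> Ck1 n (\<lambda>x. f x + g x)"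
proof (induction n arbitrary: f g)
  case (Suc n)
  then obtain f' g' where "\<And>x. (f has_real_derivative f' x) (at x)" "Ck1 n f'"
    "\<And>x. (g has_real_derivative g' x) (at x)" "Ck1 n g'" by auto
  with Suc.IH[of f' g'] show ?case
    by (auto intro!: exI[of _ "\<lambda>x. f' x + g' x"] derivative_intros)
qed (auto intro: continuous_intros)

lemma Ck1_mult: "Ck1 n f \<Longrightarrow> Ck1 n g \<Longrightarrow> Ck1 n (\<lambda>x. f x * g x)"
proof (induction n arbitrary: f g)
  case (Suc n)
  then obtain f' g' where *: "\<And>x. (f has_real_derivative f' x) (at x)" "Ck1 n f'"
    "\<And>x. (g has_real_derivative g' x) (at x)" "Ck1 n g'" by auto
  have "Ck1 n (\<lambda>x. f' x * g x + f x * g' x)"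
    using * Suc.IH Suc.prems[THEN Ck1_mono] by (intro Ck1_add) auto
  with * show ?case
    by (auto intro!: exI[of _ "\<lambda>x. f' x * g x + f x * g' x"] derivative_eq_intros)
qed (auto intro: continuous_intros)

lemma Ck1_affine: "Ck1 n f \<Longrightarrow> Ck1 n (\<lambda>x. f (c * x + d))"
proof (induction n arbitrary: f)
  case 0
  then show ?case by (auto intro!: continuous_intros continuous_on_compose2[of UNIV f])
next
  case (Suc n)
  then obtain f' where f': "\<And>x. (f has_real_derivative f' x) (at x)" "Ck1 n f'" by auto
  have const: "Ck1 n (\<lambda>_. c)" for n c
    by (induction n arbitrary: c) (auto intro!: exI[of _ "\<lambda>_. 0"])
  have "((\<lambda>x. f (c * x + d)) has_real_derivative c * f' (c * x + d)) (at x)" for x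
  proof -
    have "((\<lambda>x. c * x + d) has_real_derivative c) (at x)" by (auto intro!: derivative_eq_intros)
    from DERIV_chain2[OF f'(1) this] show ?thesis by (simp add: mult.commute)
  qed
  moreover have "Ck1 n (\<lambda>x. c * f' (c * x + d))"
    by (intro Ck1_mult const Suc.IH f')
  ultimately show ?case unfolding Ck1.simps by (intro exI[of _ "\<lambda>x. c * f' (c * x + d)"]) blast
qed

lemma smooth1_mult: "smooth1 f \<Longrightarrow> smooth1 g \<Longrightarrow> smooth1 (\<lambda>x. f x * g x)"
  by (simp add: smooth1_def Ck1_mult)

lemma smooth1_affine: "smooth1 f \<Longrightarrow> smooth1 (\<lambda>x. f (c * x + d))"
  by (simp add: smooth1_def Ck1_affine)

lemma smooth1_deriv:
  assumes "smooth1 f" shows "(f has_real_derivative deriv f x) (at x)" "smooth1 (deriv f)"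
proof -
  have "\<exists>f'. (\<forall>x. (f has_real_derivative f' x) (at x)) \<and> Ck1 n f'" for n
    using assms unfolding smooth1_def by (metis Ck1.simps(2))
  then have *: "(\<forall>x. (f has_real_derivative deriv f x) (at x)) \<and> Ck1 n (deriv f)" for n
    by (metis DERIV_imp_deriv ext)
  then show "(f has_real_derivative deriv f x) (at x)" "smooth1 (deriv f)"
    by (auto simp: smooth1_def)
qed

text \<open>Smoothness by invariance: a family containing a derivative of each of its members
  consists of smooth functions, without a formula for higher derivatives. \<open>C_k_closed\<close>
  is the same argument in two variables.\<close>

lemma smooth1_closed:
  assumes "\<And>f. f \<in> S \<Longrightarrow> \<exists>f'\<in>S. \<forall>x. (f has_real_derivative f' x) (at x)" and "f \<in> S"
  shows "smooth1 f"
proof -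
  have "Ck1 n f" for n using assms(2)
  proof (induction n arbitrary: f)
    case 0
    then show ?case using assms(1) continuous_on_deriv by (metis Ck1.simps(1))
  next
    case (Suc n)
    then show ?case using assms(1) Ck1.simps(2) by blast
  qed
  then show ?thesis by (simp add: smooth1_def)
qed

text \<open>The polynomial parameter makes the family closed under differentiation: with y = 1 / x,
  the derivative replaces p by y^2 (p - p').\<close>

definition flat :: "real poly \<Rightarrow> real \<Rightarrow> real" where
  "flat p x = (if x > 0 then poly p (1 / x) * exp (- (1 / x)) else 0)"

lemma poly_exp_tendsto_0: "((\<lambda>y::real. poly p y * exp (- y)) \<longlongrightarrow> 0) at_top"
proof -
  have "((\<lambda>y. \<Sum>i\<le>degree p. coeff p i * (y ^ i / exp y)) \<longlongrightarrow> (\<Sum>i\<le>degree p. coeff p i * 0)) at_top"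
    by (intro tendsto_sum tendsto_mult_left tendsto_power_div_exp_0)
  then show ?thesis by (simp add: poly_altdef sum_distrib_right exp_minus field_simps sum_divide_distrib)
qed

lemma flat_deriv:
  "(flat p has_real_derivative flat ([:0, 0, 1:] * (p - pderiv p)) x) (at x)"
proof -
  consider "x > 0" | "x < 0" | "x = 0" by linarith
  then show ?thesis
  proof cases
    case 1
    have "((\<lambda>y. poly p (1 / y)) has_real_derivative poly (pderiv p) (1 / x) * (- 1 / x\<^sup>2)) (at x)"
      using 1 by (intro DERIV_chain2[OF poly_DERIV]) (auto intro!: derivative_eq_intros simp: power2_eq_square)
    moreover have "((\<lambda>y. exp (- (1 / y))) has_real_derivative exp (- (1 / x)) * (1 / x\<^sup>2)) (at x)"
      using 1 by (auto intro!: derivative_eq_intros simp: power2_eq_square)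
    ultimately have "((\<lambda>y. poly p (1 / y) * exp (- (1 / y))) has_real_derivative
        poly (pderiv p) (1 / x) * (- 1 / x\<^sup>2) * exp (- (1 / x)) + exp (- (1 / x)) * (1 / x\<^sup>2) * poly p (1 / x)) (at x)"
      by (rule DERIV_mult)
    moreover have "poly (pderiv p) (1 / x) * (- 1 / x\<^sup>2) * exp (- (1 / x)) + exp (- (1 / x)) * (1 / x\<^sup>2) * poly p (1 / x)
        = flat ([:0, 0, 1:] * (p - pderiv p)) x"
      using 1 by (simp add: flat_def power2_eq_square field_simps)
    ultimately show ?thesis
      using 1 by (auto simp: flat_def intro: has_field_derivative_transform_within_open[of _ _ _ "{0<..}"])
  next
    case 2
    have "((\<lambda>_. 0) has_real_derivative 0) (at x)" by simp
    with 2 show ?thesis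
      by (auto simp: flat_def intro: has_field_derivative_transform_within_open[of "\<lambda>_. 0" _ _ "{..<0}"])
  next
    case 3
    \<comment> \<open>From the right the difference quotient is y p(y) exp (- y) with y = 1 / h,
      which tends to 0; from the left it is identically 0.\<close>
    have "((\<lambda>h. (flat p (0 + h) - flat p 0) / h) \<longlongrightarrow> 0) (at 0)"
    proof (rule filterlim_split_at)
      have "((\<lambda>h. poly ([:0, 1:] * p) (inverse h) * exp (- inverse h)) \<longlongrightarrow> 0) (at_right (0::real))"
        by (rule filterlim_compose[OF poly_exp_tendsto_0 filterlim_inverse_at_top_right])
      moreover have "\<forall>\<^sub>F h in at_right (0::real). poly ([:0, 1:] * p) (inverse h) * exp (- inverse h)
          = (flat p (0 + h) - flat p 0) / h"
        by (auto simp: eventually_at_filter flat_def field_simps)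
      ultimately show "((\<lambda>h. (flat p (0 + h) - flat p 0) / h) \<longlongrightarrow> 0) (at_right 0)"
        by (rule Lim_transform_eventually)
      have "\<forall>\<^sub>F h in at_left (0::real). 0 = (flat p (0 + h) - flat p 0) / h"
        by (auto simp: eventually_at_filter flat_def)
      then show "((\<lambda>h. (flat p (0 + h) - flat p 0) / h) \<longlongrightarrow> 0) (at_left 0)"
        by (rule Lim_transform_eventually[OF tendsto_const])
    qed
    then have "(flat p has_real_derivative 0) (at 0)" unfolding DERIV_def .
    then show ?thesis using 3 by (simp add: flat_def)
  qed
qed

lemma smooth1_flat: "smooth1 (flat p)"
  by (rule smooth1_closed[of "range flat"]) (use flat_deriv in auto)

text \<open>A bump supported in [-1, 1]; each factor equals exp (-1) at 0, so exp 2 normalises the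
  value there to 1. It is not constant near 0: the dilated cut-offs converge to 1 by continuity at
  0.\<close>

definition cutoff :: "real \<Rightarrow> real" where
  "cutoff x = exp 2 * (flat 1 (1 * x + 1) * flat 1 ((- 1) * x + 1))"

lemma smooth1_const: "smooth1 (\<lambda>_. c)"
  by (rule smooth1_closed[of "range (\<lambda>c _. c)"]) (auto intro!: exI[of _ 0])

lemma smooth1_cutoff: "smooth1 cutoff"
  unfolding cutoff_def by (intro smooth1_mult smooth1_const smooth1_affine smooth1_flat)

lemma cutoff_0: "cutoff 0 = 1"
  by (simp add: cutoff_def flat_def exp_add[symmetric])

lemma cutoff_outside: "\<bar>x\<bar> \<ge> 1 \<Longrightarrow> cutoff x = 0"
  by (auto simp: cutoff_def flat_def abs_if split: if_splits)

lemma deriv_zero_outside: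
  fixes f :: "real \<Rightarrow> real"
  assumes "\<And>x. \<bar>x\<bar> \<ge> R \<Longrightarrow> f x = 0" "\<And>x. (f has_real_derivative f' x) (at x)" "\<bar>x\<bar> > R"
  shows "f' x = 0"
proof -
  have "open {x. \<bar>x\<bar> > R}" by (intro open_Collect_less continuous_intros)
  moreover have "((\<lambda>_. 0) has_real_derivative 0) (at x)" by simp
  ultimately have "(f has_real_derivative 0) (at x)"
    by (intro has_field_derivative_transform_within_open[of "\<lambda>_. 0" 0 x "{x. \<bar>x\<bar> > R}" f])
      (use assms in auto)
  then show ?thesis using assms(2) DERIV_unique by blast
qed

lemma bounded_if_zero_outside:
  fixes f :: "real \<Rightarrow> real"
  assumes "continuous_on UNIV f" "\<And>x. \<bar>x\<bar> > R \<Longrightarrow> f x = 0" obtains c where "c \<ge> 0" "\<And>x. \<bar>f x\<bar> \<le> c"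
proof -
  have "compact (f ` {-R..R})"
    by (intro compact_continuous_image continuous_on_subset[OF assms(1)]) auto
  then have "bounded (f ` {-R..R})" by (rule compact_imp_bounded)
  then obtain c where c: "\<forall>y\<in>f ` {-R..R}. norm y \<le> c" unfolding bounded_iff by blast
  have "\<bar>f x\<bar> \<le> max c 0" for x
  proof (cases "\<bar>x\<bar> > R")
    case False
    then have "x \<in> {-R..R}" by auto
    then have "norm (f x) \<le> c" using c by blast
    then show ?thesis by simp
  qed (simp add: assms(2))
  then show ?thesis using that[of "max c 0"] by simp
qed

section \<open>Test functions\<close>

lemma C_k_closed:
  assumes "\<And>\<phi>. \<phi> \<in> S \<Longrightarrow> (\<forall>p. \<phi> differentiable (at p)) \<and> partial_x \<phi> \<in> S \<and> partial_v \<phi> \<in> S" and "\<phi> \<in> S"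
  shows "C_k n \<phi>"
  using assms(2)
proof (induction n arbitrary: \<phi>)
  case 0
  then show ?case
    using assms(1)[of \<phi>] by (auto intro!: continuous_at_imp_continuous_on differentiable_imp_continuous_within)
qed (use assms(1) in auto)

definition tens :: "(real \<Rightarrow> real) \<Rightarrow> (real \<Rightarrow> real) \<Rightarrow> real \<times> real \<Rightarrow> complex" where
  "tens F G p = of_real (F (fst p) * G (snd p))"

lemma tens_has_derivative:
  assumes "\<And>x. (F has_real_derivative F' x) (at x)" "\<And>x. (G has_real_derivative G' x) (at x)"
  shows "(tens F G has_derivative (\<lambda>h. fst h *\<^sub>R tens F' G p + snd h *\<^sub>R tens F G' p)) (at p)"
proof -
  have "((\<lambda>p. F (fst p) * G (snd p)) has_derivative
      (\<lambda>h. F (fst p) * (snd h * G' (snd p)) + fst h * F' (fst p) * G (snd p))) (at p)"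
    using has_derivative_mult[OF
        DERIV_compose_FDERIV[OF assms(1) has_derivative_fst[OF has_derivative_ident]]
        DERIV_compose_FDERIV[OF assms(2) has_derivative_snd[OF has_derivative_ident]]] .
  from bounded_linear.has_derivative[OF bounded_linear_of_real this]
  show ?thesis unfolding tens_def[abs_def]
    by (rule has_derivative_eq_rhs) (simp add: fun_eq_iff scaleR_conv_of_real algebra_simps)
qed

lemma partial_tens:
  assumes "\<And>x. (F has_real_derivative F' x) (at x)" "\<And>x. (G has_real_derivative G' x) (at x)"
  shows "partial_x (tens F G) = tens F' G" "partial_v (tens F G) = tens F G'"
  using frechet_derivative_at[OF tens_has_derivative[OF assms], symmetric]
  by (simp_all add: fun_eq_iff partial_x_def partial_v_def)

lemma tens_test_function:
  assumes F: "smooth1 F" and G: "smooth1 G" and R: "\<And>x. \<bar>x\<bar> \<ge> R \<Longrightarrow> F x = 0" "\<And>x. \<bar>x\<bar> \<ge> R \<Longrightarrow> G x = 0"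
  shows "tens F G \<in> test_functions"
proof -
  have "C_k n (tens F G)" for n
  proof (rule C_k_closed)
    show "tens F G \<in> {tens F G |F G. smooth1 F \<and> smooth1 G}" using F G by auto
    fix \<phi> assume "\<phi> \<in> {tens F G |F G. smooth1 F \<and> smooth1 G}"
    then obtain F G where \<phi>: "\<phi> = tens F G" and F: "smooth1 F" and G: "smooth1 G" by auto
    note d = smooth1_deriv(1)[OF F] smooth1_deriv(1)[OF G]
    show "(\<forall>p. \<phi> differentiable (at p)) \<and> partial_x \<phi> \<in> {tens F G |F G. smooth1 F \<and> smooth1 G}
       \<and> partial_v \<phi> \<in> {tens F G |F G. smooth1 F \<and> smooth1 G}"
      unfolding \<phi> partial_tens[OF d]
      using tens_has_derivative[OF d] smooth1_deriv(2)[OF F] smooth1_deriv(2)[OF G] F G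
      unfolding differentiable_def by blast
  qed
  moreover have "{p. tens F G p \<noteq> 0} \<subseteq> cbox (- R, - R) (R, R)"
    using R by (force simp: tens_def cbox_Pair_eq)
  then have "compact (closure {p. tens F G p \<noteq> 0})"
    by (meson bounded_cbox bounded_subset compact_closure)
  ultimately show ?thesis by (simp add: test_functions_def)
qed

lemma test_C_k: "\<phi> \<in> test_functions \<Longrightarrow> C_k n \<phi>"
  by (simp add: test_functions_def)

lemma test_differentiable: "\<phi> \<in> test_functions \<Longrightarrow> \<phi> differentiable (at p)"
  using test_C_k[of \<phi> "Suc 0"] unfolding C_k.simps by blast

lemma test_continuous: "\<phi> \<in> test_functions \<Longrightarrow> continuous_on UNIV \<phi>"
  using test_C_k[of \<phi> 0] by simp

lemma test_partial:
  assumes "\<phi> \<in> test_functions" shows "partial_x \<phi> \<in> test_functions" "partial_v \<phi> \<in> test_functions"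
proof -
  let ?S = "closure {p. \<phi> p \<noteq> 0}"
  have z: "frechet_derivative \<phi> (at p) h = 0" if "p \<notin> ?S" for p h
  proof -
    have "((\<lambda>_. 0) has_derivative (\<lambda>_. 0)) (at p)" by simp
    then have "(\<phi> has_derivative (\<lambda>_. 0)) (at p)"
      by (rule has_derivative_transform_within_open[of _ _ _ _ "- ?S"])
        (use that closure_subset[of "{p. \<phi> p \<noteq> 0}"] in auto)
    from frechet_derivative_at[OF this, symmetric] show ?thesis by simp
  qed
  have *: "compact (closure {p. \<psi> p \<noteq> 0})" if "\<And>p. p \<notin> ?S \<Longrightarrow> \<psi> p = 0" for \<psi> :: "real \<times> real \<Rightarrow> complex"
  proof -
    have "{p. \<psi> p \<noteq> 0} \<subseteq> ?S" using that by auto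
    moreover have "bounded ?S" using assms by (auto simp: test_functions_def intro: compact_imp_bounded)
    ultimately show ?thesis unfolding compact_closure by (rule bounded_subset[rotated])
  qed
  show "partial_x \<phi> \<in> test_functions" "partial_v \<phi> \<in> test_functions"
    using test_C_k[OF assms, of "Suc n" for n] *[of "partial_x \<phi>"] *[of "partial_v \<phi>"] z
    by (auto simp: test_functions_def partial_x_def partial_v_def)
qed

text \<open>Unlike \<open>test_functions\<close>, this class is stable under multiplication by
  merely continuous functions, and it still guarantees integrability and square
  integrability.\<close>

definition compact_supp :: "(real \<times> real \<Rightarrow> complex) \<Rightarrow> bool" where
  "compact_supp \<psi> \<longleftrightarrow>
     continuous_on UNIV \<psi> \<and> (\<exists>R. \<forall>x v. \<bar>x\<bar> \<ge> R \<or> \<bar>v\<bar> \<ge> R \<longrightarrow> \<psi> (x, v) = 0)"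

lemma compact_supp_test:
  assumes "\<phi> \<in> test_functions" shows "compact_supp \<phi>"
proof -
  have "bounded {p. \<phi> p \<noteq> 0}"
    using assms by (auto simp: test_functions_def simp flip: compact_closure)
  then obtain B where B: "\<And>p. \<phi> p \<noteq> 0 \<Longrightarrow> norm p \<le> B" unfolding bounded_iff by blast
  have "\<phi> (x, v) = 0" if "\<bar>x\<bar> \<ge> B + 1 \<or> \<bar>v\<bar> \<ge> B + 1" for x v
  proof (rule ccontr)
    assume "\<phi> (x, v) \<noteq> 0"
    from B[OF this] that norm_fst_le[of x v] norm_snd_le[of v x] show False by auto
  qed
  then show ?thesis using test_continuous[OF assms] unfolding compact_supp_def by blast
qed

lemma compact_supp_mult: "continuous_on UNIV m \<Longrightarrow> compact_supp \<psi> \<Longrightarrow> compact_supp (\<lambda>p. m p * \<psi> p)"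
  unfolding compact_supp_def using continuous_on_mult[of UNIV m \<psi>] mult_zero_right by metis

lemma compact_supp_add:
  assumes "compact_supp \<phi>" "compact_supp \<psi>" shows "compact_supp (\<lambda>p. \<phi> p + \<psi> p)"
proof -
  obtain R S where "\<forall>x v. \<bar>x\<bar> \<ge> R \<or> \<bar>v\<bar> \<ge> R \<longrightarrow> \<phi> (x, v) = 0" "\<forall>x v. \<bar>x\<bar> \<ge> S \<or> \<bar>v\<bar> \<ge> S \<longrightarrow> \<psi> (x, v) = 0"
    using assms unfolding compact_supp_def by blast
  then have "\<forall>x v. \<bar>x\<bar> \<ge> max R S \<or> \<bar>v\<bar> \<ge> max R S \<longrightarrow> \<phi> (x, v) + \<psi> (x, v) = 0" by auto
  moreover have "continuous_on UNIV (\<lambda>p. \<phi> p + \<psi> p)"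
    using assms by (auto simp: compact_supp_def intro: continuous_intros)
  ultimately show ?thesis unfolding compact_supp_def by blast
qed

lemma compact_supp_integrable:
  assumes "compact_supp \<psi>" shows "integrable lborel \<psi>" "square_integrable \<psi>"
proof -
  obtain R where R: "\<And>x v. \<bar>x\<bar> \<ge> R \<or> \<bar>v\<bar> \<ge> R \<Longrightarrow> \<psi> (x, v) = 0"
    using assms unfolding compact_supp_def by blast
  have cont: "continuous_on UNIV \<psi>" using assms by (simp add: compact_supp_def)
  have out: "\<psi> p = 0" if "p \<notin> cbox (- R, - R) (R, R)" for p
  proof (cases p)
    case (Pair x v)
    then have "\<bar>x\<bar> \<ge> R \<or> \<bar>v\<bar> \<ge> R" using that by (auto simp: cbox_Pair_eq)
    then show ?thesis unfolding Pair by (rule R)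
  qed
  have ind: "indicat_real (cbox (- R, - R) (R, R)) p *\<^sub>R \<psi> p = \<psi> p"
    "indicat_real (cbox (- R, - R) (R, R)) p *\<^sub>R (cmod (\<psi> p))\<^sup>2 = (cmod (\<psi> p))\<^sup>2" for p
    using out[of p] by (auto simp: indicator_def)
  show "integrable lborel \<psi>"
    using borel_integrable_compact[OF compact_cbox continuous_on_subset[OF cont], of "(- R, - R)" "(R, R)"]
    by (simp only: ind) simp
  have "continuous_on UNIV (\<lambda>p. (cmod (\<psi> p))\<^sup>2)" using cont by (intro continuous_intros)
  from borel_integrable_compact[OF compact_cbox continuous_on_subset[OF this], of "(- R, - R)" "(R, R)"]
  have "integrable lborel (\<lambda>p. (cmod (\<psi> p))\<^sup>2)" by (simp only: ind) simp
  then show "square_integrable \<psi>"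
    using cont by (simp add: square_integrable_def borel_measurable_continuous_onI)
qed

text \<open>The formal transpose of the differential operator.\<close>

definition Kt :: "real \<Rightarrow> (real \<times> real \<Rightarrow> complex) \<Rightarrow> real \<times> real \<Rightarrow> complex" where
  "Kt a \<phi> p = of_real (- snd p) * partial_x \<phi> p + (of_real (a * fst p) * partial_v \<phi> p
     + (- 1 * partial_v (partial_v \<phi>) p + of_real ((snd p)\<^sup>2 / 4 - 1 / 2) * \<phi> p))"

lemma compact_supp_Kt: "\<phi> \<in> test_functions \<Longrightarrow> compact_supp (Kt a \<phi>)"
  unfolding Kt_def[abs_def]
  by (intro compact_supp_add compact_supp_mult compact_supp_test test_partial continuous_intros) auto

text \<open>The coefficient v does not depend on x nor the coefficient x on v, so each commutes with
  the derivative next to it; transposition only flips the sign of the transport term.\<close>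

lemma K_dist_dist_of:
  assumes "\<phi> \<in> test_functions" shows "K_dist a (dist_of f) \<phi> = dist_of f (Kt a \<phi>)"
proof -
  have d: "(\<phi> has_derivative frechet_derivative \<phi> (at p)) (at p)" for p
    using test_differentiable[OF assms] unfolding frechet_derivative_works .
  have "((\<lambda>p. complex_of_real (snd p) * \<phi> p) has_derivative
      (\<lambda>h. of_real (snd p) * frechet_derivative \<phi> (at p) h + of_real (snd h) * \<phi> p)) (at p)" for p
    by (rule has_derivative_mult[OF bounded_linear.has_derivative[OF bounded_linear_of_real has_derivative_snd[OF has_derivative_ident]] d])
  from frechet_derivative_at[OF this, symmetric]
  have x: "partial_x (\<lambda>p. complex_of_real (snd p) * \<phi> p) = (\<lambda>p. of_real (snd p) * partial_x \<phi> p)"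
    by (simp add: partial_x_def fun_eq_iff)
  have "((\<lambda>p. complex_of_real (fst p) * \<phi> p) has_derivative
      (\<lambda>h. of_real (fst p) * frechet_derivative \<phi> (at p) h + of_real (fst h) * \<phi> p)) (at p)" for p
    by (rule has_derivative_mult[OF bounded_linear.has_derivative[OF bounded_linear_of_real has_derivative_fst[OF has_derivative_ident]] d])
  from frechet_derivative_at[OF this, symmetric]
  have v: "partial_v (\<lambda>p. complex_of_real (fst p) * \<phi> p) = (\<lambda>p. of_real (fst p) * partial_v \<phi> p)"
    by (simp add: partial_v_def fun_eq_iff)
  note cs = compact_supp_test[OF assms] compact_supp_test[OF test_partial(1)[OF assms]]
    compact_supp_test[OF test_partial(2)[OF assms]] compact_supp_test[OF test_partial(2)[OF test_partial(2)[OF assms]]]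
  have int: "integrable lborel (\<lambda>p. rep_L2 f p * (m p * \<psi> p))" if "continuous_on UNIV m" "compact_supp \<psi>" for m \<psi>
    using dist_of_integrable[OF compact_supp_integrable(2)[OF compact_supp_mult[OF that]]] .
  define I1 where "I1 p = rep_L2 f p * (of_real (snd p) * partial_x \<phi> p)" for p
  define I2 where "I2 p = rep_L2 f p * (of_real (fst p) * partial_v \<phi> p)" for p
  define I3 where "I3 p = rep_L2 f p * (1 * partial_v (partial_v \<phi>) p)" for p
  define I4 where "I4 p = rep_L2 f p * (of_real ((snd p)\<^sup>2 / 4) * \<phi> p)" for p
  define I5 where "I5 p = rep_L2 f p * (1 * \<phi> p)" for p
  have i [simp]: "integrable lborel I1" "integrable lborel I2" "integrable lborel I3" "integrable lborel I4" "integrable lborel I5"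
    unfolding I1_def I2_def I3_def I4_def I5_def by (intro int cs continuous_intros; simp)+
  have "dist_of f (Kt a \<phi>) = (LINT p|lborel. - I1 p + (of_real a * I2 p + (- I3 p + (I4 p - 1 / 2 * I5 p))))"
    unfolding dist_of_def Kt_def I1_def I2_def I3_def I4_def I5_def
    by (intro Bochner_Integration.integral_cong refl) (simp add: algebra_simps)
  also have "\<dots> = - (LINT p|lborel. I1 p) + (of_real a * (LINT p|lborel. I2 p) + (- (LINT p|lborel. I3 p)
     + ((LINT p|lborel. I4 p) - 1 / 2 * (LINT p|lborel. I5 p))))"
    by simp
  also have "\<dots> = K_dist a (dist_of f) \<phi>"
    unfolding K_dist_def dist_mult_def dist_x_def dist_v_def case_prod_beta x v dist_of_def
      I1_def I2_def I3_def I4_def I5_def by simp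
  finally show ?thesis by simp
qed

lemma K_graph_dist_of:
  "K_graph a f g \<longleftrightarrow> (\<forall>\<phi>\<in>test_functions. dist_of f (Kt a \<phi>) = dist_of g \<phi>)"
  by (simp add: K_graph_def K_dist_dist_of)

section \<open>Integration by parts against test functions\<close>

lemma integral_partial_zero:
  fixes \<theta> \<theta>' :: "real \<Rightarrow> real \<Rightarrow> complex"
  assumes d: "\<And>x v. ((\<lambda>x. \<theta> x v) has_vector_derivative \<theta>' x v) (at x)"
    and cs: "compact_supp (\<lambda>p. \<theta>' (fst p) (snd p))" and \<theta>: "compact_supp (\<lambda>p. \<theta> (fst p) (snd p))"
  shows "(LINT v|lborel. LINT x|lborel. \<theta>' x v) = 0"
proof -
  obtain R1 where R1: "\<And>x v. \<bar>x\<bar> \<ge> R1 \<or> \<bar>v\<bar> \<ge> R1 \<Longrightarrow> \<theta> x v = 0"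
    using \<theta> unfolding compact_supp_def fst_conv snd_conv by blast
  obtain R2 where R2: "\<And>x v. \<bar>x\<bar> \<ge> R2 \<or> \<bar>v\<bar> \<ge> R2 \<Longrightarrow> \<theta>' x v = 0"
    using cs unfolding compact_supp_def fst_conv snd_conv by blast
  define R where "R = max (max R1 R2) 0"
  have R: "R \<ge> R1" "R \<ge> R2" "R \<ge> 0" by (auto simp: R_def)
  have "(LINT x|lborel. \<theta>' x v) = 0" for v
  proof -
    have cont: "continuous_on {- R..R} (\<lambda>x. \<theta>' x v)"
      by (rule continuous_on_compose2[of UNIV "\<lambda>p. \<theta>' (fst p) (snd p)" "{- R..R}" "\<lambda>x. (x, v)", simplified])
        (use cs in \<open>auto simp: compact_supp_def intro!: continuous_intros\<close>)
    have "(LINT x|lborel. \<theta>' x v) = (LINT x|lborel. indicat_real {- R..R} x *\<^sub>R \<theta>' x v)"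
      using R R2 by (intro Bochner_Integration.integral_cong refl) (auto simp: indicator_def abs_if)
    also have "\<dots> = \<theta> R v - \<theta> (- R) v"
      by (rule integral_FTC_Icc[OF _ _ cont]) (use R d in \<open>auto intro: has_vector_derivative_at_within\<close>)
    also have "\<dots> = 0" using R R1 by simp
    finally show ?thesis .
  qed
  then show ?thesis by simp
qed

lemma integral_partial_x_zero:
  fixes \<theta> \<theta>' :: "real \<times> real \<Rightarrow> complex"
  assumes "\<And>x v. ((\<lambda>x. \<theta> (x, v)) has_vector_derivative \<theta>' (x, v)) (at x)" "compact_supp \<theta>'" "compact_supp \<theta>"
  shows "(LINT p|lborel. \<theta>' p) = 0"
proof -
  have "integrable (lborel \<Otimes>\<^sub>M lborel) (\<lambda>(x, v). \<theta>' (x, v))"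
    unfolding lborel_prod using compact_supp_integrable(1)[OF assms(2)] by simp
  from lborel_pair.integral_snd[OF this]
  have "(LINT p|lborel. \<theta>' p) = (LINT v|lborel. LINT x|lborel. \<theta>' (x, v))"
    unfolding lborel_prod by simp
  also have "\<dots> = 0"
  proof (rule integral_partial_zero[of "\<lambda>x v. \<theta> (x, v)" "\<lambda>x v. \<theta>' (x, v)"])
    show "((\<lambda>x. \<theta> (x, v)) has_vector_derivative \<theta>' (x, v)) (at x)" for x v by (rule assms(1))
    show "compact_supp (\<lambda>p. \<theta>' (fst p, snd p))" "compact_supp (\<lambda>p. \<theta> (fst p, snd p))"
      using assms(2,3) by simp_all
  qed
  finally show ?thesis .
qed

lemma integral_partial_v_zero:
  fixes \<theta> \<theta>' :: "real \<times> real \<Rightarrow> complex"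
  assumes "\<And>x v. ((\<lambda>v. \<theta> (x, v)) has_vector_derivative \<theta>' (x, v)) (at v)" "compact_supp \<theta>'" "compact_supp \<theta>"
  shows "(LINT p|lborel. \<theta>' p) = 0"
proof -
  have swap: "compact_supp (\<lambda>p. \<psi> (snd p, fst p))" if "compact_supp \<psi>" for \<psi> :: "real \<times> real \<Rightarrow> complex"
  proof -
    have "continuous_on UNIV (\<lambda>p. \<psi> (snd p, fst p))"
      by (rule continuous_on_compose2[of UNIV \<psi>]) (use that in \<open>auto simp: compact_supp_def intro!: continuous_intros\<close>)
    then show ?thesis using that unfolding compact_supp_def fst_conv snd_conv by blast
  qed
  have "integrable (lborel \<Otimes>\<^sub>M lborel) \<theta>'"
    unfolding lborel_prod by (rule compact_supp_integrable(1)[OF assms(2)])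
  from lborel_pair.integral_fst'[OF this]
  have "(LINT p|lborel. \<theta>' p) = (LINT x|lborel. LINT v|lborel. \<theta>' (x, v))"
    unfolding lborel_prod by (rule sym)
  also have "\<dots> = 0"
  proof (rule integral_partial_zero[of "\<lambda>v x. \<theta> (x, v)" "\<lambda>v x. \<theta>' (x, v)"])
    show "((\<lambda>v. \<theta> (x, v)) has_vector_derivative \<theta>' (x, v)) (at v)" for x v by (rule assms(1))
  qed (rule swap assms)+
  finally show ?thesis .
qed

lemma partial_x_vector_derivative:
  assumes "\<phi> \<in> test_functions" shows "((\<lambda>x. \<phi> (x, v)) has_vector_derivative partial_x \<phi> (x, v)) (at x)"
proof -
  have D: "(\<phi> has_derivative frechet_derivative \<phi> (at (x, v))) (at (x, v))"
    using test_differentiable[OF assms] unfolding frechet_derivative_works .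
  have "((\<lambda>x. (x, v)) has_derivative (\<lambda>h. (h, 0))) (at x)"
    by (intro has_derivative_Pair has_derivative_ident has_derivative_const)
  from has_derivative_compose[OF this D]
  have "((\<lambda>x. \<phi> (x, v)) has_derivative (\<lambda>h. frechet_derivative \<phi> (at (x, v)) (h, 0))) (at x)" .
  moreover have "frechet_derivative \<phi> (at (x, v)) (h, 0) = h *\<^sub>R partial_x \<phi> (x, v)" for h
    using linear_cmul[OF has_derivative_linear[OF D], of h "(1, 0)"] by (simp add: partial_x_def)
  ultimately show ?thesis by (simp add: has_vector_derivative_def)
qed

lemma partial_v_vector_derivative:
  assumes "\<phi> \<in> test_functions" shows "((\<lambda>v. \<phi> (x, v)) has_vector_derivative partial_v \<phi> (x, v)) (at v)"
proof -
  have D: "(\<phi> has_derivative frechet_derivative \<phi> (at (x, v))) (at (x, v))"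
    using test_differentiable[OF assms] unfolding frechet_derivative_works .
  have "((\<lambda>v. (x, v)) has_derivative (\<lambda>h. (0, h))) (at v)"
    by (intro has_derivative_Pair has_derivative_ident has_derivative_const)
  from has_derivative_compose[OF this D]
  have "((\<lambda>v. \<phi> (x, v)) has_derivative (\<lambda>h. frechet_derivative \<phi> (at (x, v)) (0, h))) (at v)" .
  moreover have "frechet_derivative \<phi> (at (x, v)) (0, h) = h *\<^sub>R partial_v \<phi> (x, v)" for h
    using linear_cmul[OF has_derivative_linear[OF D], of h "(0, 1)"] by (simp add: partial_v_def)
  ultimately show ?thesis by (simp add: has_vector_derivative_def)
qed

lemma tens_continuous: "continuous_on UNIV F \<Longrightarrow> continuous_on UNIV G \<Longrightarrow> continuous_on UNIV (tens F G)"
proof -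
  assume "continuous_on UNIV F" "continuous_on UNIV G"
  then have "continuous_on UNIV (\<lambda>p. F (fst p))" "continuous_on UNIV (\<lambda>p. G (snd p))"
    by (auto intro: continuous_on_compose2[OF _ continuous_on_fst[OF continuous_on_id]]
        continuous_on_compose2[OF _ continuous_on_snd[OF continuous_on_id]])
  then show ?thesis unfolding tens_def[abs_def] by (intro continuous_on_of_real continuous_on_mult)
qed

text \<open>The two integrands differ pointwise by a divergence. X is the flux of the transport in
  x; V collects the flux of the transport in v and of both integrations by parts of the second
  derivative. Their compact support comes from the test function alone.\<close>

lemma Kt_by_parts:
  assumes \<phi>: "\<phi> \<in> test_functions"
    and F: "\<And>x. (F has_real_derivative F' x) (at x)" and F'c: "continuous_on UNIV F'"
    and G: "\<And>x. (G has_real_derivative G' x) (at x)" and G': "\<And>x. (G' has_real_derivative G'' x) (at x)"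
    and G''c: "continuous_on UNIV G''"
  shows "(LINT p|lborel. tens F G p * Kt a \<phi> p)
    = (LINT p|lborel. (of_real (snd p) * tens F' G p - of_real (a * fst p) * tens F G' p - tens F G'' p
        + of_real ((snd p)\<^sup>2 / 4 - 1 / 2) * tens F G p) * \<phi> p)"
    (is "_ = (LINT p|lborel. ?KT p * \<phi> p)")
proof -
  note Fc = continuous_on_deriv[of F, OF F] and Gc = continuous_on_deriv[of G, OF G]
    and G'c = continuous_on_deriv[of G', OF G']
  note tc = tens_continuous[OF Fc Gc] tens_continuous[OF F'c Gc] tens_continuous[OF Fc G'c] tens_continuous[OF Fc G''c]
  note cs = compact_supp_test[OF \<phi>] compact_supp_test[OF test_partial(1)[OF \<phi>]]
    compact_supp_test[OF test_partial(2)[OF \<phi>]] compact_supp_test[OF test_partial(2)[OF test_partial(2)[OF \<phi>]]]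
  define X where "X p = - of_real (snd p) * tens F G p * \<phi> p" for p
  define X' where "X' p = (- of_real (snd p) * tens F' G p) * \<phi> p + (- of_real (snd p) * tens F G p) * partial_x \<phi> p" for p
  define V where "V p = (of_real (a * fst p) * tens F G p + tens F G' p) * \<phi> p + (- tens F G p) * partial_v \<phi> p" for p
  define V' where "V' p = (of_real (a * fst p) * tens F G' p + tens F G'' p) * \<phi> p
     + ((of_real (a * fst p) * tens F G p) * partial_v \<phi> p + (- tens F G p) * partial_v (partial_v \<phi>) p)" for p
  have csX: "compact_supp X" "compact_supp X'" "compact_supp V" "compact_supp V'"
    unfolding X_def[abs_def] X'_def[abs_def] V_def[abs_def] V'_def[abs_def]
    by (intro compact_supp_add compact_supp_mult cs continuous_intros tc)+
  have "(LINT p|lborel. X' p) = 0"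
  proof (rule integral_partial_x_zero[OF _ csX(2,1)])
    fix x v
    have "((\<lambda>x. F x) has_vector_derivative F' x) (at x)"
      using F by (simp add: has_real_derivative_iff_has_vector_derivative)
    from bounded_linear.has_vector_derivative[OF bounded_linear_of_real this]
    have F1: "((\<lambda>x. complex_of_real (F x)) has_vector_derivative of_real (F' x)) (at x)" .
    have "((\<lambda>x. - of_real v * of_real (G v) * (of_real (F x) * \<phi> (x, v))) has_vector_derivative
        - of_real v * of_real (G v) * (of_real (F x) * partial_x \<phi> (x, v) + of_real (F' x) * \<phi> (x, v))) (at x)"
      by (intro has_vector_derivative_mult_right has_vector_derivative_mult F1 partial_x_vector_derivative \<phi>)
    then show "((\<lambda>x. X (x, v)) has_vector_derivative X' (x, v)) (at x)"
      by (simp add: X_def X'_def tens_def algebra_simps)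
  qed
  moreover have "(LINT p|lborel. V' p) = 0"
  proof (rule integral_partial_v_zero[OF _ csX(4,3)])
    fix x v
    have "((\<lambda>x. G x) has_vector_derivative G' v) (at v)" "((\<lambda>x. G' x) has_vector_derivative G'' v) (at v)"
      using G G' by (simp_all add: has_real_derivative_iff_has_vector_derivative)
    from this[THEN bounded_linear.has_vector_derivative[OF bounded_linear_of_real]]
    have G1: "((\<lambda>x. complex_of_real (G x)) has_vector_derivative of_real (G' v)) (at v)"
      "((\<lambda>x. complex_of_real (G' x)) has_vector_derivative of_real (G'' v)) (at v)" .
    have "((\<lambda>v. of_real (a * x) * of_real (F x) * (of_real (G v) * \<phi> (x, v))
          + of_real (F x) * (of_real (G' v) * \<phi> (x, v)) - of_real (F x) * (of_real (G v) * partial_v \<phi> (x, v))) has_vector_derivative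
        of_real (a * x) * of_real (F x) * (of_real (G v) * partial_v \<phi> (x, v) + of_real (G' v) * \<phi> (x, v))
          + of_real (F x) * (of_real (G' v) * partial_v \<phi> (x, v) + of_real (G'' v) * \<phi> (x, v))
          - of_real (F x) * (of_real (G v) * partial_v (partial_v \<phi>) (x, v) + of_real (G' v) * partial_v \<phi> (x, v))) (at v)"
      by (intro has_vector_derivative_mult_right has_vector_derivative_mult has_vector_derivative_add
          has_vector_derivative_diff G1 partial_v_vector_derivative \<phi> test_partial)
    then show "((\<lambda>v. V (x, v)) has_vector_derivative V' (x, v)) (at v)"
      by (simp add: V_def V'_def tens_def algebra_simps)
  qed
  moreover have "tens F G p * Kt a \<phi> p = ?KT p * \<phi> p + X' p + V' p" for p
    by (simp add: Kt_def X'_def V'_def algebra_simps)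
  moreover have "compact_supp (\<lambda>p. ?KT p * \<phi> p)"
    by (intro compact_supp_mult cs continuous_intros tc) auto
  from Bochner_Integration.integral_add[OF Bochner_Integration.integrable_add[OF compact_supp_integrable(1)[OF this]
          compact_supp_integrable(1)[OF csX(2)]] compact_supp_integrable(1)[OF csX(4)]]
    Bochner_Integration.integral_add[OF compact_supp_integrable(1)[OF this] compact_supp_integrable(1)[OF csX(2)]]
  have "(LINT p|lborel. ?KT p * \<phi> p + X' p + V' p) = (LINT p|lborel. ?KT p * \<phi> p)
      + (LINT p|lborel. X' p) + (LINT p|lborel. V' p)" by (simp only:)
  ultimately show ?thesis by (simp only: add_0_right)
qed

section \<open>From test functions to rapidly decaying products\<close>

lemma dist_of_tendsto:
  assumes meas: "\<And>n. \<psi>n n \<in> borel_measurable lborel" "\<psi> \<in> borel_measurable lborel"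
    and lim: "\<And>p. (\<lambda>n. \<psi>n n p) \<longlonglongrightarrow> \<psi> p"
    and bd: "\<And>n p. cmod (\<psi>n n p) \<le> W p" and W: "square_integrable (\<lambda>p. complex_of_real (W p))"
  shows "(\<lambda>n. dist_of f (\<psi>n n)) \<longlonglongrightarrow> dist_of f \<psi>"
  unfolding dist_of_def
proof (rule integral_dominated_convergence[where w = "\<lambda>p. cmod (rep_L2 f p * of_real (W p))"])
  show "integrable lborel (\<lambda>p. cmod (rep_L2 f p * of_real (W p)))"
    by (intro integrable_norm dist_of_integrable W)
  show "AE p in lborel. (\<lambda>n. rep_L2 f p * \<psi>n n p) \<longlonglongrightarrow> rep_L2 f p * \<psi> p"
    by (intro AE_I2 tendsto_mult_left lim)
  have "cmod (rep_L2 f p * \<psi>n n p) \<le> cmod (rep_L2 f p * of_real (W p))" for n p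
    using order.trans[OF bd[of n p] abs_ge_self] by (auto simp: norm_mult intro!: mult_left_mono)
  then show "AE p in lborel. cmod (rep_L2 f p * \<psi>n n p) \<le> cmod (rep_L2 f p * of_real (W p))" for n
    by simp
qed (use meas in measurable)

text \<open>\<open>Kt a\<close> on a product F(x) G(v). The derivatives are separate arguments so
  that the truncated functions and their limits are inserted into one formula.\<close>

definition Ktens :: "real \<Rightarrow> (real \<Rightarrow> real) \<Rightarrow> (real \<Rightarrow> real) \<Rightarrow> (real \<Rightarrow> real) \<Rightarrow> (real \<Rightarrow> real) \<Rightarrow> (real \<Rightarrow> real)
    \<Rightarrow> real \<times> real \<Rightarrow> real" where
  "Ktens a F F' G G' G'' p = - snd p * (F' (fst p) * G (snd p)) + a * fst p * (F (fst p) * G' (snd p))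
     - F (fst p) * G'' (snd p) + ((snd p)\<^sup>2 / 4 - 1 / 2) * (F (fst p) * G (snd p))"

lemma Kt_tens:
  assumes F: "\<And>x. (F has_real_derivative F' x) (at x)" and G: "\<And>x. (G has_real_derivative G' x) (at x)"
    and G': "\<And>x. (G' has_real_derivative G'' x) (at x)"
  shows "Kt a (tens F G) p = of_real (Ktens a F F' G G' G'' p)"
  by (simp add: Kt_def Ktens_def partial_tens[OF F G] partial_tens[OF F G'] tens_def algebra_simps)

text \<open>The majorant is a product of a function of x and a function of v, the shape required by
  \<open>square_integrable_tensor\<close>; separating the variables is worth the crude
  constants.\<close>

lemma Ktens_bound:
  assumes "\<bar>F x\<bar> \<le> A" "\<bar>F' x\<bar> \<le> A" "\<bar>G v\<bar> \<le> B" "\<bar>G' v\<bar> \<le> B" "\<bar>G'' v\<bar> \<le> B"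
  shows "\<bar>Ktens a F F' G G' G'' (x, v)\<bar> \<le> ((1 + \<bar>a\<bar> * \<bar>x\<bar>) * A) * ((2 + \<bar>v\<bar> + v\<^sup>2) * B)"
proof -
  have A: "A \<ge> 0" and B: "B \<ge> 0" using assms by linarith+
  have AB: "A * B \<ge> 0" using A B by simp
  have m: "\<bar>y * z\<bar> \<le> A * B" if "\<bar>y\<bar> \<le> A" "\<bar>z\<bar> \<le> B" for y z
    unfolding abs_mult using that A by (intro mult_mono) auto
  have tri: "\<bar>q1 + q2 - q3 + q4\<bar> \<le> \<bar>q1\<bar> + \<bar>q2\<bar> + \<bar>q3\<bar> + \<bar>q4\<bar>" for q1 q2 q3 q4 :: real
    by linarith
  have "\<bar>Ktens a F F' G G' G'' (x, v)\<bar>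
      \<le> \<bar>- v * (F' x * G v)\<bar> + \<bar>a * x * (F x * G' v)\<bar> + \<bar>F x * G'' v\<bar> + \<bar>(v\<^sup>2 / 4 - 1 / 2) * (F x * G v)\<bar>"
    unfolding Ktens_def fst_conv snd_conv by (rule tri)
  also have "\<dots> \<le> \<bar>v\<bar> * (A * B) + \<bar>a\<bar> * \<bar>x\<bar> * (A * B) + 1 * (A * B) + (v\<^sup>2 / 4 + 1 / 2) * (A * B)"
  proof (intro add_mono)
    show "\<bar>- v * (F' x * G v)\<bar> \<le> \<bar>v\<bar> * (A * B)"
      using m[of "F' x" "G v"] assms by (simp add: abs_mult mult_left_mono)
    show "\<bar>a * x * (F x * G' v)\<bar> \<le> \<bar>a\<bar> * \<bar>x\<bar> * (A * B)"
      using m[of "F x" "G' v"] assms by (simp add: abs_mult[of "a * x"] abs_mult[of a] mult_left_mono)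
    show "\<bar>F x * G'' v\<bar> \<le> 1 * (A * B)" using m[of "F x" "G'' v"] assms by simp
    have "\<bar>v\<^sup>2 / 4 - 1 / 2\<bar> \<le> v\<^sup>2 / 4 + 1 / 2" using zero_le_power2[of v] by linarith
    then show "\<bar>(v\<^sup>2 / 4 - 1 / 2) * (F x * G v)\<bar> \<le> (v\<^sup>2 / 4 + 1 / 2) * (A * B)"
      unfolding abs_mult[of "v\<^sup>2 / 4 - 1 / 2"] using m[of "F x" "G v"] assms by (intro mult_mono) auto
  qed
  also have "\<dots> = (\<bar>v\<bar> + \<bar>a\<bar> * \<bar>x\<bar> + 1 + (v\<^sup>2 / 4 + 1 / 2)) * (A * B)" by (simp add: algebra_simps)
  also have "\<dots> \<le> ((1 + \<bar>a\<bar> * \<bar>x\<bar>) * (2 + \<bar>v\<bar> + v\<^sup>2)) * (A * B)"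
  proof (rule mult_right_mono[OF _ AB])
    have "0 \<le> \<bar>a\<bar> * \<bar>x\<bar>" "0 \<le> v\<^sup>2" "0 \<le> \<bar>v\<bar>" "0 \<le> (\<bar>a\<bar> * \<bar>x\<bar>) * (1 + \<bar>v\<bar> + v\<^sup>2)" by auto
    moreover have "(1 + \<bar>a\<bar> * \<bar>x\<bar>) * (2 + \<bar>v\<bar> + v\<^sup>2) = 2 + \<bar>v\<bar> + v\<^sup>2 + \<bar>a\<bar> * \<bar>x\<bar> + (\<bar>a\<bar> * \<bar>x\<bar>) * (1 + \<bar>v\<bar> + v\<^sup>2)"
      by (simp add: algebra_simps)
    ultimately show "\<bar>v\<bar> + \<bar>a\<bar> * \<bar>x\<bar> + 1 + (v\<^sup>2 / 4 + 1 / 2) \<le> (1 + \<bar>a\<bar> * \<bar>x\<bar>) * (2 + \<bar>v\<bar> + v\<^sup>2)"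
      by linarith
  qed
  finally show ?thesis by (simp add: mult_ac)
qed

lemma Ktens_measurable:
  assumes [measurable]: "F \<in> borel_measurable borel" "F' \<in> borel_measurable borel" "G \<in> borel_measurable borel"
    "G' \<in> borel_measurable borel" "G'' \<in> borel_measurable borel"
  shows "(\<lambda>p. complex_of_real (Ktens a F F' G G' G'' p)) \<in> borel_measurable lborel"
    "(\<lambda>p. tens F G p) \<in> borel_measurable lborel"
  unfolding Ktens_def tens_def lborel_prod[symmetric] by measurable

lemma smooth1_measurable: "smooth1 F \<Longrightarrow> F \<in> borel_measurable borel"
  unfolding smooth1_def by (metis Ck1.simps(1) borel_measurable_continuous_onI)

text \<open>The graph relation is tested on the product truncated by slowly dilated cut-offs. Each
  derivative falling on a cut-off brings a factor \<open>e N\<close>, so those terms vanish in the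
  limit, and dominated convergence gives the relation for the product itself.\<close>

lemma K_graph_tens:
  assumes graph: "K_graph a f g"
    and sF: "smooth1 F" and sG: "smooth1 G"
    and rF: "rapid F" "rapid (deriv F)" and rG: "rapid G" "rapid (deriv G)" "rapid (deriv (deriv G))"
  shows "dist_of f (\<lambda>p. of_real (Ktens a F (deriv F) G (deriv G) (deriv (deriv G)) p)) = dist_of g (tens F G)"
proof -
  define F' G' G'' where "F' = deriv F" and "G' = deriv G" and "G'' = deriv (deriv G)"
  have dF: "(F has_real_derivative F' x) (at x)" for x unfolding F'_def by (rule smooth1_deriv[OF sF])
  have dG: "(G has_real_derivative G' x) (at x)" for x unfolding G'_def by (rule smooth1_deriv[OF sG])
  have dG': "(G' has_real_derivative G'' x) (at x)" for x
    unfolding G'_def G''_def by (rule smooth1_deriv[OF smooth1_deriv(2)[OF sG]])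
  define k k' k'' where "k = cutoff" and "k' = deriv cutoff" and "k'' = deriv (deriv cutoff)"
  have sk: "smooth1 k" "smooth1 k'" "smooth1 k''"
    unfolding k_def k'_def k''_def by (intro smooth1_deriv(2) smooth1_cutoff)+
  have dk: "(k has_real_derivative k' x) (at x)" "(k' has_real_derivative k'' x) (at x)" for x
    unfolding k_def k'_def k''_def by (intro smooth1_deriv(1) smooth1_deriv(2) smooth1_cutoff)+
  have ck: "continuous_on UNIV k" "continuous_on UNIV k'" "continuous_on UNIV k''"
    using sk unfolding smooth1_def by (metis Ck1.simps(1))+
  have k0: "k x = 0" if "\<bar>x\<bar> \<ge> 1" for x using that by (simp add: k_def cutoff_outside)
  have k'0: "k' x = 0" if "\<bar>x\<bar> > 1" for x
    using deriv_zero_outside[of 1 k k'] k0 dk that by auto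
  \<comment> \<open>\<open>deriv_zero_outside\<close> assumes vanishing for |x| >= R but concludes
    it only for |x| > R, so a second application needs a larger radius; 2 will do.\<close>
  have k'2: "k' x = 0" if "\<bar>x\<bar> \<ge> 2" for x using that k'0 by auto
  have k''0: "k'' x = 0" if "\<bar>x\<bar> > 2" for x
    using deriv_zero_outside[of 2 k' k''] k'2 dk that by auto
  obtain c0 where c0: "c0 \<ge> 0" "\<And>x. \<bar>k x\<bar> \<le> c0" using bounded_if_zero_outside[of k 1] ck k0 by (metis less_imp_le)
  obtain c1 where c1: "c1 \<ge> 0" "\<And>x. \<bar>k' x\<bar> \<le> c1" using bounded_if_zero_outside[of k' 1] ck k'0 by metis
  obtain c2 where c2: "c2 \<ge> 0" "\<And>x. \<bar>k'' x\<bar> \<le> c2" using bounded_if_zero_outside[of k'' 2] ck k''0 by metis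
  define c where "c = c0 + c1 + c2"
  have c: "c \<ge> 0" "\<bar>k x\<bar> \<le> c" "\<bar>k' x\<bar> \<le> c" "\<bar>k'' x\<bar> \<le> c" for x
    using c0 c1 c2 by (auto simp: c_def intro: order.trans[OF c0(2)] order.trans[OF c1(2)] order.trans[OF c2(2)])
  \<comment> \<open>Since \<open>e N \<le> 1\<close>, the factors produced by differentiating the
    cut-offs never enlarge the bounds; the truncated functions vanish for |x| >= N + 1.\<close>
  define e :: "nat \<Rightarrow> real" where "e N = 1 / real (Suc N)" for N
  have e: "0 < e N" "e N \<le> 1" for N by (auto simp: e_def)
  have e0: "e \<longlonglongrightarrow> 0" unfolding e_def[abs_def] by (rule LIMSEQ_Suc[OF lim_1_over_n])
  define F0 where "F0 N x = k (e N * x) * F x" for N x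
  define F1 where "F1 N x = e N * k' (e N * x) * F x + k (e N * x) * F' x" for N x
  define G0 where "G0 N x = k (e N * x) * G x" for N x
  define G1 where "G1 N x = e N * k' (e N * x) * G x + k (e N * x) * G' x" for N x
  define G2 where "G2 N x = e N * (e N * k'' (e N * x)) * G x + 2 * (e N * k' (e N * x) * G' x) + k (e N * x) * G'' x" for N x
  have dke: "((\<lambda>x. k (e N * x)) has_real_derivative e N * k' (e N * x)) (at x)"
     "((\<lambda>x. k' (e N * x)) has_real_derivative e N * k'' (e N * x)) (at x)" for N x
  proof -
    have "((\<lambda>x. e N * x) has_real_derivative e N) (at x)" by (auto intro!: derivative_eq_intros)
    from DERIV_chain2[OF dk(1) this] DERIV_chain2[OF dk(2) this]
    show "((\<lambda>x. k (e N * x)) has_real_derivative e N * k' (e N * x)) (at x)"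
     "((\<lambda>x. k' (e N * x)) has_real_derivative e N * k'' (e N * x)) (at x)" by (simp_all add: mult.commute)
  qed
  have d0: "(F0 N has_real_derivative F1 N x) (at x)" "(G0 N has_real_derivative G1 N x) (at x)" for N x
    unfolding F0_def[abs_def] G0_def[abs_def] F1_def G1_def
    by (auto intro!: derivative_eq_intros dke dF dG)
  have d1: "(G1 N has_real_derivative G2 N x) (at x)" for N x
    unfolding G1_def[abs_def]
    by (rule DERIV_cong[OF DERIV_add[OF DERIV_mult[OF DERIV_cmult[OF dke(2)] dG] DERIV_mult[OF dke(1) dG']]])
      (simp add: G2_def algebra_simps)
  have ske: "smooth1 (\<lambda>x. k (e N * x))" for N using smooth1_affine[OF sk(1), of "e N" 0] by simp
  have s0: "smooth1 (F0 N)" "smooth1 (G0 N)" for N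
    unfolding F0_def[abs_def] G0_def[abs_def] by (intro smooth1_mult ske sF sG)+
  have z0: "F0 N x = 0" "G0 N x = 0" if "\<bar>x\<bar> \<ge> real (Suc N)" for N x
  proof -
    have "\<bar>e N * x\<bar> \<ge> 1" using that by (simp add: e_def abs_mult field_simps)
    then show "F0 N x = 0" "G0 N x = 0" by (simp_all add: F0_def G0_def k0)
  qed
  have test: "tens (F0 N) (G0 N) \<in> test_functions" for N
    by (rule tens_test_function[OF s0 z0])
  have eq: "dist_of f (\<lambda>p. of_real (Ktens a (F0 N) (F1 N) (G0 N) (G1 N) (G2 N) p)) = dist_of g (tens (F0 N) (G0 N))" for N
  proof -
    have "Kt a (tens (F0 N) (G0 N)) = (\<lambda>p. of_real (Ktens a (F0 N) (F1 N) (G0 N) (G1 N) (G2 N) p))"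
      by (rule ext) (rule Kt_tens[OF d0(1) d0(2) d1])
    then show ?thesis using graph test[of N] by (metis K_graph_dist_of)
  qed
  have lk: "(\<lambda>N. h (e N * x)) \<longlonglongrightarrow> h 0" if "continuous_on UNIV h" for h :: "real \<Rightarrow> real" and x
  proof -
    have "(\<lambda>N. e N * x) \<longlonglongrightarrow> 0" using tendsto_mult_left_zero[OF e0] .
    moreover have "isCont h 0" using that by (simp add: continuous_on_eq_continuous_at)
    ultimately show ?thesis by (rule isCont_tendsto_compose[rotated])
  qed
  have k1: "k 0 = 1" by (simp add: k_def cutoff_0)
  have lF0: "(\<lambda>N. F0 N x) \<longlonglongrightarrow> F x" for x
    unfolding F0_def using tendsto_mult_right[OF lk[OF ck(1), of x], of "F x"] by (simp add: k1)
  have lG0: "(\<lambda>N. G0 N x) \<longlonglongrightarrow> G x" for x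
    unfolding G0_def using tendsto_mult_right[OF lk[OF ck(1), of x], of "G x"] by (simp add: k1)
  have l1: "(\<lambda>N. e N * k' (e N * x) * y + k (e N * x) * z) \<longlonglongrightarrow> 0 * k' 0 * y + k 0 * z" for x y z
    by (intro tendsto_intros lk ck e0)
  have lF1: "(\<lambda>N. F1 N x) \<longlonglongrightarrow> F' x" for x unfolding F1_def using l1[of x "F x" "F' x"] by (simp add: k1)
  have lG1: "(\<lambda>N. G1 N x) \<longlonglongrightarrow> G' x" for x unfolding G1_def using l1[of x "G x" "G' x"] by (simp add: k1)
  have "(\<lambda>N. G2 N x) \<longlonglongrightarrow> 0 * (0 * k'' 0) * G x + 2 * (0 * k' 0 * G' x) + k 0 * G'' x" for x
    unfolding G2_def by (intro tendsto_intros lk ck e0)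
  then have lG2: "(\<lambda>N. G2 N x) \<longlonglongrightarrow> G'' x" for x by (simp add: k1)
  \<comment> \<open>Majorants independent of N: in the product rule every cut-off factor, together
    with its powers of \<open>e N\<close>, is replaced by c. The 2 in B is the mixed term of the
    second derivative.\<close>
  define A where "A x = c * (\<bar>F x\<bar> + \<bar>F' x\<bar>)" for x
  define B where "B x = c * (\<bar>G x\<bar> + 2 * \<bar>G' x\<bar> + \<bar>G'' x\<bar>)" for x
  have ek: "\<bar>e N * k' y\<bar> \<le> c" "\<bar>e N * (e N * k'' y)\<bar> \<le> c" for N y
  proof -
    have m: "\<bar>e N * z\<bar> \<le> c" if "\<bar>z\<bar> \<le> c" for z
    proof -
      have "\<bar>e N * z\<bar> \<le> 1 * c" unfolding abs_mult using e[of N] that by (intro mult_mono) auto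
      then show ?thesis by simp
    qed
    show "\<bar>e N * k' y\<bar> \<le> c" "\<bar>e N * (e N * k'' y)\<bar> \<le> c" by (intro m c)+
  qed
  have mc: "\<bar>y * z\<bar> \<le> c * \<bar>z\<bar>" if "\<bar>y\<bar> \<le> c" for y z
    unfolding abs_mult using that by (intro mult_right_mono) auto
  have mc2: "\<bar>y1 * z1 + y2 * z2\<bar> \<le> c * (\<bar>z1\<bar> + \<bar>z2\<bar>)" if "\<bar>y1\<bar> \<le> c" "\<bar>y2\<bar> \<le> c" for y1 y2 z1 z2
    unfolding distrib_left by (rule order.trans[OF abs_triangle_ineq add_mono[OF mc[OF that(1)] mc[OF that(2)]]])
  have mc3: "\<bar>y1 * z1 + 2 * (y2 * z2) + y3 * z3\<bar> \<le> c * (\<bar>z1\<bar> + 2 * \<bar>z2\<bar> + \<bar>z3\<bar>)"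
    if "\<bar>y1\<bar> \<le> c" "\<bar>y2\<bar> \<le> c" "\<bar>y3\<bar> \<le> c" for y1 y2 y3 z1 z2 z3
    using add_mono[OF mc2[OF that(1,2), of z1 "2 * z2"] mc[OF that(3), of z3]]
      abs_triangle_ineq[of "y1 * z1 + y2 * (2 * z2)" "y3 * z3"]
    by (simp add: distrib_left mult.left_commute abs_mult[of 2 z2])
  have bF: "\<bar>F0 N x\<bar> \<le> A x" "\<bar>F1 N x\<bar> \<le> A x" for N x
  proof -
    show "\<bar>F0 N x\<bar> \<le> A x" unfolding F0_def A_def
      by (rule order.trans[OF mc[OF c(2)] mult_left_mono[OF _ c(1)]]) simp
    show "\<bar>F1 N x\<bar> \<le> A x" unfolding F1_def A_def by (rule mc2[OF ek(1) c(2)])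
  qed
  have bG: "\<bar>G0 N x\<bar> \<le> B x" "\<bar>G1 N x\<bar> \<le> B x" "\<bar>G2 N x\<bar> \<le> B x" for N x
  proof -
    show "\<bar>G0 N x\<bar> \<le> B x" unfolding G0_def B_def
      by (rule order.trans[OF mc[OF c(2)] mult_left_mono[OF _ c(1)]]) simp
    show "\<bar>G1 N x\<bar> \<le> B x" unfolding G1_def B_def
      by (rule order.trans[OF mc2[OF ek(1) c(2)] mult_left_mono[OF _ c(1)]]) simp
    show "\<bar>G2 N x\<bar> \<le> B x" unfolding G2_def B_def by (rule mc3[OF ek(2) ek(1) c(2)])
  qed
  define WA where "WA x = (1 + \<bar>a\<bar> * \<bar>x\<bar>) * A x" for x
  define WB where "WB v = (2 + \<bar>v\<bar> + v\<^sup>2) * B v" for v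
  have rA: "rapid A" and rB: "rapid B"
    unfolding A_def[abs_def] B_def[abs_def] F'_def G'_def G''_def
    by (intro rapid_cmult rapid_add rapid_abs rF rG)+
  have rWA: "rapid WA" unfolding WA_def[abs_def]
  proof (rule rapid_mult_exp_bound[OF rA, where B = "1 + \<bar>a\<bar>" and b = 1])
    have "1 + \<bar>a\<bar> * \<bar>x\<bar> \<le> (1 + \<bar>a\<bar>) * exp \<bar>x\<bar>" for x :: real
    proof -
      have "\<bar>x\<bar> \<le> exp \<bar>x\<bar>" by (rule order.trans[OF _ exp_ge_add_one_self]) simp
      then have "1 + \<bar>a\<bar> * \<bar>x\<bar> \<le> exp \<bar>x\<bar> + \<bar>a\<bar> * exp \<bar>x\<bar>"
        by (intro add_mono mult_left_mono) auto
      then show ?thesis by (simp add: algebra_simps)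
    qed
    then show "\<bar>1 + \<bar>a\<bar> * \<bar>x\<bar>\<bar> \<le> (1 + \<bar>a\<bar>) * exp (1 * \<bar>x\<bar>)" for x :: real
      by (simp add: abs_of_nonneg)
  qed (intro continuous_intros)
  have rWB: "rapid WB" unfolding WB_def[abs_def]
  proof (rule rapid_mult_exp_bound[OF rB, where B = 2 and b = 2])
    have "2 + \<bar>x\<bar> + x\<^sup>2 \<le> 2 * exp (2 * \<bar>x\<bar>)" for x :: real
    proof -
      have "2 + \<bar>x\<bar> + x\<^sup>2 \<le> 2 * (1 + \<bar>x\<bar>)\<^sup>2" by (simp add: power2_sum)
      also have "\<dots> \<le> 2 * (exp \<bar>x\<bar>)\<^sup>2" by (intro mult_left_mono power_mono exp_ge_add_one_self) auto
      finally show ?thesis by (simp add: exp_double)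
    qed
    then show "\<bar>2 + \<bar>x\<bar> + x\<^sup>2\<bar> \<le> 2 * exp (2 * \<bar>x\<bar>)" for x :: real
      by (simp add: abs_of_nonneg)
  qed (intro continuous_intros)
  have sqW: "square_integrable (\<lambda>p. complex_of_real (WA (fst p) * WB (snd p)))"
    by (rule square_integrable_tensor[OF rWA rWB])
  note meas = smooth1_measurable[OF s0(1)] smooth1_measurable[OF s0(2)]
  have m1: "F1 N \<in> borel_measurable borel" "G1 N \<in> borel_measurable borel" "G2 N \<in> borel_measurable borel" for N
  proof -
    have "F1 N = deriv (F0 N)" "G1 N = deriv (G0 N)" using d0 by (metis DERIV_imp_deriv ext)+
    moreover have "G2 N = deriv (G1 N)" using d1 by (metis DERIV_imp_deriv ext)
    ultimately show "F1 N \<in> borel_measurable borel" "G1 N \<in> borel_measurable borel" "G2 N \<in> borel_measurable borel"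
      using smooth1_deriv(2)[OF s0(1)[of N]] smooth1_deriv(2)[OF s0(2)[of N]]
        smooth1_deriv(2)[OF smooth1_deriv(2)[OF s0(2)[of N]]] smooth1_measurable by metis+
  qed
  have mF: "F \<in> borel_measurable borel" "F' \<in> borel_measurable borel" "G \<in> borel_measurable borel"
    "G' \<in> borel_measurable borel" "G'' \<in> borel_measurable borel"
    unfolding F'_def G'_def G''_def by (intro rapid_measurable rF rG)+
  have lim1: "(\<lambda>N. dist_of f (\<lambda>p. of_real (Ktens a (F0 N) (F1 N) (G0 N) (G1 N) (G2 N) p)))
      \<longlonglongrightarrow> dist_of f (\<lambda>p. of_real (Ktens a F F' G G' G'' p))"
  proof (rule dist_of_tendsto[OF _ _ _ _ sqW])
    show "(\<lambda>p. complex_of_real (Ktens a (F0 N) (F1 N) (G0 N) (G1 N) (G2 N) p)) \<in> borel_measurable lborel" for N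
      by (rule Ktens_measurable(1)[OF meas(1) m1(1) meas(2) m1(2,3)])
    show "(\<lambda>p. complex_of_real (Ktens a F F' G G' G'' p)) \<in> borel_measurable lborel"
      by (rule Ktens_measurable(1)[OF mF])
    show "(\<lambda>N. complex_of_real (Ktens a (F0 N) (F1 N) (G0 N) (G1 N) (G2 N) p))
      \<longlonglongrightarrow> complex_of_real (Ktens a F F' G G' G'' p)" for p
      unfolding Ktens_def by (intro tendsto_intros lF0 lF1 lG0 lG1 lG2)
    show "cmod (complex_of_real (Ktens a (F0 N) (F1 N) (G0 N) (G1 N) (G2 N) p)) \<le> WA (fst p) * WB (snd p)" for N p
      using Ktens_bound[where F = "F0 N" and F' = "F1 N" and G = "G0 N" and G' = "G1 N" and G'' = "G2 N"
          and x = "fst p" and v = "snd p" and A = "A (fst p)" and B = "B (snd p)", OF bF bG, of a]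
      by (simp add: WA_def WB_def)
  qed
  have lim2: "(\<lambda>N. dist_of g (tens (F0 N) (G0 N))) \<longlonglongrightarrow> dist_of g (tens F G)"
  proof (rule dist_of_tendsto[OF _ _ _ _ square_integrable_tensor[OF rA rB]])
    show "tens (F0 N) (G0 N) \<in> borel_measurable lborel" for N
      using Ktens_measurable(2)[OF meas(1) m1(1) meas(2) m1(2,3)] by simp
    show "tens F G \<in> borel_measurable lborel" using Ktens_measurable(2)[OF mF] by simp
    show "(\<lambda>N. tens (F0 N) (G0 N) p) \<longlonglongrightarrow> tens F G p" for p
      unfolding tens_def by (intro tendsto_intros lF0 lG0)
    have "A x \<ge> 0" for x using order.trans[OF abs_ge_zero bF(1)] .
    then show "cmod (tens (F0 N) (G0 N) p) \<le> A (fst p) * B (snd p)" for N p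
      unfolding tens_def norm_of_real abs_mult by (intro mult_mono bF bG) auto
  qed
  from LIMSEQ_unique[OF lim1[unfolded eq] lim2]
  show ?thesis by (simp add: F'_def G'_def G''_def)
qed

section \<open>The graph of the operator in the Hermite basis\<close>

lemma smooth1_hfun: "smooth1 (hfun n)"
proof (rule smooth1_closed)
  show "hfun n \<in> range (\<lambda>p x. poly p x * exp (- (x\<^sup>2 / 4)))"
    by (rule range_eqI[of _ _ "hermite n"]) (simp add: hfun_def fun_eq_iff)
  fix f :: "real \<Rightarrow> real" assume "f \<in> range (\<lambda>p x. poly p x * exp (- (x\<^sup>2 / 4)))"
  then obtain p where f: "f = (\<lambda>x. poly p x * exp (- (x\<^sup>2 / 4)))" by auto
  have "(f has_real_derivative poly (pderiv p - [:0, 1 / 2:] * p) x * exp (- (x\<^sup>2 / 4))) (at x)" for x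
    unfolding f by (auto intro!: derivative_eq_intros poly_DERIV simp: algebra_simps)
  then show "\<exists>f'\<in>range (\<lambda>p x. poly p x * exp (- (x\<^sup>2 / 4))). \<forall>x. (f has_real_derivative f' x) (at x)"
    by (intro bexI[of _ "\<lambda>x. poly (pderiv p - [:0, 1 / 2:] * p) x * exp (- (x\<^sup>2 / 4))"] allI)
      (assumption, rule range_eqI[of _ _ "pderiv p - [:0, 1 / 2:] * p"], rule refl)
qed

lemma deriv_hfun: "deriv (hfun n) = (\<lambda>x. real n * hfun (n - 1) x - x / 2 * hfun n x)"
  using hfun_deriv by (intro ext DERIV_imp_deriv)

lemma deriv2_hfun: "deriv (deriv (hfun n)) = (\<lambda>x. (x\<^sup>2 / 4 - 1 / 2 - real n) * hfun n x)"
proof (rule ext, rule DERIV_imp_deriv)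
  fix x
  have "((\<lambda>x. real n * hfun (n - 1) x - x / 2 * hfun n x) has_real_derivative
      real n * (x / 2 * hfun (n - 1) x - hfun (Suc (n - 1)) x)
      - (1 / 2 * hfun n x + x / 2 * (real n * hfun (n - 1) x - x / 2 * hfun n x))) (at x)"
  proof -
    have "((\<lambda>x. x / 2) has_real_derivative 1 / 2) (at x)" by (auto intro!: derivative_eq_intros)
    from DERIV_diff[OF DERIV_cmult[OF hfun_deriv'[of "n - 1" x], of "real n"] DERIV_mult[OF this hfun_deriv[of n x]]]
    show ?thesis by (simp add: mult.commute)
  qed
  moreover have "real n * hfun (Suc (n - 1)) x = real n * hfun n x" by (cases n) auto
  then have "real n * (x / 2 * hfun (n - 1) x - hfun (Suc (n - 1)) x)
      - (1 / 2 * hfun n x + x / 2 * (real n * hfun (n - 1) x - x / 2 * hfun n x)) = (x\<^sup>2 / 4 - 1 / 2 - real n) * hfun n x"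
    by (auto simp: algebra_simps power2_eq_square)
  ultimately show "(deriv (hfun n) has_real_derivative (x\<^sup>2 / 4 - 1 / 2 - real n) * hfun n x) (at x)"
    by (simp add: deriv_hfun)
qed

lemma rapid_deriv_hfun: "rapid (deriv (hfun n))" "rapid (deriv (deriv (hfun n)))"
proof -
  show "rapid (deriv (hfun n))"
    using rapid_diff[OF rapid_cmult[OF rapid_hfun, of "real n" "n - 1"] rapid_cmult[OF rapid_id_mult[OF rapid_hfun[of n]], of "1 / 2"]]
    by (simp add: deriv_hfun)
  have "rapid (\<lambda>x. poly [:- 1 / 2 - real n, 0, 1 / 4:] x * hfun n x)" by (rule rapid_poly_mult[OF rapid_hfun])
  then show "rapid (deriv (deriv (hfun n)))"
    by (simp add: deriv2_hfun power2_eq_square algebra_simps)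
qed

context kfp
begin

definition Fh :: "nat \<Rightarrow> real \<Rightarrow> real" where "Fh j x = sqrt (s / (2 * pi)) * hfun j (s * x)"

lemma HC_tens: "HC i j = tens (Fh j) (hfun i)"
  by (simp add: HC_tensor tens_def Fh_def fun_eq_iff)

lemma rapid_Fh: "rapid (Fh j)"
  unfolding Fh_def[abs_def] by (rule rapid_Hf_fst)

lemma smooth1_Fh: "smooth1 (Fh j)"
  using smooth1_mult[OF smooth1_const smooth1_affine[OF smooth1_hfun], of "sqrt (s / (2 * pi))" j s 0]
  by (simp add: Fh_def[abs_def])

lemma Fh_deriv: "(Fh j has_real_derivative sqrt (s / (2 * pi)) * (s * deriv (hfun j) (s * x))) (at x)"
proof -
  have "((\<lambda>x. s * x) has_real_derivative s) (at x)" by (auto intro!: derivative_eq_intros)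
  from DERIV_cmult[OF DERIV_chain2[OF smooth1_deriv(1)[OF smooth1_hfun] this], of "sqrt (s / (2 * pi))" j]
  show ?thesis by (simp add: Fh_def[abs_def] mult_ac)
qed

lemma deriv_Fh: "deriv (Fh j) = (\<lambda>x. sqrt (s / (2 * pi)) * (s * deriv (hfun j) (s * x)))"
  using Fh_deriv by (intro ext DERIV_imp_deriv)

lemma rapid_deriv_Fh: "rapid (deriv (Fh j))"
  unfolding deriv_Fh by (intro rapid_cmult rapid_scale rapid_deriv_hfun s_pos)

lemma s_mult: "s * s = a" using a_pos by (simp add: s_def)

text \<open>In the variable y = s x the transport is s (v d_y - y d_v). The terms with v y / 2 from
  the Gaussians cancel; expanding v and y times a Hermite function, the products of both lowered
  functions, with factor i j, cancel as well. What is left is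
  \<open>s (b\<^sup>* c - c\<^sup>* b)\<close>.\<close>

lemma transport_Hf:
  "snd p * (deriv (Fh j) (fst p) * hfun i (snd p)) - a * fst p * (Fh j (fst p) * deriv (hfun i) (snd p))
    = s * (real j * Hf (Suc i) (j - 1) p - real i * Hf (i - 1) (Suc j) p)"
proof -
  define y v \<nu> where "y = s * fst p" and "v = snd p" and "\<nu> = sqrt (s / (2 * pi))"
  have "v * (\<nu> * (s * (real j * hfun (j - 1) y - y / 2 * hfun j y)) * hfun i v)
      - s * y * (\<nu> * hfun j y * (real i * hfun (i - 1) v - v / 2 * hfun i v))
    = s * \<nu> * (real j * hfun (j - 1) y * (v * hfun i v) - real i * hfun (i - 1) v * (y * hfun j y))"
    by (simp add: algebra_simps)
  also have "\<dots> = s * (real j * (\<nu> * hfun (j - 1) y * hfun (Suc i) v) - real i * (\<nu> * hfun (Suc j) y * hfun (i - 1) v))"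
    unfolding hfun_mult by (simp add: algebra_simps)
  finally have *: "v * (\<nu> * (s * (real j * hfun (j - 1) y - y / 2 * hfun j y)) * hfun i v)
      - s * y * (\<nu> * hfun j y * (real i * hfun (i - 1) v - v / 2 * hfun i v))
    = s * (real j * (\<nu> * hfun (j - 1) y * hfun (Suc i) v) - real i * (\<nu> * hfun (Suc j) y * hfun (i - 1) v))" .
  have y: "a * fst p = s * y" unfolding y_def mult.assoc[symmetric] s_mult ..
  show ?thesis
    unfolding deriv_Fh Fh_def deriv_hfun Hf_def y y_def[symmetric] v_def[symmetric] \<nu>_def[symmetric]
    by (rule *)
qed

lemma oscillator_Hf:
  "- (Fh j (fst p) * deriv (deriv (hfun i)) (snd p)) + ((snd p)\<^sup>2 / 4 - 1 / 2) * (Fh j (fst p) * hfun i (snd p)) = real i * Hf i j p"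
  by (simp add: deriv2_hfun Fh_def Hf_def algebra_simps)

lemma Ktens_Hf:
  "Ktens a (Fh j) (deriv (Fh j)) (hfun i) (deriv (hfun i)) (deriv (deriv (hfun i))) p
    = real i * Hf i j p - s * (real j * Hf (Suc i) (j - 1) p - real i * Hf (i - 1) (Suc j) p)"
  using transport_Hf[of p j i] oscillator_Hf[of j p i] unfolding Ktens_def by (simp only: mult_minus_left)

lemma integral_HC_comb:
  assumes "square_integrable f"
  shows "(LINT p|lborel. f p * (x * HC i j p + y * HC k l p + z * HC m n p))
    = x * (LINT p|lborel. f p * HC i j p) + y * (LINT p|lborel. f p * HC k l p) + z * (LINT p|lborel. f p * HC m n p)"
proof -
  have [simp]: "integrable lborel (\<lambda>p. w * (f p * HC i j p))" for w i j
    by (intro integrable_mult_right integrable_mult assms square_integrable_HC)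
  have "(LINT p|lborel. f p * (x * HC i j p + y * HC k l p + z * HC m n p))
     = (LINT p|lborel. x * (f p * HC i j p) + y * (f p * HC k l p) + z * (f p * HC m n p))"
    by (intro Bochner_Integration.integral_cong refl) (simp add: algebra_simps)
  also have "\<dots> = (LINT p|lborel. x * (f p * HC i j p)) + (LINT p|lborel. y * (f p * HC k l p)) + (LINT p|lborel. z * (f p * HC m n p))"
    by (subst Bochner_Integration.integral_add; (intro Bochner_Integration.integrable_add)?; simp?)+
  finally show ?thesis by (simp only: integral_mult_right_zero)
qed

text \<open>Pairing with a Hermite function moves the operator onto it, so the coefficients of g are
  those of f transformed by the transposed matrix. This holds for every pair in the maximal
  graph.\<close>

lemma K_graph_cf:
  assumes "K_graph a f g"
  shows "cf g i j = of_nat i * cf f i j - of_real s * (of_nat j * cf f (Suc i) (j - 1) - of_nat i * cf f (i - 1) (Suc j))"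
proof -
  have "cf g i j = dist_of g (tens (Fh j) (hfun i))" by (simp add: cf_def HC_tens)
  also have "\<dots> = dist_of f (\<lambda>p. of_real (Ktens a (Fh j) (deriv (Fh j)) (hfun i) (deriv (hfun i)) (deriv (deriv (hfun i))) p))"
    by (rule K_graph_tens[OF assms smooth1_Fh smooth1_hfun rapid_Fh rapid_deriv_Fh rapid_hfun rapid_deriv_hfun, symmetric])
  also have "(\<lambda>p. complex_of_real (Ktens a (Fh j) (deriv (Fh j)) (hfun i) (deriv (hfun i)) (deriv (deriv (hfun i))) p))
     = (\<lambda>p. of_nat i * HC i j p + (- of_real s * of_nat j) * HC (Suc i) (j - 1) p + (of_real s * of_nat i) * HC (i - 1) (Suc j) p)"
    unfolding Ktens_Hf by (simp add: fun_eq_iff HC_def algebra_simps)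
  finally show ?thesis
    unfolding cf_def dist_of_def integral_HC_comb[OF square_integrable_rep] by (simp add: algebra_simps)
qed

text \<open>Here the Hermite function is the argument of the operator and not the object tested
  with. Integration by parts restores the operator itself, so the transport has the sign opposite to
  \<open>Ktens_Hf\<close>.\<close>

lemma dist_of_HL_Kt:
  assumes \<phi>: "\<phi> \<in> test_functions"
  shows "dist_of (HL i j) (Kt a \<phi>) = of_nat i * dist_of (HL i j) \<phi>
    + of_real s * (of_nat j * dist_of (HL (Suc i) (j - 1)) \<phi> - of_nat i * dist_of (HL (i - 1) (Suc j)) \<phi>)"
proof -
  note sq = compact_supp_integrable(2)[OF compact_supp_test[OF \<phi>]]
  have HLd: "dist_of (HL i j) \<phi> = (LINT p|lborel. \<phi> p * HC i j p)" for i j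
    unfolding HL_def dist_of_abs[OF square_integrable_HC sq] by (simp add: mult.commute)
  have "dist_of (HL i j) (Kt a \<phi>) = (LINT p|lborel. tens (Fh j) (hfun i) p * Kt a \<phi> p)"
    unfolding HL_def by (subst dist_of_abs[OF square_integrable_HC compact_supp_integrable(2)[OF compact_supp_Kt[OF \<phi>]]]) (simp add: HC_tens)
  also have "\<dots> = (LINT p|lborel. (of_real (snd p) * tens (deriv (Fh j)) (hfun i) p
      - of_real (a * fst p) * tens (Fh j) (deriv (hfun i)) p - tens (Fh j) (deriv (deriv (hfun i))) p
        + of_real ((snd p)\<^sup>2 / 4 - 1 / 2) * tens (Fh j) (hfun i) p) * \<phi> p)"
    by (rule Kt_by_parts[OF \<phi> smooth1_deriv(1)[OF smooth1_Fh] rapid_continuous[OF rapid_deriv_Fh]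
          smooth1_deriv(1)[OF smooth1_hfun] smooth1_deriv(1)[OF smooth1_deriv(2)[OF smooth1_hfun]]
          rapid_continuous[OF rapid_deriv_hfun(2)]])
  also have "\<dots> = (LINT p|lborel. \<phi> p * (of_nat i * HC i j p + (of_real s * of_nat j) * HC (Suc i) (j - 1) p
      + (- of_real s * of_nat i) * HC (i - 1) (Suc j) p))"
  proof (intro Bochner_Integration.integral_cong refl)
    fix p :: "real \<times> real"
    have "of_real (snd p) * tens (deriv (Fh j)) (hfun i) p
      - of_real (a * fst p) * tens (Fh j) (deriv (hfun i)) p - tens (Fh j) (deriv (deriv (hfun i))) p
        + of_real ((snd p)\<^sup>2 / 4 - 1 / 2) * tens (Fh j) (hfun i) p
      = complex_of_real ((snd p * (deriv (Fh j) (fst p) * hfun i (snd p)) - a * fst p * (Fh j (fst p) * deriv (hfun i) (snd p)))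
        + (- (Fh j (fst p) * deriv (deriv (hfun i)) (snd p)) + ((snd p)\<^sup>2 / 4 - 1 / 2) * (Fh j (fst p) * hfun i (snd p))))"
      unfolding tens_def by simp
    also have "\<dots> = complex_of_real (s * (real j * Hf (Suc i) (j - 1) p - real i * Hf (i - 1) (Suc j) p) + real i * Hf i j p)"
      unfolding transport_Hf oscillator_Hf ..
    also have "\<dots> = of_nat i * HC i j p + (of_real s * of_nat j) * HC (Suc i) (j - 1) p
      + (- of_real s * of_nat i) * HC (i - 1) (Suc j) p"
      by (simp add: HC_def algebra_simps)
    finally show "(of_real (snd p) * tens (deriv (Fh j)) (hfun i) p
      - of_real (a * fst p) * tens (Fh j) (deriv (hfun i)) p - tens (Fh j) (deriv (deriv (hfun i))) p
        + of_real ((snd p)\<^sup>2 / 4 - 1 / 2) * tens (Fh j) (hfun i) p) * \<phi> p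
      = \<phi> p * (of_nat i * HC i j p + (of_real s * of_nat j) * HC (Suc i) (j - 1) p
      + (- of_real s * of_nat i) * HC (i - 1) (Suc j) p)" by (simp only: mult.commute)
  qed
  also have "\<dots> = of_nat i * dist_of (HL i j) \<phi> + (of_real s * of_nat j) * dist_of (HL (Suc i) (j - 1)) \<phi>
      + (- of_real s * of_nat i) * dist_of (HL (i - 1) (Suc j)) \<phi>"
    unfolding integral_HC_comb[OF sq] HLd ..
  finally show ?thesis by (simp add: algebra_simps)
qed

lemma dist_of_Jn: "square_integrable \<psi> \<Longrightarrow> dist_of (Jn n p) \<psi> = (\<Sum>i\<le>n. coeff p i * dist_of (HL i (n - i)) \<psi>)"
  unfolding Jn_def
  by (subst linear_sum[OF bounded_linear.linear[OF bounded_linear_dist_of]]) (simp_all add: dist_of_scaleC)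

lemma dist_of_Jn_Kt:
  assumes \<phi>: "\<phi> \<in> test_functions" and p: "degree p \<le> n"
  shows "dist_of (Jn n p) (Kt a \<phi>) = dist_of (Jn n (Kpoly n p)) \<phi>"
proof -
  define D where "D i = dist_of (HL i (n - i)) \<phi>" for i
  define c where "c = coeff p"
  have c0: "c (Suc n) = 0" using p by (simp add: c_def coeff_eq_0)
  have "dist_of (Jn n p) (Kt a \<phi>) = (\<Sum>i\<le>n. c i * dist_of (HL i (n - i)) (Kt a \<phi>))"
    unfolding dist_of_Jn[OF compact_supp_integrable(2)[OF compact_supp_Kt[OF \<phi>]]] c_def ..
  also have "\<dots> = (\<Sum>i\<le>n. of_nat i * c i * D i) + (\<Sum>i\<le>n. of_real s * of_nat (n - i) * c i * D (Suc i))
      - (\<Sum>i\<le>n. if i = 0 then 0 else of_real s * of_nat i * c i * D (i - 1))"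
    unfolding sum.distrib[symmetric] sum_subtractf[symmetric]
  proof (intro sum.cong refl)
    fix i assume "i \<in> {..n}"
    then have "n - (i - 1) = Suc (n - i)" if "i \<noteq> 0" using that by auto
    moreover have "n - i - 1 = n - Suc i" by simp
    ultimately show "c i * dist_of (HL i (n - i)) (Kt a \<phi>)
      = of_nat i * c i * D i + of_real s * of_nat (n - i) * c i * D (Suc i)
       - (if i = 0 then 0 else of_real s * of_nat i * c i * D (i - 1))"
      unfolding dist_of_HL_Kt[OF \<phi>] D_def by (cases "i = 0") (simp_all add: algebra_simps)
  qed
  also have "(\<Sum>i\<le>n. of_real s * of_nat (n - i) * c i * D (Suc i))
     = (\<Sum>i\<le>Suc n. if i = 0 then 0 else of_real s * of_nat (n - (i - 1)) * c (i - 1) * D i)"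
    unfolding sum.atMost_Suc_shift by simp
  \<comment> \<open>The term at \<open>Suc n\<close> vanishes through the factor n - n. In the next
    sum the term at \<open>Suc n\<close> is added, being zero by \<open>c0\<close>.\<close>
  also have "\<dots> = (\<Sum>i\<le>n. if i = 0 then 0 else of_real s * of_nat (n - (i - 1)) * c (i - 1) * D i)" by simp
  also have "(\<Sum>i\<le>n. if i = 0 then 0 else of_real s * of_nat i * c i * D (i - 1))
     = (\<Sum>i\<le>Suc n. if i = 0 then 0 else of_real s * of_nat i * c i * D (i - 1))" by (simp add: c0)
  also have "\<dots> = (\<Sum>i\<le>n. of_real s * of_nat (Suc i) * c (Suc i) * D i)"
    unfolding sum.atMost_Suc_shift by simp
  also have "(\<Sum>i\<le>n. of_nat i * c i * D i)
      + (\<Sum>i\<le>n. if i = 0 then 0 else of_real s * of_nat (n - (i - 1)) * c (i - 1) * D i)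
      - (\<Sum>i\<le>n. of_real s * of_nat (Suc i) * c (Suc i) * D i) = (\<Sum>i\<le>n. coeff (Kpoly n p) i * D i)"
    unfolding sum.distrib[symmetric] sum_subtractf[symmetric]
  proof (intro sum.cong refl)
    fix i assume "i \<in> {..n}"
    then have "of_nat n - of_nat (i - 1) = (of_nat (n - (i - 1)) :: complex)" by (intro of_nat_diff[symmetric]) auto
    then show "of_nat i * c i * D i + (if i = 0 then 0 else of_real s * of_nat (n - (i - 1)) * c (i - 1) * D i)
       - of_real s * of_nat (Suc i) * c (Suc i) * D i = coeff (Kpoly n p) i * D i"
      unfolding coeff_Kpoly c_def[symmetric]
      by (cases "i = 0") (simp_all only: if_True if_False simp_thms, simp_all add: algebra_simps del: of_nat_diff)
  qed
  also have "\<dots> = dist_of (Jn n (Kpoly n p)) \<phi>"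
    unfolding dist_of_Jn[OF compact_supp_integrable(2)[OF compact_supp_test[OF \<phi>]]] D_def ..
  finally show ?thesis .
qed

lemma K_graph_imp_pn: assumes "K_graph a f g" shows "pn n g = Kpoly n (pn n f)"
proof (rule poly_eqI)
  fix i
  show "coeff (pn n g) i = coeff (Kpoly n (pn n f)) i"
  proof (cases "i \<le> n")
    case False
    then have "coeff (Kpoly n (pn n f)) i = 0"
      by (intro coeff_eq_0 le_less_trans[OF degree_Kpoly[OF degree_pn]]) simp
    with False show ?thesis by (simp add: coeff_pn)
  next
    case True
    define j where "j = n - i"
    have n: "n = i + j" using True by (simp add: j_def)
    \<comment> \<open>Weights change along with the index: j / (i! j!) = (i + 1) / ((i + 1)! (j -
      1)!) for j > 0, and both sides of the claim are 0 for j = 0. R is the mirror image.\<close>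
    have L: "of_real s * of_nat (Suc i) * coeff (pn n f) (Suc i)
        = of_real s * of_nat j * cf f (Suc i) (j - 1) / (fact i * fact j)"
    proof (cases j)
      case (Suc l)
      have "(of_nat (Suc i) :: complex) \<noteq> 0" "(of_nat (Suc l) :: complex) \<noteq> 0" by (simp_all only: of_nat_eq_0_iff)
      then show ?thesis unfolding coeff_pn n Suc fact_Suc of_nat_mult by (simp del: of_nat_Suc add: field_simps)
    qed (simp add: coeff_pn n)
    have R: "(if i = 0 then 0 else of_real s * (of_nat n - of_nat (i - 1)) * coeff (pn n f) (i - 1))
        = of_real s * of_nat i * cf f (i - 1) (Suc j) / (fact i * fact j)"
    proof (cases i)
      case (Suc l)
      have *: "(of_nat n - of_nat (i - 1) :: complex) = of_nat (Suc j)" unfolding n Suc by simp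
      have "(if i = 0 then 0 else of_real s * (of_nat n - of_nat (i - 1)) * coeff (pn n f) (i - 1))
          = of_real s * of_nat (Suc j) * (cf f l (Suc j) / (fact l * fact (Suc j)))"
        unfolding * by (simp add: coeff_pn n Suc Suc_diff_le)
      moreover have "(of_nat (Suc l) :: complex) \<noteq> 0" "(of_nat (Suc j) :: complex) \<noteq> 0"
        by (simp_all only: of_nat_eq_0_iff)
      ultimately show ?thesis unfolding Suc fact_Suc of_nat_mult by (simp del: of_nat_Suc add: field_simps)
    qed simp
    have "coeff (pn n g) i = cf g i j / (fact i * fact j)"
      using True by (simp add: coeff_pn j_def)
    also have "\<dots> = of_nat i * coeff (pn n f) i - of_real s * of_nat j * cf f (Suc i) (j - 1) / (fact i * fact j)
        + of_real s * of_nat i * cf f (i - 1) (Suc j) / (fact i * fact j)"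
      unfolding K_graph_cf[OF assms] using True by (simp add: coeff_pn j_def diff_divide_distrib algebra_simps add_divide_distrib)
    finally show ?thesis unfolding coeff_Kpoly L R .
  qed
qed

text \<open>For the converse, the identity on each level is summed over the Hermite expansion: for a
  fixed test function both pairings are continuous in the L2 argument, so the distributional
  equation follows.\<close>

lemma K_graph_iff: "K_graph a f g \<longleftrightarrow> (\<forall>n. pn n g = Kpoly n (pn n f))"
proof (intro iffI allI K_graph_imp_pn)
  assume *: "\<forall>n. pn n g = Kpoly n (pn n f)"
  show "K_graph a f g"
    unfolding K_graph_dist_of
  proof
    fix \<phi> assume \<phi>: "\<phi> \<in> test_functions"
    note sq = compact_supp_integrable(2)[OF compact_supp_Kt[OF \<phi>]] compact_supp_integrable(2)[OF compact_supp_test[OF \<phi>]]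
    have "(\<lambda>n. dist_of (Jn n (pn n f)) (Kt a \<phi>)) sums dist_of f (Kt a \<phi>)"
      by (rule bounded_linear.sums[OF bounded_linear_dist_of[OF sq(1)] expansion_sums])
    moreover have "(\<lambda>n. dist_of (Jn n (pn n g)) \<phi>) sums dist_of g \<phi>"
      by (rule bounded_linear.sums[OF bounded_linear_dist_of[OF sq(2)] expansion_sums])
    ultimately show "dist_of f (Kt a \<phi>) = dist_of g \<phi>"
      unfolding dist_of_Jn_Kt[OF \<phi> degree_pn] using * by (simp add: sums_iff)
  qed
qed simp

end

lemma bounded_linear_scaleC_left: "bounded_linear (\<lambda>c. c *\<^sub>C x)"
  by (rule bounded_linear_intro[where K = "norm x"])
    (simp_all add: L2.scale_left_distrib norm_scaleC scaleR_scaleC scaleR_conv_of_real)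

lemma norm_diff_le_vector_derivative:
  fixes f :: "real \<Rightarrow> 'a :: real_normed_vector"
  assumes "\<And>t. (f has_vector_derivative f' t) (at t)" "\<And>t. 0 \<le> t \<Longrightarrow> t \<le> T \<Longrightarrow> norm (f' t) \<le> B" "T \<ge> 0"
  shows "norm (f T - f 0) \<le> B * T"
proof -
  have "norm (f T - f 0) \<le> B * norm (T - 0)"
  proof (rule differentiable_bound[of "{0..T}" f "\<lambda>t h. h *\<^sub>R f' t"])
    fix t assume t: "t \<in> {0..T}"
    show "(f has_derivative (\<lambda>h. h *\<^sub>R f' t)) (at t within {0..T})"
      using assms(1)[of t] by (auto simp: has_vector_derivative_def intro: has_derivative_at_withinI)
    show "onorm (\<lambda>h. h *\<^sub>R f' t) \<le> B"
      using assms(2)[of t] t by (intro onorm_le) (auto simp: mult.commute[of B] intro: mult_left_mono)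
  qed (use assms in auto)
  then show ?thesis using assms by simp
qed

section \<open>Uniform resolvent bounds\<close>

context kfp
begin

lemma norm_Jn_fcalc:
  assumes "degree p \<le> n" "\<And>k. k \<le> n \<Longrightarrow> cmod (m k) \<le> M"
  shows "norm (Jn n (fcalc n m p)) \<le> M * (2 * cond1) ^ n * norm (Jn n p)"
  unfolding norm_Jn by (rule hsq_fcalc[OF assms])

lemma Jn_fcalc: "Jn n (fcalc n m p) = (\<Sum>k\<le>n. (m k * eigcoef n p k) *\<^sub>C Jn n (eigpoly n k))"
  by (simp add: fcalc_def Jn_sum Jn_smult)

lemma Jn_fcalc_exp_derivative:
  "((\<lambda>t. Jn n (fcalc n (\<lambda>k. exp (of_real t * c k)) p)) has_vector_derivative
     Jn n (fcalc n (\<lambda>k. c k * exp (of_real t * c k)) p)) (at t)"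
  unfolding Jn_fcalc
proof (intro has_vector_derivative_sum bounded_linear.has_vector_derivative[OF bounded_linear_scaleC_left])
  fix k
  have "((\<lambda>z. exp (z * c k) * eigcoef n p k) has_field_derivative c k * exp (of_real t * c k) * eigcoef n p k) (at (of_real t))"
    by (auto intro!: derivative_eq_intros)
  then show "((\<lambda>t. exp (of_real t * c k) * eigcoef n p k) has_vector_derivative c k * exp (of_real t * c k) * eigcoef n p k) (at t)"
    by (rule has_vector_derivative_real_field)
qed

lemma Kpoly_accretive_Jn: "degree p \<le> n \<Longrightarrow> 0 \<le> Jn n (Kpoly n p) \<bullet> Jn n p"
  unfolding inner_Jn_same by (rule Kpoly_accretive)

lemma fcalc_semigroup_contraction:
  assumes p: "degree p \<le> n" and t: "t \<ge> 0"
  shows "norm (Jn n (fcalc n (\<lambda>k. exp (of_real t * - lam n k)) p)) \<le> norm (Jn n p)"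
proof -
  define U where "U t = Jn n (fcalc n (\<lambda>k. exp (of_real t * - lam n k)) p)" for t
  have d: "(U has_vector_derivative - Jn n (Kpoly n (fcalc n (\<lambda>k. exp (of_real t * - lam n k)) p))) (at t)" for t
  proof -
    have "Jn n (fcalc n (\<lambda>k. - lam n k * exp (of_real t * - lam n k)) p)
        = - Jn n (Kpoly n (fcalc n (\<lambda>k. exp (of_real t * - lam n k)) p))"
      unfolding Kpoly_fcalc[OF degree_fcalc] fcalc_fcalc Jn_fcalc by (simp add: sum_negf)
    with Jn_fcalc_exp_derivative[of n "\<lambda>k. - lam n k" p t] show ?thesis by (simp add: U_def[abs_def])
  qed
  have "U t \<bullet> U t \<le> U 0 \<bullet> U 0"
  proof (rule DERIV_nonpos_imp_nonincreasing[OF t])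
    fix x
    let ?k = "Jn n (Kpoly n (fcalc n (\<lambda>k. exp (of_real x * - lam n k)) p)) \<bullet> U x"
    from bounded_bilinear.has_vector_derivative[OF bounded_bilinear_inner d[of x] d[of x]]
    have "((\<lambda>t. U t \<bullet> U t) has_real_derivative - 2 * ?k) (at x)"
      by (simp add: has_real_derivative_iff_has_vector_derivative inner_commute)
    moreover have "- 2 * ?k \<le> 0" using Kpoly_accretive_Jn[OF degree_fcalc, of n] by (simp add: U_def)
    ultimately show "\<exists>y. ((\<lambda>t. U t \<bullet> U t) has_real_derivative y) (at x) \<and> y \<le> 0" by blast
  qed
  then have "norm (U t) \<le> norm (U 0)" by (simp add: norm_eq_sqrt_inner)
  then show ?thesis by (simp add: U_def fcalc_1[OF p])
qed

definition kappa :: real where "kappa = min (Re mp) (Re mm)"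

lemma kappa_pos: "kappa > 0" by (simp add: kappa_def Re_mp Re_mm)

lemma Re_lam: "k \<le> n \<Longrightarrow> real n * kappa \<le> Re (lam n k)"
proof -
  assume k: "k \<le> n"
  have "real n * kappa = real k * kappa + real (n - k) * kappa"
    using k by (simp add: of_nat_diff algebra_simps)
  also have "\<dots> \<le> real k * Re mp + real (n - k) * Re mm"
    by (intro add_mono mult_left_mono) (auto simp: kappa_def)
  finally show ?thesis by (simp add: lam_def)
qed

lemma fcalc_scale: "fcalc n (\<lambda>k. c * m k) p = smult c (fcalc n m p)"
  by (simp add: fcalc_def smult_sum_right mult_ac)

lemma fcalc_exp_shift:
  "fcalc n (\<lambda>k. exp (of_real t * (w - lam n k))) p
    = smult (exp (of_real t * w)) (fcalc n (\<lambda>k. exp (of_real t * - lam n k)) p)"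
  unfolding fcalc_scale[symmetric] by (simp add: exp_add[symmetric] algebra_simps)

text \<open>The constant and the level depend on r alone. No distance from w to the eigenvalues
  appears, because on these levels the estimate itself excludes eigenvalues with real part at most
  r.\<close>

lemma shifted_lower_bound:
  "\<exists>n0 C. C \<ge> 0 \<and> (\<forall>n\<ge>n0. \<forall>w p. Re w \<le> r \<longrightarrow> degree p \<le> n \<longrightarrow>
      norm (Jn n p) \<le> C * norm (Jn n (Kpoly n p - smult w p)))"
proof -
  \<comment> \<open>By time \<open>T\<close> the decay \<open>exp (- n kappa T)\<close> has beaten the condition number of the eigenbasis,
    so the semigroup has norm at most \<open>2\<^sup>-\<^sup>n\<close> on level \<open>n\<close>.\<close>
  define T where "T = ln (4 * cond1 + 1) / kappa"
  have T: "T \<ge> 0" using cond1_nonneg kappa_pos by (simp add: T_def)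
  have e1: "exp (- kappa * T) = inverse (4 * cond1 + 1)"
    using cond1_nonneg kappa_pos by (simp add: T_def exp_minus)
  have half: "exp (- kappa * T) * (2 * cond1) \<le> 1 / 2"
    unfolding e1 using cond1_nonneg by (simp add: field_simps)
  \<comment> \<open>Bounds exp (t w) on [0, T] for all w with Re w <= r at once; the absolute value
    covers negative r.\<close>
  define E where "E = exp (\<bar>r\<bar> * T)"
  have E: "E > 0" by (simp add: E_def)
  \<comment> \<open>From this level on E / 2^n is at most 1/2, so the value at time T is absorbed
    into the left-hand side and the constant 2 E T remains.\<close>
  obtain n0 where n0: "(1 / 2) ^ n0 < 1 / (2 * E)"
    using real_arch_pow_inv[of "1 / (2 * E)" "1 / 2"] E by auto
  have "norm (Jn n p) \<le> (2 * (E * T)) * norm (Jn n (Kpoly n p - smult w p))"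
    if n: "n \<ge> n0" and w: "Re w \<le> r" and p: "degree p \<le> n" for n w p
  proof -
    define g where "g = Kpoly n p - smult w p"
    have g: "g = fcalc n (\<lambda>k. lam n k - w) p" by (simp add: g_def Kpoly_shift_fcalc[OF p])
    define W where "W t = Jn n (fcalc n (\<lambda>k. exp (of_real t * (w - lam n k))) p)" for t
    have ew: "cmod (exp (of_real t * w)) \<le> E" if "0 \<le> t" "t \<le> T" for t
    proof -
      have "t * Re w \<le> t * \<bar>r\<bar>" using w that by (intro mult_left_mono) auto
      also have "\<dots> \<le> T * \<bar>r\<bar>" using that by (intro mult_right_mono) auto
      finally show ?thesis by (simp add: E_def mult.commute)
    qed
    have d: "(W has_vector_derivative - (exp (of_real t * w) *\<^sub>C Jn n (fcalc n (\<lambda>k. exp (of_real t * - lam n k)) g))) (at t)" for t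
    proof -
      have "fcalc n (\<lambda>k. (w - lam n k) * exp (of_real t * (w - lam n k))) p
          = fcalc n (\<lambda>k. exp (of_real t * (w - lam n k))) (smult (- 1) g)"
        unfolding g fcalc_scale[symmetric] fcalc_fcalc by (intro fcalc_cong) (simp add: algebra_simps)
      also have "\<dots> = smult (- exp (of_real t * w)) (fcalc n (\<lambda>k. exp (of_real t * - lam n k)) g)"
        unfolding fcalc_exp_shift fcalc_smult by simp
      finally have "Jn n (fcalc n (\<lambda>k. (w - lam n k) * exp (of_real t * (w - lam n k))) p)
          = - (exp (of_real t * w) *\<^sub>C Jn n (fcalc n (\<lambda>k. exp (of_real t * - lam n k)) g))"
        by (simp only: Jn_smult L2.scale_minus_left)
      with Jn_fcalc_exp_derivative[of n "\<lambda>k. w - lam n k" p t] show ?thesis by (simp add: W_def[abs_def])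
    qed
    have "norm (W T - W 0) \<le> (E * norm (Jn n g)) * T"
    proof (rule norm_diff_le_vector_derivative[OF d _ T])
      fix t assume t: "0 \<le> t" "t \<le> T"
      show "norm (- (exp (of_real t * w) *\<^sub>C Jn n (fcalc n (\<lambda>k. exp (of_real t * - lam n k)) g))) \<le> E * norm (Jn n g)"
        unfolding norm_minus_cancel norm_scaleC
        using E by (intro mult_mono ew t fcalc_semigroup_contraction) (simp_all add: g degree_fcalc)
    qed
    moreover have "W 0 = Jn n p" by (simp add: W_def fcalc_1[OF p])
    moreover have "norm (W T) \<le> 1 / 2 * norm (Jn n p)"
    proof -
      have "norm (W T) = cmod (exp (of_real T * w)) * norm (Jn n (fcalc n (\<lambda>k. exp (of_real T * - lam n k)) p))"
        unfolding W_def fcalc_exp_shift Jn_smult norm_scaleC ..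
      also have "\<dots> \<le> E * (exp (- kappa * T) ^ n * (2 * cond1) ^ n * norm (Jn n p))"
      proof (intro mult_mono ew norm_Jn_fcalc[OF p] T order.refl)
        fix k assume k: "k \<le> n"
        have "T * (real n * kappa) \<le> T * Re (lam n k)" using Re_lam[OF k] T by (intro mult_left_mono) auto
        then show "cmod (exp (of_real T * - lam n k)) \<le> exp (- kappa * T) ^ n"
          by (simp add: exp_of_nat_mult[symmetric] mult_ac)
      qed (use E in auto)
      also have "\<dots> = E * ((exp (- kappa * T) * (2 * cond1)) ^ n) * norm (Jn n p)"
        by (simp only: power_mult_distrib mult_ac)
      also have "\<dots> \<le> E * ((1 / 2) ^ n) * norm (Jn n p)"
        using E half cond1_nonneg by (intro mult_right_mono mult_left_mono power_mono) auto
      also have "\<dots> \<le> E * ((1 / 2) ^ n0) * norm (Jn n p)"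
        using E n by (intro mult_right_mono mult_left_mono power_decreasing) auto
      also have "\<dots> \<le> 1 / 2 * norm (Jn n p)"
        using n0 E by (intro mult_right_mono) (auto simp: field_simps)
      finally show ?thesis .
    qed
    moreover have "norm (W 0) \<le> norm (W T - W 0) + norm (W T)"
      using norm_triangle_ineq4[of "W T" "W T - W 0"] by simp
    ultimately have "norm (Jn n p) \<le> 2 * ((E * norm (Jn n g)) * T)" by simp
    then show ?thesis by (simp add: g_def mult_ac)
  qed
  moreover have "2 * (E * T) \<ge> 0" using E T by simp
  ultimately show ?thesis by blast
qed

definition reso :: "complex \<Rightarrow> nat \<Rightarrow> complex poly \<Rightarrow> complex poly" where
  "reso w n = fcalc n (\<lambda>k. 1 / (lam n k - w))"

text \<open>On high levels the lower bound is applied to the vector \<open>reso w n p\<close>. On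
  the finitely many levels below \<open>n0\<close> the eigenbasis estimate is enough, with
  multipliers at most 1 / \<delta>.\<close>

lemma resolvent_bound:
  assumes \<delta>: "\<delta> > 0"
  shows "\<exists>C\<ge>0. \<forall>w. Re w \<le> r \<longrightarrow> (\<forall>n. \<forall>k\<le>n. \<delta> \<le> cmod (lam n k - w)) \<longrightarrow>
     (\<forall>n p. degree p \<le> n \<longrightarrow> norm (Jn n (reso w n p)) \<le> C * norm (Jn n p))"
proof -
  obtain n0 C where C: "C \<ge> 0" and bd: "\<And>n w p. n \<ge> n0 \<Longrightarrow> Re w \<le> r \<Longrightarrow> degree p \<le> n \<Longrightarrow>
      norm (Jn n p) \<le> C * norm (Jn n (Kpoly n p - smult w p))"
    using shifted_lower_bound[of r] by metis
  \<comment> \<open>The base 1 + 2 cond1 is at least 1, so its power \<open>n0\<close> dominates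
    \<open>(2 * cond1) ^ n\<close> for all n < n0.\<close>
  define C1 where "C1 = 1 / \<delta> * (1 + 2 * cond1) ^ n0"
  have C1: "C1 \<ge> 0" using \<delta> cond1_nonneg by (simp add: C1_def)
  have "norm (Jn n (reso w n p)) \<le> (C + C1) * norm (Jn n p)"
    if w: "Re w \<le> r" and sep: "\<forall>n. \<forall>k\<le>n. \<delta> \<le> cmod (lam n k - w)" and p: "degree p \<le> n" for w n p
  proof (cases "n \<ge> n0")
    case True
    have nz: "lam n k - w \<noteq> 0" if "k \<le> n" for k
      using sep \<delta> that by (metis norm_zero not_le)
    have "Kpoly n (reso w n p) - smult w (reso w n p) = fcalc n (\<lambda>_. 1) p"
      unfolding reso_def Kpoly_shift_fcalc[OF degree_fcalc] fcalc_fcalc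
      by (intro fcalc_cong) (use nz in auto)
    then have "Kpoly n (reso w n p) - smult w (reso w n p) = p" by (simp add: fcalc_1[OF p])
    with bd[OF True w, of "reso w n p"] have "norm (Jn n (reso w n p)) \<le> C * norm (Jn n p)"
      by (simp add: reso_def degree_fcalc)
    also have "\<dots> \<le> (C + C1) * norm (Jn n p)" using C1 by (intro mult_right_mono) auto
    finally show ?thesis .
  next
    case False
    have "norm (Jn n (reso w n p)) \<le> 1 / \<delta> * (2 * cond1) ^ n * norm (Jn n p)"
      unfolding reso_def
    proof (rule norm_Jn_fcalc[OF p])
      fix k assume "k \<le> n"
      then show "cmod (1 / (lam n k - w)) \<le> 1 / \<delta>"
        using sep \<delta> by (auto simp: norm_divide intro!: divide_left_mono mult_pos_pos intro: less_le_trans)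
    qed
    also have "(2 * cond1) ^ n \<le> (1 + 2 * cond1) ^ n0"
      using power_mono[of "2 * cond1" "1 + 2 * cond1" n] power_increasing[of n n0 "1 + 2 * cond1"]
        False cond1_nonneg by simp
    then have "1 / \<delta> * (2 * cond1) ^ n * norm (Jn n p) \<le> C1 * norm (Jn n p)"
      unfolding C1_def using \<delta> by (intro mult_right_mono mult_left_mono) auto
    also have "\<dots> \<le> (C + C1) * norm (Jn n p)" using C by (intro mult_right_mono) auto
    finally show ?thesis .
  qed
  then show ?thesis using C C1 by (intro exI[of _ "C + C1"]) auto
qed

section \<open>The resolvent and the spectrum\<close>

lemma K_graph_unique: "K_graph a f g \<Longrightarrow> K_graph a f g' \<Longrightarrow> g = g'"
  by (rule pn_eq_imp_eq) (simp add: K_graph_iff)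

lemma K_op_graph: "K_graph a f g \<Longrightarrow> f \<in> fst (K_op a) \<and> snd (K_op a) f = g"
  unfolding K_op_def by (auto intro!: the_equality intro: K_graph_unique)

lemma K_op_domain: "f \<in> fst (K_op a) \<Longrightarrow> K_graph a f (snd (K_op a) f)"
  using K_op_graph by (auto simp: K_op_def)

definition Rop :: "complex \<Rightarrow> L2 \<Rightarrow> L2" where
  "Rop w f = (\<Sum>n. Jn n (reso w n (pn n f)))"

lemma Rop_props:
  assumes C: "C \<ge> 0" and bd: "\<And>n p. degree p \<le> n \<Longrightarrow> norm (Jn n (reso w n p)) \<le> C * norm (Jn n p)"
  shows "pn n (Rop w f) = reso w n (pn n f)" "norm (Rop w f) \<le> C * norm f" "bounded_linear (Rop w)"
proof -
  have le: "(norm (Jn n (reso w n (pn n f))))\<^sup>2 \<le> C\<^sup>2 * (norm (Jn n (pn n f)))\<^sup>2" for n f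
    unfolding power_mult_distrib[symmetric] by (intro power_mono bd degree_pn) auto
  have sm: "summable (\<lambda>n. (norm (Jn n (reso w n (pn n f))))\<^sup>2)" for f
    by (rule summable_comparison_test'[OF summable_mult[OF bessel(1)], where N = 0]) (use le in auto)
  have pR: "pn n (Rop w f) = reso w n (pn n f)" for n f
    unfolding Rop_def by (rule pn_suminf_Jn[OF sm]) (simp add: reso_def degree_fcalc)
  then show "pn n (Rop w f) = reso w n (pn n f)" .
  have nR: "norm (Rop w f) \<le> C * norm f" for f
  proof -
    have "(norm (Rop w f))\<^sup>2 = (\<Sum>n. (norm (Jn n (reso w n (pn n f))))\<^sup>2)"
      unfolding parseval[of "Rop w f"] pR ..
    also have "\<dots> \<le> (\<Sum>n. C\<^sup>2 * (norm (Jn n (pn n f)))\<^sup>2)"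
      by (intro suminf_le le sm summable_mult bessel(1))
    also have "\<dots> = (C * norm f)\<^sup>2"
      unfolding power_mult_distrib parseval[of f] by (rule suminf_mult[OF bessel(1)])
    finally show ?thesis using C by (auto intro: power2_le_imp_le)
  qed
  then show "norm (Rop w f) \<le> C * norm f" .
  show "bounded_linear (Rop w)"
  proof (rule bounded_linear_intro[where K = C])
    show "Rop w (f + g) = Rop w f + Rop w g" for f g
      by (rule pn_eq_imp_eq) (simp add: pR pn_add reso_def fcalc_add)
    show "Rop w (c *\<^sub>R f) = c *\<^sub>R Rop w f" for c f
      by (rule pn_eq_imp_eq) (simp add: pR pn_scaleC scaleR_scaleC reso_def fcalc_smult)
    show "norm (Rop w f) \<le> norm f * C" for f using nR by (simp add: mult.commute)
  qed
qed

section \<open>Discreteness of the eigenvalues and construction of the resolvent\<close>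

definition eigs :: "complex set" where "eigs = {lam n k |n k. k \<le> n}"

lemma finite_eigs_le: "finite {(n, k). k \<le> n \<and> Re (lam n k) \<le> r}"
proof (rule finite_subset)
  show "{(n, k). k \<le> n \<and> Re (lam n k) \<le> r} \<subseteq> {..nat \<lfloor>r / kappa\<rfloor>} \<times> {..nat \<lfloor>r / kappa\<rfloor>}"
  proof clarify
    fix n k assume k: "k \<le> n" and "Re (lam n k) \<le> r"
    then have "real n * kappa \<le> r" using Re_lam order.trans by blast
    then have "real n \<le> r / kappa" using kappa_pos by (simp add: field_simps)
    then have "n \<le> nat \<lfloor>r / kappa\<rfloor>" by (simp add: le_nat_floor)
    then show "n \<in> {..nat \<lfloor>r / kappa\<rfloor>} \<and> k \<in> {..nat \<lfloor>r / kappa\<rfloor>}" using k by auto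
  qed
qed simp

text \<open>Only finitely many eigenvalues have real part at most Re w + 1; all others are at
  distance at least 1. Leaving out w itself lets the lemma serve both off the spectrum and at an
  eigenvalue.\<close>

lemma eigs_discrete: "\<exists>\<delta>>0. \<forall>n. \<forall>k\<le>n. lam n k \<noteq> w \<longrightarrow> \<delta> \<le> cmod (lam n k - w)"
proof -
  let ?S = "(\<lambda>(n, k). lam n k) ` {(n, k). k \<le> n \<and> Re (lam n k) \<le> Re w + 1}"
  have "finite ?S" by (intro finite_imageI finite_eigs_le)
  then obtain d where d: "d > 0" "\<And>x. x \<in> ?S \<Longrightarrow> x \<noteq> w \<Longrightarrow> d \<le> dist w x"
    using finite_set_avoid[of ?S w] by blast
  have "min d 1 \<le> cmod (lam n k - w)" if "k \<le> n" "lam n k \<noteq> w" for n k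
  proof (cases "Re (lam n k) \<le> Re w + 1")
    case True
    then have "lam n k \<in> ?S" using that by auto
    then show ?thesis using d(2)[of "lam n k"] that by (simp add: dist_norm norm_minus_commute)
  next
    case False
    then have "1 \<le> Re (lam n k - w)" by simp
    also have "\<dots> \<le> cmod (lam n k - w)" by (rule complex_Re_le_cmod)
    finally show ?thesis by simp
  qed
  then show ?thesis using d(1) by (intro exI[of _ "min d 1"]) auto
qed

lemma is_resolvent_Rop:
  assumes C: "C \<ge> 0" and bd: "\<And>n p. degree p \<le> n \<Longrightarrow> norm (Jn n (reso w n p)) \<le> C * norm (Jn n p)"
    and w: "w \<notin> eigs"
  shows "is_resolvent (K_op a) w (Blinfun (Rop w))"
proof -
  note R = Rop_props[OF C bd]
  have nz: "lam n k - w \<noteq> 0" if "k \<le> n" for n k using w that by (auto simp: eigs_def)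
  have app: "blinfun_apply (Blinfun (Rop w)) = Rop w" by (rule bounded_linear_Blinfun_apply[OF R(3)])
  have r1: "Kpoly n (reso w n p) = p + smult w (reso w n p)" if "degree p \<le> n" for n p
  proof -
    have "Kpoly n (reso w n p) - smult w (reso w n p) = fcalc n (\<lambda>_. 1) p"
      unfolding reso_def Kpoly_shift_fcalc[OF degree_fcalc] fcalc_fcalc by (intro fcalc_cong) (use nz in auto)
    then show ?thesis using fcalc_1[OF that] by (simp add: diff_eq_eq)
  qed
  have r2: "reso w n (Kpoly n p - smult w p) = p" if "degree p \<le> n" for n p
  proof -
    have "reso w n (Kpoly n p - smult w p) = fcalc n (\<lambda>_. 1) p"
      unfolding reso_def Kpoly_shift_fcalc[OF that] fcalc_fcalc by (intro fcalc_cong) (use nz in auto)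
    then show ?thesis using fcalc_1[OF that] by simp
  qed
  have g: "K_graph a (Rop w g) (g + w *\<^sub>C Rop w g)" for g
    unfolding K_graph_iff by (simp add: pn_add pn_scaleC R(1) r1 degree_pn)
  have "Rop w (snd (K_op a) f - w *\<^sub>C f) = f" if "f \<in> fst (K_op a)" for f
  proof (rule pn_eq_imp_eq)
    fix n
    have "pn n (snd (K_op a) f) = Kpoly n (pn n f)"
      using K_op_domain[OF that] by (simp add: K_graph_iff)
    moreover have "pn n (snd (K_op a) f - w *\<^sub>C f) = pn n (snd (K_op a) f) - smult w (pn n f)"
      using pn_add[of n "snd (K_op a) f - w *\<^sub>C f" "w *\<^sub>C f"] by (simp add: pn_scaleC)
    ultimately show "pn n (Rop w (snd (K_op a) f - w *\<^sub>C f)) = pn n f"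
      by (simp add: R(1) r2 degree_pn)
  qed
  then show ?thesis
    unfolding is_resolvent_def app using K_op_graph[OF g] by auto
qed

lemma is_resolvent_unique: "is_resolvent A w R \<Longrightarrow> is_resolvent A w R' \<Longrightarrow> R = R'"
  unfolding is_resolvent_def by (rule blinfun_eqI) metis

text \<open>The bound depends only on r and \<delta>, so a single constant covers a whole circle
  around an eigenvalue.\<close>

lemma resolvent_uniform:
  assumes \<delta>: "\<delta> > 0"
  shows "\<exists>C\<ge>0. \<forall>w. Re w \<le> r \<longrightarrow> (\<forall>n. \<forall>k\<le>n. \<delta> \<le> cmod (lam n k - w)) \<longrightarrow>
     is_resolvent (K_op a) w (resolvent (K_op a) w) \<and> norm (resolvent (K_op a) w) \<le> C"
proof -
  obtain C where C: "C \<ge> 0" and bd: "\<And>w n p. Re w \<le> r \<Longrightarrow> (\<forall>n. \<forall>k\<le>n. \<delta> \<le> cmod (lam n k - w)) \<Longrightarrow>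
     degree p \<le> n \<Longrightarrow> norm (Jn n (reso w n p)) \<le> C * norm (Jn n p)"
    using resolvent_bound[OF \<delta>, of r] by metis
  have "is_resolvent (K_op a) w (resolvent (K_op a) w) \<and> norm (resolvent (K_op a) w) \<le> C"
    if w: "Re w \<le> r" "\<forall>n. \<forall>k\<le>n. \<delta> \<le> cmod (lam n k - w)" for w
  proof -
    have "w \<notin> eigs" using w(2) \<delta> by (force simp: eigs_def)
    then have R: "is_resolvent (K_op a) w (Blinfun (Rop w))"
      using bd[OF w] by (intro is_resolvent_Rop[OF C]) auto
    then have eq: "resolvent (K_op a) w = Blinfun (Rop w)"
      unfolding resolvent_def by (rule the_equality) (rule is_resolvent_unique[OF _ R])
    have "norm (Blinfun (Rop w)) \<le> C"
      using Rop_props(2,3)[OF C bd[OF w]] C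
      by (intro norm_blinfun_bound) (simp_all add: bounded_linear_Blinfun_apply)
    with R eq show ?thesis by simp
  qed
  then show ?thesis using C by blast
qed

section \<open>Eigenvectors and identification of the spectrum\<close>

definition eigvec :: "nat \<Rightarrow> nat \<Rightarrow> L2" where "eigvec n k = Jn n (eigpoly n k)"

lemma pn_eigvec: "k \<le> n \<Longrightarrow> pn m (eigvec n k) = (if m = n then eigpoly n k else 0)"
  using pn_Jn_same[OF degree_eigpoly, of k n] pn_Jn[of m n "eigpoly n k"]
  by (cases "m = n") (simp_all only: eigvec_def if_True if_False simp_thms)

lemma eigpoly_nonzero: "eigpoly n k \<noteq> 0"
  using s_pos by (simp add: eigpoly_def)

lemma eigvec_nonzero: "k \<le> n \<Longrightarrow> eigvec n k \<noteq> 0"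
  using pn_eigvec[of k n n] eigpoly_nonzero[of n k] pn_add[of n 0 0] by auto

lemma K_graph_eigvec: "k \<le> n \<Longrightarrow> K_graph a (eigvec n k) (lam n k *\<^sub>C eigvec n k)"
proof -
  have "Kpoly m 0 = 0" for m by (simp add: Kpoly_def)
  then show "k \<le> n \<Longrightarrow> K_graph a (eigvec n k) (lam n k *\<^sub>C eigvec n k)"
    unfolding K_graph_iff by (simp add: pn_scaleC pn_eigvec Kpoly_eigpoly)
qed

lemma spectrum_K_op: "spectrum (K_op a) = eigs"
proof (intro equalityI subsetI)
  fix w assume w: "w \<in> eigs"
  then obtain n k where k: "k \<le> n" and w: "w = lam n k" by (auto simp: eigs_def)
  have "\<not> is_resolvent (K_op a) w R" for R
  proof
    assume R: "is_resolvent (K_op a) w R"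
    have "eigvec n k \<in> fst (K_op a)" "snd (K_op a) (eigvec n k) - w *\<^sub>C eigvec n k = 0"
      using K_op_graph[OF K_graph_eigvec[OF k]] w by auto
    with R have "blinfun_apply R 0 = eigvec n k" unfolding is_resolvent_def by metis
    then show False using eigvec_nonzero[OF k] by (simp add: blinfun.zero_right)
  qed
  then show "w \<in> spectrum (K_op a)" by (simp add: spectrum_def)
next
  fix w assume w: "w \<in> spectrum (K_op a)"
  show "w \<in> eigs"
  proof (rule ccontr)
    assume "w \<notin> eigs"
    then have ne: "lam n k \<noteq> w" if "k \<le> n" for n k using that by (auto simp: eigs_def)
    obtain \<delta> where \<delta>: "\<delta> > 0" "\<forall>n. \<forall>k\<le>n. \<delta> \<le> cmod (lam n k - w)"
      using eigs_discrete[of w] ne by metis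
    from resolvent_uniform[OF \<delta>(1), of "Re w"] \<delta>(2) w show False
      by (auto simp: spectrum_def)
  qed
qed

end

section \<open>Riesz projectors and multiplicities\<close>

lemma scale_blinfun_apply: "blinfun_apply (scale_blinfun c R) f = c *\<^sub>C blinfun_apply R f"
  by (simp add: scale_blinfun_def bounded_linear_Blinfun_apply[OF bounded_linear_scaleC])

lemma bounded_bilinear_scale_blinfun: "bounded_bilinear scale_blinfun"
proof
  show "scale_blinfun (c + d) R = scale_blinfun c R + scale_blinfun d R" for c d R
    by (rule blinfun_eqI) (simp add: scale_blinfun_apply blinfun.add_left L2.scale_left_distrib)
  show "scale_blinfun c (R + S) = scale_blinfun c R + scale_blinfun c S" for c R S
    by (rule blinfun_eqI) (simp add: scale_blinfun_apply blinfun.add_left L2.scale_right_distrib)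
  show "scale_blinfun (r *\<^sub>R c) R = r *\<^sub>R scale_blinfun c R" for r c R
    by (rule blinfun_eqI) (simp add: scale_blinfun_apply blinfun.scaleR_left scaleR_scaleC scaleR_conv_of_real)
  show "scale_blinfun c (r *\<^sub>R R) = r *\<^sub>R scale_blinfun c R" for r c R
    by (rule blinfun_eqI) (simp add: scale_blinfun_apply blinfun.scaleR_left scaleR_scaleC mult.commute)
  have "norm (scale_blinfun c R) \<le> norm c * norm R * 1" for c R
  proof (rule norm_blinfun_bound)
    fix f
    show "norm (blinfun_apply (scale_blinfun c R) f) \<le> norm c * norm R * 1 * norm f"
      using mult_left_mono[OF norm_blinfun[of R f], of "cmod c"]
      by (simp add: scale_blinfun_apply norm_scaleC mult.assoc)
  qed simp
  then show "\<exists>K. \<forall>c R. norm (scale_blinfun c R) \<le> norm c * norm R * K" by blast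
qed

text \<open>An explicit primitive: with u = \<epsilon> exp (i t) / d the integrand is i u / (1 - u),
  the derivative of - Ln (1 - u). As |u| < 1, the value 1 - u stays in the right half plane, away
  from the branch cut, and the primitive is 2 pi periodic.\<close>

lemma circle_integral_outside:
  assumes \<epsilon>: "\<epsilon> > 0" and d: "\<epsilon> < cmod d"
  shows "((\<lambda>t. \<i> * of_real \<epsilon> * cis t / (d - of_real \<epsilon> * cis t)) has_integral 0) {0..2 * pi}"
proof -
  define f where "f z = - Ln (1 - of_real \<epsilon> * exp (\<i> * z) / d)" for z :: complex
  have d0: "d \<noteq> 0" using \<epsilon> d by auto
  have D: "((\<lambda>t. f (of_real t)) has_vector_derivative \<i> * of_real \<epsilon> * cis t / (d - of_real \<epsilon> * cis t)) (at t within {0..2 * pi})" for t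
  proof (rule has_vector_derivative_real_field)
    define u where "u = of_real \<epsilon> * exp (\<i> * of_real t) / d"
    have "cmod u < 1"
      using \<epsilon> d less_trans[OF \<epsilon> d] by (simp add: u_def norm_mult norm_divide divide_less_eq_1_pos del: zero_less_norm_iff)
    then have "Re u < 1" using complex_Re_le_cmod[of u] by linarith
    then have nz: "1 - u \<notin> \<real>\<^sub>\<le>\<^sub>0" by (auto simp: complex_nonpos_Reals_iff)
    then have nz': "1 - u \<noteq> 0" by auto
    have "(f has_field_derivative - ((- (\<i> * u)) / (1 - u))) (at (of_real t))"
      unfolding f_def[abs_def] using nz nz' d0
      by (auto intro!: derivative_eq_intros simp: u_def) (simp add: divide_inverse mult_ac)
    moreover have "- ((- (\<i> * u)) / (1 - u)) = \<i> * of_real \<epsilon> * cis t / (d - of_real \<epsilon> * cis t)"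
    proof -
      have "1 - u = (d - of_real \<epsilon> * cis t) / d" using d0 by (simp add: u_def cis_conv_exp diff_divide_distrib)
      then show ?thesis using d0 by (simp add: u_def cis_conv_exp)
    qed
    ultimately show "(f has_field_derivative \<i> * of_real \<epsilon> * cis t / (d - of_real \<epsilon> * cis t)) (at (of_real t))"
      by simp
  qed
  have "((\<lambda>t. \<i> * of_real \<epsilon> * cis t / (d - of_real \<epsilon> * cis t)) has_integral (f (of_real (2 * pi)) - f (of_real 0))) {0..2 * pi}"
    by (rule fundamental_theorem_of_calculus[OF _ D]) simp
  moreover have "f (of_real (2 * pi)) = f (of_real 0)"
  proof -
    have "exp (\<i> * of_real (2 * pi)) = (1 :: complex)" using cis_2pi unfolding cis_conv_exp .
    then show ?thesis by (simp only: f_def of_real_0 mult_zero_right exp_zero)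
  qed
  ultimately show ?thesis by simp
qed

context kfp
begin

lemma K_graph_scaleC: "K_graph a f g \<Longrightarrow> K_graph a (c *\<^sub>C f) (c *\<^sub>C g)"
  unfolding K_graph_iff by (simp add: pn_scaleC Kpoly_smult)

lemma K_graph_add: "K_graph a f g \<Longrightarrow> K_graph a f' g' \<Longrightarrow> K_graph a (f + f') (g + g')"
  unfolding K_graph_iff by (simp add: pn_add Kpoly_add)

lemma resolvent_eigvec:
  assumes R: "is_resolvent (K_op a) w R" and y: "K_graph a y (\<nu> *\<^sub>C y)" and ne: "\<nu> \<noteq> w"
  shows "blinfun_apply R y = (1 / (\<nu> - w)) *\<^sub>C y"
proof -
  define x where "x = (1 / (\<nu> - w)) *\<^sub>C y"
  have "K_graph a x (\<nu> *\<^sub>C x)"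
    using K_graph_scaleC[OF y, of "1 / (\<nu> - w)"] by (simp add: x_def L2.scale_left_commute mult.commute)
  then have "blinfun_apply R (\<nu> *\<^sub>C x - w *\<^sub>C x) = x"
    using R K_op_graph unfolding is_resolvent_def by metis
  moreover have "\<nu> *\<^sub>C x - w *\<^sub>C x = ((\<nu> - w) * (1 / (\<nu> - w))) *\<^sub>C y"
    by (simp only: x_def L2.scale_scale L2.scale_left_diff_distrib[symmetric] left_diff_distrib)
  then have "\<nu> *\<^sub>C x - w *\<^sub>C x = y" using ne by simp
  ultimately show ?thesis by (simp add: x_def)
qed

text \<open>The first resolvent identity, R' - R = R (w' - w) R', evaluated on a vector. It yields
  norm continuity of the resolvent along the contour.\<close>

lemma resolvent_lipschitz:
  assumes "is_resolvent (K_op a) w R" "is_resolvent (K_op a) w' R'" "norm R \<le> C" "norm R' \<le> C" "C \<ge> 0"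
  shows "norm (R' - R) \<le> C * C * cmod (w' - w)"
proof (rule norm_blinfun_bound)
  fix g
  define f' where "f' = blinfun_apply R' g"
  have f': "f' \<in> fst (K_op a)" "snd (K_op a) f' - w' *\<^sub>C f' = g"
    using assms(2) by (auto simp: is_resolvent_def f'_def)
  have "f' = blinfun_apply R (snd (K_op a) f' - w *\<^sub>C f')"
    using assms(1) f'(1) by (auto simp: is_resolvent_def)
  also have "snd (K_op a) f' - w *\<^sub>C f' = g + (w' - w) *\<^sub>C f'"
    using f'(2) by (simp add: L2.scale_left_diff_distrib algebra_simps)
  finally have "blinfun_apply (R' - R) g = blinfun_apply R ((w' - w) *\<^sub>C f')"
    by (simp add: blinfun.diff_left f'_def[symmetric] blinfun.add_right diff_eq_eq add.commute)
  then have "norm (blinfun_apply (R' - R) g) \<le> norm R * (cmod (w' - w) * norm f')"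
    using norm_blinfun[of R "(w' - w) *\<^sub>C f'"] by (simp add: norm_scaleC)
  also have "\<dots> \<le> C * (cmod (w' - w) * (C * norm g))"
  proof (intro mult_mono mult_left_mono assms)
    have "norm f' \<le> norm R' * norm g" unfolding f'_def by (rule norm_blinfun)
    also have "\<dots> \<le> C * norm g" using assms by (intro mult_right_mono) auto
    finally show "norm f' \<le> C * norm g" .
  qed (use assms in auto)
  finally show "norm (blinfun_apply (R' - R) g) \<le> C * C * cmod (w' - w) * norm g" by (simp add: mult_ac)
qed (use assms in auto)

lemma circle_separated:
  assumes \<epsilon>: "\<epsilon> > 0" and sep: "cball z \<epsilon> \<inter> eigs \<subseteq> {z}"
  shows "\<exists>\<delta>>0. \<forall>w. cmod (w - z) = \<epsilon> \<longrightarrow> (\<forall>n. \<forall>k\<le>n. \<delta> \<le> cmod (lam n k - w))"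
proof -
  let ?S = "(\<lambda>(n, k). lam n k) ` {(n, k). k \<le> n \<and> Re (lam n k) \<le> Re z + \<epsilon> + 1} - {z}"
  define g where "g x = cmod (x - z) - \<epsilon>" for x
  have fin: "finite ?S" by (intro finite_Diff finite_imageI finite_eigs_le)
  have pos: "g x > 0" if "x \<in> ?S" for x
  proof -
    have "x \<in> eigs" "x \<noteq> z" using that by (auto simp: eigs_def)
    then have "x \<notin> cball z \<epsilon>" using sep by auto
    then show ?thesis by (simp add: g_def dist_norm norm_minus_commute)
  qed
  \<comment> \<open>The entry \<epsilon> accounts for z itself, 1 for eigenvalues with real part
    above Re z + \<epsilon> + 1, and the finite set of gaps for all the others.\<close>
  define \<delta> where "\<delta> = Min (insert (min 1 \<epsilon>) (g ` ?S))"
  have "\<delta> > 0" using fin pos \<epsilon> by (simp add: \<delta>_def)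
  have d1: "\<delta> \<le> min 1 \<epsilon>" unfolding \<delta>_def using fin by (intro Min_le) auto
  have d2: "\<delta> \<le> g x" if "x \<in> ?S" for x unfolding \<delta>_def using fin that by (intro Min_le) auto
  have "\<delta> \<le> cmod (lam n k - w)" if w: "cmod (w - z) = \<epsilon>" and k: "k \<le> n" for w n k
  proof (cases "lam n k = z")
    case True
    then show ?thesis using w d1 by (simp add: norm_minus_commute)
  next
    case ne: False
    show ?thesis
    proof (cases "Re (lam n k) \<le> Re z + \<epsilon> + 1")
      case True
      then have "lam n k \<in> ?S" using k ne by auto
      then have "\<delta> \<le> cmod (lam n k - z) - cmod (w - z)" using d2 w by (simp add: g_def)
      also have "\<dots> \<le> cmod (lam n k - w)" using norm_triangle_ineq2[of "lam n k - z" "w - z"] by simp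
      finally show ?thesis .
    next
      case False
      have "Re (w - z) \<le> \<epsilon>" using complex_Re_le_cmod[of "w - z"] w by simp
      then have "1 \<le> Re (lam n k - w)" using False by simp
      also have "\<dots> \<le> cmod (lam n k - w)" by (rule complex_Re_le_cmod)
      finally show ?thesis using d1 by simp
    qed
  qed
  then show ?thesis using \<open>\<delta> > 0\<close> by blast
qed

lemma riesz_projector_apply:
  assumes \<epsilon>: "\<epsilon> > 0" and sep: "cball z \<epsilon> \<inter> eigs \<subseteq> {z}"
    and y: "K_graph a y (\<nu> *\<^sub>C y)" and \<nu>: "\<nu> \<in> eigs"
  shows "blinfun_apply (riesz_projector (K_op a) z \<epsilon>) y = (if \<nu> = z then y else 0)"
proof -
  define w where "w t = z + of_real \<epsilon> * cis t" for t
  have wz: "cmod (w t - z) = \<epsilon>" for t using \<epsilon> by (simp add: w_def norm_mult)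
  have Rew: "Re (w t) \<le> Re z + \<epsilon>" for t using complex_Re_le_cmod[of "w t - z"] wz[of t] by simp
  obtain \<delta> where \<delta>: "\<delta> > 0" "\<And>w n k. cmod (w - z) = \<epsilon> \<Longrightarrow> k \<le> n \<Longrightarrow> \<delta> \<le> cmod (lam n k - w)"
    using circle_separated[OF \<epsilon> sep] by metis
  obtain C where C: "C \<ge> 0" and R: "\<And>t. is_resolvent (K_op a) (w t) (resolvent (K_op a) (w t))"
      "\<And>t. norm (resolvent (K_op a) (w t)) \<le> C"
    using resolvent_uniform[OF \<delta>(1), of "Re z + \<epsilon>"] Rew \<delta>(2)[OF wz] by metis
  have w_cont: "continuous_on A w" for A unfolding w_def[abs_def] by (intro continuous_intros)
  \<comment> \<open>Norm continuity makes the operator-valued integrand integrable, so that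
    evaluation at y may be moved inside the integral.\<close>
  have R_cont: "continuous_on {0..2 * pi} (\<lambda>t. resolvent (K_op a) (w t))"
    unfolding continuous_on_def
  proof
    fix t
    have "((\<lambda>s. C * C * cmod (w s - w t)) \<longlongrightarrow> C * C * cmod (w t - w t)) (at t within {0..2 * pi})"
      by (intro tendsto_intros) (use w_cont[of UNIV] in \<open>auto simp: continuous_on_eq_continuous_at isCont_def intro: tendsto_within_subset\<close>)
    then have "((\<lambda>s. C * C * cmod (w s - w t)) \<longlongrightarrow> 0) (at t within {0..2 * pi})" by simp
    then have "((\<lambda>s. resolvent (K_op a) (w s) - resolvent (K_op a) (w t)) \<longlongrightarrow> 0) (at t within {0..2 * pi})"
      by (rule Lim_null_comparison[rotated]) (use resolvent_lipschitz[OF R(1) R(1) R(2) R(2) C] in auto)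
    then show "((\<lambda>t. resolvent (K_op a) (w t)) \<longlongrightarrow> resolvent (K_op a) (w t)) (at t within {0..2 * pi})"
      by (rule LIM_zero_cancel)
  qed
  define F where "F t = scale_blinfun (\<i> * of_real \<epsilon> * cis t) (resolvent (K_op a) (w t))" for t
  have "continuous_on {0..2 * pi} F"
    unfolding F_def[abs_def]
    by (intro bounded_bilinear.continuous_on[OF bounded_bilinear_scale_blinfun] R_cont continuous_intros)
  then have F_int: "F integrable_on {0..2 * pi}" by (rule integrable_continuous_real)
  define c where "c t = \<i> * of_real \<epsilon> * cis t / (\<nu> - w t)" for t
  have Fy: "blinfun_apply (F t) y = c t *\<^sub>C y" for t
  proof -
    have "\<nu> \<noteq> w t"
    proof
      assume "\<nu> = w t"
      then have "\<nu> \<in> cball z \<epsilon>" "\<nu> \<noteq> z" using wz[of t] \<epsilon> by (auto simp: dist_norm norm_minus_commute)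
      then show False using sep \<nu> by auto
    qed
    then show ?thesis by (simp add: F_def scale_blinfun_apply resolvent_eigvec[OF R(1) y] c_def)
  qed
  \<comment> \<open>At the centre, \<nu> - w t = - \<epsilon> cis t, so the integrand is the
    constant - i; the prefactor i / (2 pi) of the projector turns the integral - 2 pi i into
    1.\<close>
  have c_int: "(c has_integral (if \<nu> = z then - 2 * pi * \<i> else 0)) {0..2 * pi}"
  proof (cases "\<nu> = z")
    case True
    have "c t = - \<i>" for t using \<epsilon> by (simp add: c_def w_def True)
    then have "c = (\<lambda>_. - \<i>)" by (simp add: fun_eq_iff)
    then show ?thesis using has_integral_const_real[of "- \<i>" 0 "2 * pi"] True
      by (simp add: scaleR_conv_of_real mult_ac)
  next
    case False
    then have "\<nu> \<notin> cball z \<epsilon>" using sep \<nu> by auto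
    then have "\<epsilon> < cmod (\<nu> - z)" by (simp add: dist_norm norm_minus_commute)
    from circle_integral_outside[OF \<epsilon> this] False show ?thesis
      by (simp add: c_def[abs_def] w_def diff_diff_eq)
  qed
  have "blinfun_apply (riesz_projector (K_op a) z \<epsilon>) y = (\<i> / (2 * of_real pi)) *\<^sub>C blinfun_apply (integral {0..2 * pi} F) y"
    by (simp add: riesz_projector_def scale_blinfun_apply F_def[abs_def] w_def)
  also have "blinfun_apply (integral {0..2 * pi} F) y = integral {0..2 * pi} (\<lambda>t. c t *\<^sub>C y)"
    using blinfun_apply_integral[OF F_int] Fy by simp
  also have "\<dots> = (if \<nu> = z then - 2 * pi * \<i> else 0) *\<^sub>C y"
    using has_integral_linear[OF c_int bounded_linear_scaleC_left] by (intro integral_unique) (simp add: o_def)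
  finally show ?thesis by auto
qed

section \<open>Range and rank of the Riesz projectors\<close>

definition eigpairs :: "complex \<Rightarrow> (nat \<times> nat) set" where
  "eigpairs z = {(n, k). k \<le> n \<and> lam n k = z}"

lemma finite_eigpairs: "finite (eigpairs z)"
  by (rule finite_subset[OF _ finite_eigs_le[of "Re z"]]) (auto simp: eigpairs_def)

lemma eigpairs_same_level:
  assumes "(n, k) \<in> eigpairs z" "(n, k') \<in> eigpairs z" shows "k = k'"
proof -
  have "lam n k = lam n k'" using assms by (simp add: eigpairs_def)
  then have "(of_nat k - of_nat k') * (mp - mm) = 0"
    using assms by (simp add: lam_def eigpairs_def of_nat_diff algebra_simps)
  then show ?thesis using mu_neq by simp
qed

text \<open>Every vector of the span satisfies K y = z y and is fixed by the projector. Conversely,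
  the projector is applied termwise to the expansion of f; only the finitely many levels carrying
  the eigenvalue z contribute, so the image lies in the algebraic span and no closure
  appears.\<close>

lemma range_riesz_projector:
  assumes \<epsilon>: "\<epsilon> > 0" and sep: "cball z \<epsilon> \<inter> eigs \<subseteq> {z}" and z: "z \<in> eigs"
  shows "range (blinfun_apply (riesz_projector (K_op a) z \<epsilon>)) = L2_span ((\<lambda>(n, k). eigvec n k) ` eigpairs z)"
    (is "range ?P = L2_span ?B")
proof (intro equalityI subsetI)
  fix y assume "y \<in> L2_span ?B"
  then have "K_graph a y (z *\<^sub>C y)"
  proof (induction rule: L2.span_induct_alt)
    case base
    have "Kpoly n 0 = 0" for n by (simp add: Kpoly_def)
    moreover have "pn n 0 = 0" for n using pn_add[of n 0 0] by simp
    ultimately show ?case by (simp add: K_graph_iff)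
  next
    case (step c x y)
    then have "K_graph a x (z *\<^sub>C x)" using K_graph_eigvec by (auto simp: eigpairs_def)
    from K_graph_add[OF K_graph_scaleC[OF this, of c] step(2)] show ?case
      by (simp add: L2.scale_right_distrib mult.commute)
  qed
  from riesz_projector_apply[OF \<epsilon> sep this z] have "?P y = y" by simp
  then show "y \<in> range ?P" by (metis rangeI)
next
  fix y assume "y \<in> range ?P"
  then obtain f where y: "y = ?P f" by blast
  define g where "g n = ?P (Jn n (pn n f))" for n
  have g: "g n = (\<Sum>k\<le>n. if lam n k = z then eigcoef n (pn n f) k *\<^sub>C eigvec n k else 0)" for n
  proof -
    have "Jn n (pn n f) = (\<Sum>k\<le>n. eigcoef n (pn n f) k *\<^sub>C eigvec n k)"
      using Jn_fcalc[of n "\<lambda>_. 1" "pn n f"] by (simp add: fcalc_1 degree_pn eigvec_def)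
    then have "g n = (\<Sum>k\<le>n. ?P (eigcoef n (pn n f) k *\<^sub>C eigvec n k))"
      by (simp add: g_def blinfun.sum_right)
    also have "\<dots> = (\<Sum>k\<le>n. if lam n k = z then eigcoef n (pn n f) k *\<^sub>C eigvec n k else 0)"
    proof (intro sum.cong refl)
      fix k assume k: "k \<in> {..n}"
      then have "K_graph a (eigcoef n (pn n f) k *\<^sub>C eigvec n k) (lam n k *\<^sub>C (eigcoef n (pn n f) k *\<^sub>C eigvec n k))"
        using K_graph_scaleC[OF K_graph_eigvec[of k n], of "eigcoef n (pn n f) k"] by (simp add: mult.commute)
      moreover have "lam n k \<in> eigs" using k by (auto simp: eigs_def)
      ultimately show "?P (eigcoef n (pn n f) k *\<^sub>C eigvec n k) = (if lam n k = z then eigcoef n (pn n f) k *\<^sub>C eigvec n k else 0)"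
        by (rule riesz_projector_apply[OF \<epsilon> sep])
    qed
    finally show ?thesis .
  qed
  have "g sums y"
    unfolding g_def y by (rule bounded_linear.sums[OF blinfun.bounded_linear_right expansion_sums])
  moreover have "g n = 0" if "n \<notin> fst ` eigpairs z" for n
    unfolding g using that by (intro sum.neutral) (force simp: eigpairs_def)
  then have "g sums (\<Sum>n\<in>fst ` eigpairs z. g n)"
    by (intro sums_finite finite_imageI finite_eigpairs) auto
  ultimately have "y = (\<Sum>n\<in>fst ` eigpairs z. g n)" by (rule sums_unique2)
  also have "\<dots> \<in> L2_span ?B"
    unfolding g
  proof (intro L2.span_sum)
    fix n k :: nat assume k: "k \<in> {..n}"
    show "(if lam n k = z then eigcoef n (pn n f) k *\<^sub>C eigvec n k else 0) \<in> L2_span ?B"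
    proof (cases "lam n k = z")
      case True
      then have "eigvec n k \<in> ?B" using k by (force simp: eigpairs_def)
      then show ?thesis using True by (simp add: L2.span_scale L2.span_base)
    qed (simp add: L2.span_zero)
  qed
  finally show "y \<in> L2_span ?B" .
qed

lemma pn_sum: "pn n (\<Sum>i\<in>I. f i) = (\<Sum>i\<in>I. pn n (f i))"
proof -
  have "pn n 0 = 0" using pn_add[of n 0 0] by simp
  then show ?thesis by (induction I rule: infinite_finite_induct) (simp_all add: pn_add)
qed

lemma eigvec_inj: "inj_on (\<lambda>(n, k). eigvec n k) (eigpairs z)"
proof (rule inj_onI, clarify)
  fix n k n' k' assume *: "(n, k) \<in> eigpairs z" "(n', k') \<in> eigpairs z" "eigvec n k = eigvec n' k'"
  then have le: "k \<le> n" "k' \<le> n'" by (simp_all add: eigpairs_def)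
  have "eigpoly n k = (if n = n' then eigpoly n' k' else 0)"
    using pn_eigvec[OF le(1), of n] pn_eigvec[OF le(2), of n] *(3) by simp
  then have "n = n'" using eigpoly_nonzero[of n k] by presburger
  with * eigpairs_same_level show "n = n' \<and> k = k'" by blast
qed

text \<open>Distinct eigenvectors for the same z sit on distinct levels, so projecting a vanishing
  combination to one level isolates a single coefficient.\<close>

lemma independent_eigvec: "L2.independent ((\<lambda>(n, k). eigvec n k) ` eigpairs z)"
  unfolding L2.independent_explicit_finite_subsets
proof (intro allI impI ballI)
  fix S u v
  assume S: "S \<subseteq> (\<lambda>(n, k). eigvec n k) ` eigpairs z" "finite S" and sum0: "(\<Sum>v\<in>S. u v *\<^sub>C v) = 0" and v: "v \<in> S"
  then obtain n k where nk: "(n, k) \<in> eigpairs z" "v = eigvec n k" by auto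
  have other: "pn n x = 0" if "x \<in> S - {v}" for x
  proof -
    have "x \<in> (\<lambda>(n, k). eigvec n k) ` eigpairs z" using that S by blast
    then obtain n' k' where x: "(n', k') \<in> eigpairs z" "x = eigvec n' k'" by auto
    then have "n' \<noteq> n" using that nk eigpairs_same_level by blast
    then show ?thesis using x by (auto simp: pn_eigvec eigpairs_def)
  qed
  have "0 = pn n (\<Sum>v\<in>S. u v *\<^sub>C v)" using sum0 pn_add[of n 0 0] by simp
  also have "\<dots> = (\<Sum>v\<in>S. smult (u v) (pn n v))" by (simp add: pn_sum pn_scaleC)
  also have "\<dots> = smult (u v) (pn n v) + (\<Sum>v\<in>S - {v}. smult (u v) (pn n v))"
    using S v by (intro sum.remove) auto
  also have "\<dots> = smult (u v) (eigpoly n k)"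
    using other nk by (simp add: pn_eigvec eigpairs_def)
  finally show "u v = 0" using eigpoly_nonzero[of n k] by simp
qed

lemma alg_mult_K_op:
  assumes z: "z \<in> eigs" shows "alg_mult (K_op a) z = enat (card (eigpairs z))"
proof -
  define \<epsilon> where "\<epsilon> = (SOME \<epsilon>. \<epsilon> > 0 \<and> cball z \<epsilon> \<inter> spectrum (K_op a) \<subseteq> {z})"
  \<comment> \<open>An admissible radius has to exist before the one picked by \<open>SOME\<close>
    is known to be admissible; the range computed above is the same for every such radius.\<close>
  obtain \<delta> where \<delta>: "\<delta> > 0" "\<And>n k. k \<le> n \<Longrightarrow> lam n k \<noteq> z \<Longrightarrow> \<delta> \<le> cmod (lam n k - z)"
    using eigs_discrete[of z] by metis
  have "cball z (\<delta> / 2) \<inter> eigs \<subseteq> {z}"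
  proof clarify
    fix x assume x: "x \<in> cball z (\<delta> / 2)" "x \<in> eigs"
    then obtain n k where "k \<le> n" "x = lam n k" by (auto simp: eigs_def)
    with \<delta>(2)[of k n] x(1) \<delta>(1) show "x = z" by (force simp: dist_norm norm_minus_commute)
  qed
  then have "\<exists>\<epsilon>. \<epsilon> > 0 \<and> cball z \<epsilon> \<inter> spectrum (K_op a) \<subseteq> {z}"
    using \<delta>(1) by (intro exI[of _ "\<delta> / 2"]) (simp add: spectrum_K_op)
  from someI_ex[OF this] have "\<epsilon> > 0 \<and> cball z \<epsilon> \<inter> spectrum (K_op a) \<subseteq> {z}"
    unfolding \<epsilon>_def .
  then have "\<epsilon> > 0" "cball z \<epsilon> \<inter> eigs \<subseteq> {z}" by (simp_all add: spectrum_K_op)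
  note range = range_riesz_projector[OF this z]
  let ?B = "(\<lambda>(n, k). eigvec n k) ` eigpairs z"
  have "finite ?B" by (intro finite_imageI finite_eigpairs)
  then have "op_rank (riesz_projector (K_op a) z \<epsilon>) = enat (L2_dim (L2_span ?B))"
    unfolding op_rank_def range by auto
  also have "L2_dim (L2_span ?B) = card ?B" by (rule L2.dim_span_eq_card_independent[OF independent_eigvec])
  also have "\<dots> = card (eigpairs z)" by (rule card_image[OF eigvec_inj])
  finally show ?thesis by (simp add: alg_mult_def \<epsilon>_def)
qed

section \<open>Translation to pairs of quantum numbers and counting\<close>

definition modes :: "complex \<Rightarrow> (nat \<times> nat) set" where
  "modes z = {(k, l). of_nat k * mp + of_nat l * mm = z}"

lemma bij_modes: "bij_betw (\<lambda>(k, l). (k + l, k)) (modes z) (eigpairs z)"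
proof (rule bij_betwI[where g = "\<lambda>(n, k). (k, n - k)"])
  show "(\<lambda>(k, l). (k + l, k)) \<in> modes z \<rightarrow> eigpairs z"
    by (auto simp: modes_def eigpairs_def lam_def)
  show "(\<lambda>(n, k). (k, n - k)) \<in> eigpairs z \<rightarrow> modes z"
    by (auto simp: modes_def eigpairs_def lam_def)
qed (auto simp: eigpairs_def)

lemma finite_modes: "finite (modes z)" and card_modes: "card (modes z) = card (eigpairs z)"
  using bij_betw_finite[OF bij_modes] finite_eigpairs bij_betw_same_card[OF bij_modes] by auto

lemma eigs_modes: "eigs = {of_nat k * mp + of_nat l * mm |k l. True}"
proof (intro equalityI subsetI)
  fix x assume "x \<in> eigs"
  then show "x \<in> {of_nat k * mp + of_nat l * mm |k l. True}" by (auto simp: eigs_def lam_def)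
next
  fix x assume "x \<in> {of_nat k * mp + of_nat l * mm |k l. True}"
  then obtain k l where "x = of_nat k * mp + of_nat l * mm" by blast
  then have "x = lam (k + l) k" by (simp add: lam_def)
  then show "x \<in> eigs" unfolding eigs_def by (intro CollectI exI[of _ "k + l"] exI[of _ k]) simp
qed

lemma alg_mult_modes: "z \<in> eigs \<Longrightarrow> alg_mult (K_op a) z = ecard (modes z)"
  by (simp add: alg_mult_K_op ecard_def finite_modes card_modes)

lemma sum_enat: "(\<Sum>z\<in>F. enat (f z)) = enat (\<Sum>z\<in>F. f z)"
  by (induction F rule: infinite_finite_induct) (auto simp: zero_enat_def)

text \<open>Only finitely many eigenvalues have real part at most r, so the supremum over finite
  subsets is attained at the full set; the fibres \<open>modes z\<close> partition the pairs to be
  counted.\<close>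

lemma eigenvalue_counting_K_op:
  "eigenvalue_counting (K_op a) r = ecard {(k, l). Re (of_nat k * mp + of_nat l * mm) \<le> r}"
proof -
  define Q where "Q = {(k, l). Re (of_nat k * mp + of_nat l * mm) \<le> r}"
  define S where "S = {z \<in> eigs. Re z \<le> r}"
  have "S = (\<lambda>(n, k). lam n k) ` {(n, k). k \<le> n \<and> Re (lam n k) \<le> r}" by (auto simp: S_def eigs_def)
  then have finS: "finite S" using finite_eigs_le by simp
  have Q: "Q = (\<Union>z\<in>S. modes z)"
  proof (rule set_eqI)
    fix p :: "nat \<times> nat"
    obtain k l where p: "p = (k, l)" by (cases p)
    have "of_nat k * mp + of_nat l * mm \<in> eigs" unfolding eigs_modes by blast
    then have "p \<in> Q \<longleftrightarrow> of_nat k * mp + of_nat l * mm \<in> S" by (simp add: p Q_def S_def)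
    also have "\<dots> \<longleftrightarrow> p \<in> (\<Union>z\<in>S. modes z)" by (auto simp: p modes_def)
    finally show "p \<in> Q \<longleftrightarrow> p \<in> (\<Union>z\<in>S. modes z)" .
  qed
  then have finQ: "finite Q" using finS finite_modes by simp
  have sum: "(\<Sum>z\<in>F. alg_mult (K_op a) z) = enat (\<Sum>z\<in>F. card (modes z))" if "F \<subseteq> S" for F
    unfolding sum_enat[symmetric] using that
    by (intro sum.cong refl) (auto simp: S_def alg_mult_K_op card_modes)
  have "(\<Sum>z\<in>S. card (modes z)) = card Q"
    unfolding Q using finS finite_modes by (intro card_UN_disjoint[symmetric]) (auto simp: modes_def)
  with sum[of S] have top: "(\<Sum>z\<in>S. alg_mult (K_op a) z) = enat (card Q)" by simp
  have "eigenvalue_counting (K_op a) r = (\<Sum>z\<in>S. alg_mult (K_op a) z)"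
    unfolding eigenvalue_counting_def spectrum_K_op S_def[symmetric]
  proof (intro antisym SUP_least SUP_upper)
    fix F assume F: "F \<in> {F. finite F \<and> F \<subseteq> S}"
    then have "(\<Sum>z\<in>F. card (modes z)) \<le> (\<Sum>z\<in>S. card (modes z))" using finS by (intro sum_mono2) auto
    with sum[of F] sum[of S] F show "(\<Sum>z\<in>F. alg_mult (K_op a) z) \<le> (\<Sum>z\<in>S. alg_mult (K_op a) z)" by simp
  qed (use finS in auto)
  then show ?thesis using finQ top by (simp add: ecard_def Q_def)
qed

end

text \<open>For a < 1/4 the condition Re mm > 0 amounts to q < 1, that is a > 0; for a > 1/4 both
  real parts are 1/2. In both cases q > 0 separates the roots.\<close>

lemma kfp_mu:
  assumes "a > 0" "a \<noteq> 1 / 4"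
    and "mp = (if a < 1 / 4 then (1 + of_real (sqrt (1 - 4 * a))) / 2
                  else (1 + \<i> * of_real (sqrt (4 * a - 1))) / 2)"
    and "mm = (if a < 1 / 4 then (1 - of_real (sqrt (1 - 4 * a))) / 2
                  else (1 - \<i> * of_real (sqrt (4 * a - 1))) / 2)"
  shows "kfp a mp mm"
proof (cases "a < 1 / 4")
  case True
  define q where "q = sqrt (1 - 4 * a)"
  have q: "q > 0" "q < 1" "q * q = 1 - 4 * a" using True assms(1) by (auto simp: q_def)
  have mp: "mp = of_real ((1 + q) / 2)" and mm: "mm = of_real ((1 - q) / 2)"
    using True assms(3,4) by (simp_all add: q_def)
  have "(1 + q) / 2 * ((1 - q) / 2) = a" using q(3) by (simp add: field_simps)
  then have "mp * mm = of_real a" unfolding mp mm of_real_mult[symmetric] by simp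
  moreover have "mp + mm = 1" unfolding mp mm of_real_add[symmetric] by (simp add: field_simps)
  moreover have "mp \<noteq> mm" unfolding mp mm of_real_eq_iff using q by simp
  ultimately show ?thesis using assms(1) q by unfold_locales (simp_all add: mp mm)
next
  case False
  define q where "q = sqrt (4 * a - 1)"
  have q: "q > 0" "q * q = 4 * a - 1" using False assms(2) by (auto simp: q_def)
  have mp: "mp = Complex (1 / 2) (q / 2)" and mm: "mm = Complex (1 / 2) (- q / 2)"
    using False assms(3,4) by (simp_all add: q_def complex_eq_iff)
  have "mp * mm = of_real a" using q(2) by (simp add: mp mm complex_eq_iff field_simps)
  then show ?thesis using assms(1) q by unfold_locales (simp_all add: mp mm complex_eq_iff)
qed

theorem theoremC6:
  fixes a :: real and \<mu>\<^sub>p \<mu>\<^sub>m :: complex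
  assumes "a > 0" and "a \<noteq> 1 / 4"
    and "\<mu>\<^sub>p = (if a < 1 / 4 then (1 + of_real (sqrt (1 - 4 * a))) / 2
                  else (1 + \<i> * of_real (sqrt (4 * a - 1))) / 2)"
    and "\<mu>\<^sub>m = (if a < 1 / 4 then (1 - of_real (sqrt (1 - 4 * a))) / 2
                  else (1 - \<i> * of_real (sqrt (4 * a - 1))) / 2)"
  shows "spectrum (K_op a) = {of_nat k * \<mu>\<^sub>p + of_nat l * \<mu>\<^sub>m |k l :: nat. True}
    \<and> (\<forall>z\<in>spectrum (K_op a).
         alg_mult (K_op a) z = ecard {(k :: nat, l :: nat). of_nat k * \<mu>\<^sub>p + of_nat l * \<mu>\<^sub>m = z})
    \<and> (\<forall>r. eigenvalue_counting (K_op a) r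
         = ecard {(k :: nat, l :: nat). Re (of_nat k * \<mu>\<^sub>p + of_nat l * \<mu>\<^sub>m) \<le> r})"
proof -
  interpret kfp a \<mu>\<^sub>p \<mu>\<^sub>m by (rule kfp_mu[OF assms])
  show ?thesis
    using alg_mult_modes eigenvalue_counting_K_op unfolding spectrum_K_op modes_def eigs_modes by blast
qed

end
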